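(* Let $(\Sigma_1,\gamma_1)$ and $(\Sigma_2,\gamma_2)$ be closed positive Einstein manifolds of dimensions $n_1$ and $n_2$, let $n=n_1+n_2+1$, and let the metrics be normalized so that $\mathrm{Rc}(\gamma_1)=(n-2)\gamma_1$ and $\mathrm{Rc}(\gamma_2)=(n-2)\gamma_2$, so that the $n$-dimensional Riemannian cone $C(\Sigma_1\times\Sigma_2)$ over $(\Sigma_1\times\Sigma_2,\gamma_1+\gamma_2)$ is Ricci-flat. If $n<10$, then the Ricci-flat cone $C(\Sigma_1\times\Sigma_2)$ is unstable.
   Context: For a closed Riemannian manifold $(\Sigma,\gamma)$ of dimension $n-1$, the Riemannian cone over it is $C(\Sigma)=C(\Sigma,\gamma)=(\mathbb{R}_{+}\times\Sigma,\ dr^2+r^2\gamma)$, where $\mathbb{R}_+=(0,\infty)$. It is Ricci-flat if and only if $\mathrm{Rc}(\gamma)=(n-2)\gamma$. A Ricci-flat manifold or cone $(M,g)$ is called stable if $$\int_M 2\,\mathrm{Rm}(h,h)\,dV\le\int_M|\nabla h|^2\,dV$$ for all transverse symmetric 2-tensors $h$ with compact support, and unstable if it is not stable. Here $h$ is transverse if $\nabla_i h_{ij}=0$, and $\mathrm{Rm}(h,h)=R_{ijkl}h_{ik}h_{jl}$, with the curvature sign convention that for orthonormal $e_i,e_j$ with $i\ne j$, $\mathrm{Rm}(e_i,e_j,e_i,e_j)=R_{ijij}$ is the sectional curvature (positive on round spheres). On a cone, all variations $h$ are supported away from the tip, i.e. have compact support in $\mathbb{R}_+\times\Sigma$. *)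

theory Defs
  imports "HOL-Analysis.Analysis"
begin

section \<open>Smooth maps between Euclidean spaces\<close>

primrec Ck_on :: "nat \<Rightarrow> 'a::real_normed_vector set \<Rightarrow> ('a \<Rightarrow> 'b::real_normed_vector) \<Rightarrow> bool" where
  "Ck_on 0 S f \<longleftrightarrow> continuous_on S f"
| "Ck_on (Suc k) S f \<longleftrightarrow>
     (\<forall>x\<in>S. f differentiable (at x)) \<and> (\<forall>v. Ck_on k S (\<lambda>x. frechet_derivative f (at x) v))"

text \<open>Only used for open \<open>S\<close>.\<close>

definition smooth_on :: "'a::real_normed_vector set \<Rightarrow> ('a \<Rightarrow> 'b::real_normed_vector) \<Rightarrow> bool" where
  "smooth_on S f \<longleftrightarrow> (\<forall>k. Ck_on k S f)"


section \<open>Manifolds and symmetric 2-tensor fields\<close>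

text \<open>
  A manifold is given by an atlas indexed by a type \<open>'i\<close>. Its points form the subset
  \<open>points M\<close> of a second countable Hausdorff type, and its dimension is \<open>CARD('n)\<close>.
  The values of \<open>chart M c\<close> outside \<open>chart_dom M c\<close> are irrelevant.
\<close>

record ('i, 'a, 'n) atlas =
  chart_dom :: "'i \<Rightarrow> 'a set"
  chart :: "'i \<Rightarrow> 'a \<Rightarrow> real^'n"

definition points :: "('i, 'a, 'n::finite) atlas \<Rightarrow> 'a set" where
  "points M = (\<Union>c. chart_dom M c)"

definition chart_img :: "('i, 'a, 'n::finite) atlas \<Rightarrow> 'i \<Rightarrow> (real^'n) set" where
  "chart_img M c = chart M c ` chart_dom M c"

definition transition :: "('i, 'a, 'n::finite) atlas \<Rightarrow> 'i \<Rightarrow> 'i \<Rightarrow> real^'n \<Rightarrow> real^'n" where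
  "transition M c d = chart M d \<circ> inv_into (chart_dom M c) (chart M c)"

definition smooth_manifold ::
  "('i, 'a::{t2_space, second_countable_topology}, 'n::finite) atlas \<Rightarrow> bool" where
  "smooth_manifold M \<longleftrightarrow>
     (\<forall>c. openin (top_of_set (points M)) (chart_dom M c) \<and>
          open (chart_img M c) \<and>
          homeomorphism (chart_dom M c) (chart_img M c)
            (chart M c) (inv_into (chart_dom M c) (chart M c))) \<and>
     (\<forall>c d. smooth_on (chart M c ` (chart_dom M c \<inter> chart_dom M d)) (transition M c d))"

text \<open>
  A 2-tensor field is the family of its component matrices: \<open>h c x $ i $ j\<close> is \<open>h\<^sub>i\<^sub>j\<close> in the
  chart \<open>c\<close>, as a function of the coordinates \<open>x \<in> chart_img M c\<close> (other values of \<open>x\<close> are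
  irrelevant). The last clause is the transformation law of covariant tensors.
\<close>

type_synonym ('i, 'n) tensor2 = "'i \<Rightarrow> real^'n \<Rightarrow> real^'n^'n"

definition sym_tensor_field :: "('i, 'a, 'n::finite) atlas \<Rightarrow> ('i, 'n) tensor2 \<Rightarrow> bool" where
  "sym_tensor_field M h \<longleftrightarrow>
     (\<forall>c. smooth_on (chart_img M c) (h c)) \<and>
     (\<forall>c. \<forall>x\<in>chart_img M c. transpose (h c x) = h c x) \<and>
     (\<forall>c d. \<forall>x\<in>chart M c ` (chart_dom M c \<inter> chart_dom M d).
        h c x = transpose (jacobian (transition M c d) (at x)) ** h d (transition M c d x)
                  ** jacobian (transition M c d) (at x))"

definition compact_support ::
  "('i, 'a::topological_space, 'n::finite) atlas \<Rightarrow> ('i, 'n) tensor2 \<Rightarrow> bool" where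
  "compact_support M h \<longleftrightarrow>
     (\<exists>K. compact K \<and> K \<subseteq> points M \<and> (\<forall>c. \<forall>p\<in>chart_dom M c - K. h c (chart M c p) = 0))"

definition riemannian_manifold ::
  "('i, 'a::{t2_space, second_countable_topology}, 'n::finite) atlas \<Rightarrow> ('i, 'n) tensor2 \<Rightarrow> bool" where
  "riemannian_manifold M g \<longleftrightarrow>
     smooth_manifold M \<and> sym_tensor_field M g \<and>
     (\<forall>c. \<forall>x\<in>chart_img M c. \<forall>v. v \<noteq> 0 \<longrightarrow> v \<bullet> (g c x *v v) > 0)"

text \<open>Charts map onto open sets of \<open>real^'n\<close>, so there is no boundary.\<close>

definition closed_riemannian_manifold ::
  "('i, 'a::{t2_space, second_countable_topology}, 'n::finite) atlas \<Rightarrow> ('i, 'n) tensor2 \<Rightarrow> bool" where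
  "closed_riemannian_manifold M g \<longleftrightarrow>
     riemannian_manifold M g \<and> compact (points M) \<and> points M \<noteq> {}"


section \<open>Levi-Civita connection and curvature in coordinates\<close>

text \<open>
  In this section \<open>g\<close> and \<open>h\<close> are the component matrices of a metric and of a symmetric
  2-tensor in one fixed chart.
\<close>

definition pd :: "'n::finite \<Rightarrow> (real^'n \<Rightarrow> real) \<Rightarrow> real^'n \<Rightarrow> real" where
  "pd i f x = frechet_derivative f (at x) (axis i 1)"

definition ginv :: "(real^'n \<Rightarrow> real^'n^'n) \<Rightarrow> real^'n \<Rightarrow> 'n::finite \<Rightarrow> 'n \<Rightarrow> real" where
  "ginv g x i j = matrix_inv (g x) $ i $ j"

text \<open>\<open>christoffel g k i j\<close> has upper index \<open>k\<close>.\<close>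

definition christoffel ::
  "(real^'n \<Rightarrow> real^'n^'n) \<Rightarrow> 'n::finite \<Rightarrow> 'n \<Rightarrow> 'n \<Rightarrow> real^'n \<Rightarrow> real" where
  "christoffel g k i j x =
     (1/2) * (\<Sum>l\<in>UNIV. ginv g x k l *
        (pd i (\<lambda>y. g y $ j $ l) x + pd j (\<lambda>y. g y $ i $ l) x - pd l (\<lambda>y. g y $ i $ j) x))"

text \<open>
  \<open>riemann_up g m i j l\<close> is the \<open>m\<close>-th component of
  \<open>\<nabla>\<^sub>i\<nabla>\<^sub>j\<partial>\<^sub>l - \<nabla>\<^sub>j\<nabla>\<^sub>i\<partial>\<^sub>l\<close>, and \<open>R\<^sub>i\<^sub>j\<^sub>k\<^sub>l\<close> is the inner product of this vector with \<open>\<partial>\<^sub>k\<close>.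
  With this convention \<open>R\<^sub>i\<^sub>j\<^sub>i\<^sub>j\<close> is the sectional curvature in orthonormal frames.
\<close>

definition riemann_up ::
  "(real^'n \<Rightarrow> real^'n^'n) \<Rightarrow> 'n::finite \<Rightarrow> 'n \<Rightarrow> 'n \<Rightarrow> 'n \<Rightarrow> real^'n \<Rightarrow> real" where
  "riemann_up g m i j l x =
     pd i (christoffel g m j l) x - pd j (christoffel g m i l) x +
     (\<Sum>p\<in>UNIV. christoffel g p j l x * christoffel g m i p x
             - christoffel g p i l x * christoffel g m j p x)"

definition riemann ::
  "(real^'n \<Rightarrow> real^'n^'n) \<Rightarrow> 'n::finite \<Rightarrow> 'n \<Rightarrow> 'n \<Rightarrow> 'n \<Rightarrow> real^'n \<Rightarrow> real" where
  "riemann g i j k l x = (\<Sum>m\<in>UNIV. g x $ k $ m * riemann_up g m i j l x)"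

definition ricci :: "(real^'n \<Rightarrow> real^'n^'n) \<Rightarrow> real^'n \<Rightarrow> real^'n^'n::finite" where
  "ricci g x = (\<chi> j l. \<Sum>i\<in>UNIV. \<Sum>k\<in>UNIV. ginv g x i k * riemann g i j k l x)"

text \<open>\<open>cov_deriv g h k i j\<close> is \<open>\<nabla>\<^sub>k h\<^sub>i\<^sub>j\<close>.\<close>

definition cov_deriv ::
  "(real^'n \<Rightarrow> real^'n^'n) \<Rightarrow> (real^'n \<Rightarrow> real^'n^'n) \<Rightarrow> 'n::finite \<Rightarrow> 'n \<Rightarrow> 'n \<Rightarrow> real^'n \<Rightarrow> real" where
  "cov_deriv g h k i j x =
     pd k (\<lambda>y. h y $ i $ j) x
     - (\<Sum>m\<in>UNIV. christoffel g m k i x * h x $ m $ j + christoffel g m k j x * h x $ i $ m)"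

definition divergence ::
  "(real^'n \<Rightarrow> real^'n^'n) \<Rightarrow> (real^'n \<Rightarrow> real^'n^'n) \<Rightarrow> 'n::finite \<Rightarrow> real^'n \<Rightarrow> real" where
  "divergence g h j x = (\<Sum>k\<in>UNIV. \<Sum>i\<in>UNIV. ginv g x k i * cov_deriv g h k i j x)"

definition norm_cov_deriv_sq ::
  "(real^'n \<Rightarrow> real^'n^'n) \<Rightarrow> (real^'n \<Rightarrow> real^'n^'n) \<Rightarrow> real^'n::finite \<Rightarrow> real" where
  "norm_cov_deriv_sq g h x =
     (\<Sum>k\<in>UNIV. \<Sum>i\<in>UNIV. \<Sum>j\<in>UNIV. \<Sum>k'\<in>UNIV. \<Sum>i'\<in>UNIV. \<Sum>j'\<in>UNIV.
        ginv g x k k' * ginv g x i i' * ginv g x j j' *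
        cov_deriv g h k i j x * cov_deriv g h k' i' j' x)"

text \<open>\<open>raise g h i j\<close> is \<open>h\<close> with both indices raised.\<close>

definition raise ::
  "(real^'n \<Rightarrow> real^'n^'n) \<Rightarrow> (real^'n \<Rightarrow> real^'n^'n) \<Rightarrow> 'n::finite \<Rightarrow> 'n \<Rightarrow> real^'n \<Rightarrow> real" where
  "raise g h i j x = (\<Sum>a\<in>UNIV. \<Sum>b\<in>UNIV. ginv g x i a * ginv g x j b * h x $ a $ b)"

definition Rm ::
  "(real^'n \<Rightarrow> real^'n^'n) \<Rightarrow> (real^'n \<Rightarrow> real^'n^'n) \<Rightarrow> real^'n::finite \<Rightarrow> real" where
  "Rm g h x =
     (\<Sum>i\<in>UNIV. \<Sum>j\<in>UNIV. \<Sum>k\<in>UNIV. \<Sum>l\<in>UNIV.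
        riemann g i j k l x * raise g h i k x * raise g h j l x)"


section \<open>Einstein metrics, Riemannian volume, stability\<close>

definition einstein :: "('i, 'a, 'n::finite) atlas \<Rightarrow> ('i, 'n) tensor2 \<Rightarrow> real \<Rightarrow> bool" where
  "einstein M g \<Lambda> \<longleftrightarrow> (\<forall>c. \<forall>x\<in>chart_img M c. ricci (g c) x = \<Lambda> *\<^sub>R g c x)"

definition ricci_flat :: "('i, 'a, 'n::finite) atlas \<Rightarrow> ('i, 'n) tensor2 \<Rightarrow> bool" where
  "ricci_flat M g \<longleftrightarrow> (\<forall>c. \<forall>x\<in>chart_img M c. ricci (g c) x = 0)"

text \<open>
  The Riemannian volume is the unique Borel measure on \<open>points M\<close> with density
  \<open>sqrt (det g)\<close> in every chart.
\<close>

definition riemannian_volume ::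
  "('i, 'a::topological_space, 'n::finite) atlas \<Rightarrow> ('i, 'n) tensor2 \<Rightarrow> 'a measure" where
  "riemannian_volume M g = (THE \<mu>.
     sets \<mu> = sets (restrict_space borel (points M)) \<and>
     (\<forall>c. \<forall>A\<in>sets \<mu>. A \<subseteq> chart_dom M c \<longrightarrow>
        emeasure \<mu> A = (\<integral>\<^sup>+x\<in>chart M c ` A. ennreal (sqrt (det (g c x))) \<partial>lborel)))"

text \<open>
  A scalar field given by its coordinate expressions \<open>s c\<close>, as a function of the point. The
  expressions to which this is applied are full contractions of tensors, so the result does
  not depend on the chart that is chosen.
\<close>

definition scalar_at :: "('i, 'a, 'n::finite) atlas \<Rightarrow> ('i \<Rightarrow> real^'n \<Rightarrow> real) \<Rightarrow> 'a \<Rightarrow> real" where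
  "scalar_at M s p = (let c = (SOME c. p \<in> chart_dom M c) in s c (chart M c p))"

definition transverse ::
  "('i, 'a, 'n::finite) atlas \<Rightarrow> ('i, 'n) tensor2 \<Rightarrow> ('i, 'n) tensor2 \<Rightarrow> bool" where
  "transverse M g h \<longleftrightarrow> (\<forall>c. \<forall>x\<in>chart_img M c. \<forall>j. divergence (g c) (h c) j x = 0)"

definition stable ::
  "('i, 'a::topological_space, 'n::finite) atlas \<Rightarrow> ('i, 'n) tensor2 \<Rightarrow> bool" where
  "stable M g \<longleftrightarrow>
     (\<forall>h. sym_tensor_field M h \<and> compact_support M h \<and> transverse M g h \<longrightarrow>
        (\<integral>p. 2 * scalar_at M (\<lambda>c. Rm (g c) (h c)) p \<partial>riemannian_volume M g)
        \<le> (\<integral>p. scalar_at M (\<lambda>c. norm_cov_deriv_sq (g c) (h c)) p \<partial>riemannian_volume M g))"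

definition unstable ::
  "('i, 'a::topological_space, 'n::finite) atlas \<Rightarrow> ('i, 'n) tensor2 \<Rightarrow> bool" where
  "unstable M g \<longleftrightarrow> \<not> stable M g"


section \<open>Products and cones\<close>

definition product_atlas ::
  "('i, 'a, 'm::finite) atlas \<Rightarrow> ('j, 'b, 'n::finite) atlas \<Rightarrow> ('i \<times> 'j, 'a \<times> 'b, 'm + 'n) atlas" where
  "product_atlas M N =
     \<lparr> chart_dom = (\<lambda>(c, d). chart_dom M c \<times> chart_dom N d),
       chart = (\<lambda>(c, d) (p, q). \<chi> i. case i of Inl a \<Rightarrow> chart M c p $ a | Inr b \<Rightarrow> chart N d q $ b) \<rparr>"

definition product_metric ::
  "('i, 'm::finite) tensor2 \<Rightarrow> ('j, 'n::finite) tensor2 \<Rightarrow> ('i \<times> 'j, 'm + 'n) tensor2" where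
  "product_metric g g' = (\<lambda>(c, d) x. \<chi> i j. case (i, j) of
       (Inl a, Inl b) \<Rightarrow> g c (\<chi> k. x $ Inl k) $ a $ b
     | (Inr a, Inr b) \<Rightarrow> g' d (\<chi> k. x $ Inr k) $ a $ b
     | _ \<Rightarrow> 0)"

text \<open>
  On the cone the coordinate with index \<open>None\<close> is the radius \<open>r\<close>, and the metric is
  \<open>dr\<^sup>2 + r\<^sup>2 \<gamma>\<close>.
\<close>

definition cone_atlas ::
  "('i, 'a, 'n::finite) atlas \<Rightarrow> ('i, real \<times> 'a, 'n option) atlas" where
  "cone_atlas M =
     \<lparr> chart_dom = (\<lambda>c. {0<..} \<times> chart_dom M c),
       chart = (\<lambda>c (r, p). \<chi> i. case i of None \<Rightarrow> r | Some a \<Rightarrow> chart M c p $ a) \<rparr>"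

definition cone_metric :: "('i, 'n::finite) tensor2 \<Rightarrow> ('i, 'n option) tensor2" where
  "cone_metric \<gamma> = (\<lambda>c x. \<chi> i j. case (i, j) of
       (None, None) \<Rightarrow> 1
     | (Some a, Some b) \<Rightarrow> (x $ None)\<^sup>2 * \<gamma> c (\<chi> k. x $ Some k) $ a $ b
     | _ \<Rightarrow> 0)"

end

theory Submission
  imports Defs
begin

text \<open>
  Stretching one factor of the link while shrinking the other destabilises the cone. Let
  \<open>\<Sigma> = \<Sigma>\<^sub>1 \<times> \<Sigma>\<^sub>2\<close> be the link, of dimension \<open>m = n\<^sub>1 + n\<^sub>2 = n - 1\<close>, and
  \<open>A = \<gamma>1 / n\<^sub>1 - \<gamma>2 / n\<^sub>2\<close>. This tensor is parallel (a constant combination of parallel tensors)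
  and trace-free, \<open>\<nu> = |A|\<^sup>2 = 1 / n\<^sub>1 + 1 / n\<^sub>2\<close>, and \<open>Rm(A, A) = (n - 2) \<nu>\<close> by the Einstein condition.
  Test the stability inequality with \<open>h = \<phi>(r) r\<^sup>2 A\<close> for a compactly supported radial function \<open>\<phi>\<close>.
  Since \<open>A\<close> is parallel and trace-free, \<open>h\<close> is transverse; the Gauss equation for the slices
  \<open>r = const\<close> and the relation \<open>\<nabla>\<^sub>X \<partial>\<^sub>r = X / r\<close> give
    \<open>Rm(h, h) = \<nu> (n - 1) \<phi>\<^sup>2 / r\<^sup>2\<close>   and   \<open>|\<nabla>h|\<^sup>2 = \<nu> (\<phi>'\<^sup>2 + 2 \<phi>\<^sup>2 / r\<^sup>2)\<close>
  (\<open>test_tensor_geometry\<close>). The volume of the cone is \<open>r\<^sup>m dr\<close> times the volume of the link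
  (\<open>cone_volume\<close>), so stability would imply the Hardy inequality
    \<open>2 (n - 2) \<integral> \<phi>\<^sup>2 r\<^bsup>n - 3\<^esup> dr \<le> \<integral> \<phi>'\<^sup>2 r\<^bsup>n - 1\<^esup> dr\<close>.
  The optimal Hardy constant is \<open>((n - 2) / 2)\<^sup>2\<close>, which is smaller than \<open>2 (n - 2)\<close> exactly for
  \<open>2 < n < 10\<close>. It is approached by \<open>\<phi>(r) = r\<^bsup>- (n - 2) / 2\<^esup> F(\<epsilon> ln r)\<close> with a fixed bump function \<open>F\<close>
  and \<open>\<epsilon> \<rightarrow> 0\<close>: in the variable \<open>t = \<epsilon> ln r\<close> both sides are integrals over the line, and the terms
  containing \<open>F'\<close> carry a factor \<open>\<epsilon>\<close> (\<open>integral_log_substitution\<close>, \<open>hardy_inequality_fails\<close>).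

  The Ricci tensor of the cone is \<open>Rc(\<gamma>) - (m - 1) \<gamma>\<close> in the link directions and zero otherwise
  (\<open>ricci_cone\<close>), and a product of Einstein metrics with equal constants is Einstein
  (\<open>ricci_product\<close>); this is Ricci-flatness.

  A large part of the work concerns the volume. It is a definite description, so that nothing can
  be said about the integrals before a measure with the prescribed densities is shown to exist and
  to be unique. On each closed factor such a measure is glued from finitely many chart pieces
  (\<open>volume_exists\<close>), which is consistent by the change of variables formula
  (\<open>chart_vol_chart_change\<close>). On the cone the product measure with density \<open>r\<^sup>m\<close> has the prescribed
  densities by Tonelli's theorem, and uniqueness holds because finitely many charts cover the
  cone (\<open>riemannian_volume_eqI\<close>).
\<close>

section \<open>Calculus of smooth maps\<close>

lemma Ck_on_cong:
  assumes "open S" "\<And>x. x \<in> S \<Longrightarrow> f x = g x" "Ck_on k S f"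
  shows "Ck_on k S g"
  using assms(2,3)
proof (induction k arbitrary: f g)
  case 0
  then show ?case using continuous_on_cong[of S S f g] by simp
next
  case (Suc k)
  have d: "(f has_derivative frechet_derivative f (at x)) (at x)" if "x \<in> S" for x
    using Suc.prems that frechet_derivative_works by auto
  have d': "(g has_derivative frechet_derivative f (at x)) (at x)" if "x \<in> S" for x
    using has_derivative_transform_within_open[OF d[OF that] assms(1) that] Suc.prems(1) by blast
  have "Ck_on k S (\<lambda>x. frechet_derivative g (at x) v)" for v
    by (rule Suc.IH[of "\<lambda>x. frechet_derivative f (at x) v"])
      (use Suc.prems(2) in \<open>auto simp: frechet_derivative_at[OF d', symmetric]\<close>)
  with d' show ?case by (auto simp: differentiable_def)
qed

lemma Ck_on_SucI:
  assumes "open S" "\<And>x. x \<in> S \<Longrightarrow> (f has_derivative D x) (at x)"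
    and "\<And>v. Ck_on k S (\<lambda>x. D x v)"
  shows "Ck_on (Suc k) S f"
proof -
  have "Ck_on k S (\<lambda>x. frechet_derivative f (at x) v)" for v
    by (rule Ck_on_cong[OF assms(1) _ assms(3)[of v]])
      (simp add: frechet_derivative_at[OF assms(2), symmetric])
  then show ?thesis using assms(2) by (auto simp: differentiable_def)
qed

lemma Ck_on_SucD:
  assumes "Ck_on (Suc k) S f"
  shows "x \<in> S \<Longrightarrow> (f has_derivative frechet_derivative f (at x)) (at x)"
    and "Ck_on k S (\<lambda>x. frechet_derivative f (at x) v)"
  using assms frechet_derivative_works by auto

lemma Ck_on_SucD': "Ck_on (Suc k) S f \<Longrightarrow> Ck_on k S f"
proof (induction k arbitrary: f)
  case 0
  then show ?case
    by (auto intro!: continuous_at_imp_continuous_on differentiable_imp_continuous_within)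
qed auto

lemma Ck_on_const: "Ck_on k S (\<lambda>_. c)"
  by (induction k arbitrary: c) auto

lemma Ck_on_linear_right:
  assumes P: "bounded_linear P" and T: "open T" "P ` T \<subseteq> S" and f: "Ck_on k S f"
  shows "Ck_on k T (\<lambda>x. f (P x))"
  using f
proof (induction k arbitrary: f)
  case 0
  then show ?case
    using T linear_continuous_on[OF P]
    by (auto intro: continuous_on_compose2[of S f])
next
  case (Suc k)
  show ?case
  proof (rule Ck_on_SucI[OF T(1)])
    fix x assume "x \<in> T"
    then show "((\<lambda>x. f (P x)) has_derivative (\<lambda>v. frechet_derivative f (at (P x)) (P v))) (at x)"
      using has_derivative_compose[OF bounded_linear_imp_has_derivative[OF P]
        Ck_on_SucD(1)[OF Suc.prems]] T by blast
  qed (use Suc in auto)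
qed

lemma Ck_on_linear_left:
  assumes L: "bounded_linear L" and S: "open S" and f: "Ck_on k S f"
  shows "Ck_on k S (\<lambda>x. L (f x))"
  using f
proof (induction k arbitrary: f)
  case 0
  then show ?case
    by (auto intro: bounded_linear.continuous_on[OF L])
next
  case (Suc k)
  show ?case
    by (rule Ck_on_SucI[OF S bounded_linear.has_derivative[OF L Ck_on_SucD(1)[OF Suc.prems]]])
       (use Suc in auto)
qed

lemma Ck_on_add:
  assumes S: "open S" and "Ck_on k S f" "Ck_on k S g"
  shows "Ck_on k S (\<lambda>x. f x + g x)"
  using assms(2-)
proof (induction k arbitrary: f g)
  case 0
  then show ?case by (auto intro: continuous_intros)
next
  case (Suc k)
  show ?case
    by (rule Ck_on_SucI[OF S has_derivative_add[OF Ck_on_SucD(1)[OF Suc.prems(1)] Ck_on_SucD(1)[OF Suc.prems(2)]]])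
       (use Suc in auto)
qed

lemma Ck_on_scaleR:
  assumes S: "open S" and "Ck_on k S f" "Ck_on k S g"
  shows "Ck_on k S (\<lambda>x. f x *\<^sub>R g x)"
  using assms(2-)
proof (induction k arbitrary: f g)
  case 0
  then show ?case by (auto intro: continuous_intros)
next
  case (Suc k)
  show ?case
    by (rule Ck_on_SucI[OF S has_derivative_scaleR[OF Ck_on_SucD(1)[OF Suc.prems(1)] Ck_on_SucD(1)[OF Suc.prems(2)]]])
      (assumption, assumption,
       rule Ck_on_add[OF S Suc.IH[OF Ck_on_SucD'[OF Suc.prems(1)] Ck_on_SucD(2)[OF Suc.prems(2)]]
         Suc.IH[OF Ck_on_SucD(2)[OF Suc.prems(1)] Ck_on_SucD'[OF Suc.prems(2)]]])
qed

lemma Ck_on_mult: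
  fixes f g :: "'a::real_normed_vector \<Rightarrow> real"
  assumes "open S" "Ck_on k S f" "Ck_on k S g"
  shows "Ck_on k S (\<lambda>x. f x * g x)"
  using Ck_on_scaleR[OF assms] by simp

text \<open>
  The derivative of \<open>1 / g\<close> is a product of \<open>1 / g\<close>, \<open>Dg\<close> and \<open>1 / g\<close>, so the class of differentiability
  of \<open>1 / g\<close> is raised by one at a time.
\<close>

lemma Ck_on_inverse:
  fixes g :: "'a::real_normed_vector \<Rightarrow> real"
  assumes S: "open S" and nz: "\<And>x. x \<in> S \<Longrightarrow> g x \<noteq> 0" and "Ck_on k S g"
  shows "Ck_on k S (\<lambda>x. inverse (g x))"
  using assms(3)
proof (induction k)
  case 0
  then show ?case using nz by (auto intro: continuous_intros)
next
  case (Suc k)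
  have *: "Ck_on k S (\<lambda>x. inverse (g x))" using Suc Ck_on_SucD' by blast
  have "Ck_on k S (\<lambda>x. (-1) * (inverse (g x) * frechet_derivative g (at x) v * inverse (g x)))" for v
    by (rule Ck_on_mult[OF S Ck_on_const Ck_on_mult[OF S Ck_on_mult[OF S * Ck_on_SucD(2)[OF Suc.prems]] *]])
  then show ?case
    by (intro Ck_on_SucI[OF S Deriv.has_derivative_inverse[OF nz Ck_on_SucD(1)[OF Suc.prems]]]) simp_all
qed

text \<open>
  The derivative of \<open>f \<circ> g\<close> is \<open>(f' \<circ> g) Dg\<close>, so the induction has to run over all smooth \<open>f\<close>
  simultaneously.
\<close>

lemma Ck_on_compose_real:
  fixes g :: "'a::real_normed_vector \<Rightarrow> real" and f :: "real \<Rightarrow> real"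
  assumes S: "open S" and "smooth_on UNIV f" and "Ck_on k S g"
  shows "Ck_on k S (\<lambda>x. f (g x))"
  using assms(2,3)
proof (induction k arbitrary: f)
  case 0
  then have "continuous_on UNIV f" unfolding smooth_on_def by (metis Ck_on.simps(1))
  with 0 show ?case by (auto intro: continuous_on_compose2[of UNIV f])
next
  case (Suc k)
  have *: "Ck_on (Suc j) UNIV f" for j using Suc.prems unfolding smooth_on_def by blast
  let ?f' = "\<lambda>x. frechet_derivative f (at x) 1"
  have "Ck_on j UNIV ?f'" for j using *[of j] by simp
  then have f': "smooth_on UNIV ?f'" unfolding smooth_on_def by blast
  have eq: "frechet_derivative f (at x) y = ?f' x * y" for x y
  proof -
    have "linear (frechet_derivative f (at x))" using *[of 0] by (simp add: linear_frechet_derivative)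
    from linear_scale[OF this, of y 1] show ?thesis by (simp add: mult.commute)
  qed
  show ?case
  proof (rule Ck_on_SucI[OF S])
    fix x assume "x \<in> S"
    show "((\<lambda>x. f (g x)) has_derivative (\<lambda>v. ?f' (g x) * frechet_derivative g (at x) v)) (at x)"
      using has_derivative_compose[OF Ck_on_SucD(1)[OF Suc.prems(2) \<open>x \<in> S\<close>] Ck_on_SucD(1)[OF *[of 0], of "g x"]]
      by (simp add: eq[of _ "frechet_derivative g (at x) v" for v])
  next
    fix v
    show "Ck_on k S (\<lambda>x. ?f' (g x) * frechet_derivative g (at x) v)"
      by (rule Ck_on_mult[OF S Suc.IH[OF f' Ck_on_SucD'[OF Suc.prems(2)]] Ck_on_SucD(2)[OF Suc.prems(2)]])
  qed
qed

lemma Ck_on_componentwise: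
  fixes f :: "'a::real_normed_vector \<Rightarrow> 'b::euclidean_space"
  assumes S: "open S" and "\<And>b. b \<in> Basis \<Longrightarrow> Ck_on k S (\<lambda>x. f x \<bullet> b)"
  shows "Ck_on k S f"
  using assms(2)
proof (induction k arbitrary: f)
  case 0
  then show ?case by (simp add: continuous_on_componentwise[of S f])
next
  case (Suc k)
  let ?D = "\<lambda>x v. \<Sum>b\<in>Basis. frechet_derivative (\<lambda>x. f x \<bullet> b) (at x) v *\<^sub>R b"
  show ?case
  proof (rule Ck_on_SucI[OF S])
    fix x assume "x \<in> S"
    then show "(f has_derivative ?D x) (at x)"
      using Ck_on_SucD(1)[OF Suc.prems]
      by (subst has_derivative_componentwise_within) (auto simp: inner_sum_left_Basis)
  next
    fix v
    show "Ck_on k S (\<lambda>x. ?D x v)"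
      using Ck_on_SucD(2)[OF Suc.prems] by (intro Suc.IH) (auto simp: inner_sum_left_Basis)
  qed
qed

lemma smooth_on_matrixI:
  fixes f :: "'a::real_normed_vector \<Rightarrow> real^'n::finite^'m::finite"
  assumes "open S" and "\<And>i j. smooth_on S (\<lambda>x. f x $ i $ j)"
  shows "smooth_on S f"
  unfolding smooth_on_def
proof (rule allI, rule Ck_on_componentwise[OF assms(1)])
  fix k and b :: "real^'n^'m" assume "b \<in> Basis"
  then obtain i j where "b = axis i (axis j 1)"
    by (auto simp: Basis_vec_def)
  then show "Ck_on k S (\<lambda>x. f x \<bullet> b)"
    using assms(2) by (simp add: inner_axis smooth_on_def)
qed

lemma smooth_on_matrixD:
  fixes f :: "'a::real_normed_vector \<Rightarrow> real^'n::finite^'m::finite"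
  assumes "open S" and "smooth_on S f"
  shows "smooth_on S (\<lambda>x. f x $ i $ j)"
  using assms(2) unfolding smooth_on_def
  using Ck_on_linear_left[OF bounded_linear_compose[OF bounded_linear_vec_nth[of j] bounded_linear_vec_nth[of i]] assms(1)]
  by blast

lemma smooth_on_ln: "smooth_on {0<..} (ln :: real \<Rightarrow> real)"
  unfolding smooth_on_def
proof
  fix k show "Ck_on k {0<..} (ln :: real \<Rightarrow> real)"
  proof (cases k)
    case 0
    then show ?thesis by (auto intro!: continuous_intros)
  next
    case (Suc j)
    have "Ck_on j {0<..} (\<lambda>x::real. x)"
    proof (cases j)
      case (Suc l) 
      show ?thesis unfolding Suc
        by (rule Ck_on_SucI) (auto intro!: derivative_eq_intros Ck_on_const)
    qed (auto intro: continuous_intros)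
    then have "Ck_on j {0<..} (\<lambda>x. v * inverse x)" for v :: real
      by (intro Ck_on_mult Ck_on_const Ck_on_inverse) auto
    then show ?thesis unfolding Suc
      by (intro Ck_on_SucI[of _ _ "\<lambda>x v. v * inverse x"]) (auto intro!: derivative_eq_intros)
  qed
qed


section \<open>A smooth bump function\<close>

text \<open>
  For \<open>p = 1\<close> this is the standard smooth function that vanishes exactly on \<open>{..0}\<close>.
  The polynomial factor makes the family closed under differentiation, so that smoothness follows
  by induction.
\<close>

definition flat :: "real poly \<Rightarrow> real \<Rightarrow> real" where
  "flat p x = (if x > 0 then poly p (1/x) * exp (- (1/x)) else 0)"

lemma poly_times_exp_tendsto_0: "((\<lambda>y::real. poly p y * exp (- y)) \<longlongrightarrow> 0) at_top"
proof -
  have "((\<lambda>y. \<Sum>i\<le>degree p. coeff p i * (y ^ i / exp y)) \<longlongrightarrow> (\<Sum>i\<le>degree p. coeff p i * 0)) at_top"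
    by (intro tendsto_intros tendsto_power_div_exp_0)
  then show ?thesis
    by (simp add: poly_altdef sum_distrib_right exp_minus divide_inverse mult.assoc)
qed

lemma flat_has_derivative:
  "(flat p has_real_derivative flat ([:0,0,1:] * (p - pderiv p)) x) (at x)"
proof -
  consider "x > 0" | "x < 0" | "x = 0" by linarith
  then show ?thesis
  proof cases
    case 1
    have "((\<lambda>x. poly p (1/x) * exp (- (1/x))) has_real_derivative flat ([:0,0,1:] * (p - pderiv p)) x) (at x)"
      using 1 unfolding flat_def
      by (auto intro!: derivative_eq_intros DERIV_chain2[OF poly_DERIV] simp: field_simps power2_eq_square)
    then show ?thesis
      by (rule has_field_derivative_transform_within_open[where S="{0<..}"]) (use 1 in \<open>auto simp: flat_def\<close>)
  next
    case 2
    have "((\<lambda>x. 0) has_real_derivative flat ([:0,0,1:] * (p - pderiv p)) x) (at x)"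
      using 2 by (simp add: flat_def)
    then show ?thesis
      by (rule has_field_derivative_transform_within_open[where S="{..<0}"]) (use 2 in \<open>auto simp: flat_def\<close>)
  next
    case 3
    \<comment> \<open>Dividing by \<open>y\<close> multiplies the polynomial in \<open>1 / y\<close> by its variable, and \<open>exp (- 1 / y)\<close> still wins.\<close>
    have "((\<lambda>y. flat p y / y) \<longlongrightarrow> 0) (at_right 0)"
    proof -
      have "((\<lambda>y. poly (pCons 0 p) (inverse y) * exp (- inverse y)) \<longlongrightarrow> 0) (at_right (0::real))"
        by (rule filterlim_compose[OF poly_times_exp_tendsto_0 filterlim_inverse_at_top_right])
      then show ?thesis
        by (rule Lim_transform_eventually)
           (auto simp: eventually_at_filter flat_def divide_inverse)
    qed
    moreover have "((\<lambda>y. flat p y / y) \<longlongrightarrow> 0) (at_left 0)"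
      by (rule Lim_transform_eventually[OF tendsto_const]) (auto simp: eventually_at_filter flat_def)
    ultimately have "((\<lambda>y. flat p y / y) \<longlongrightarrow> 0) (at 0)"
      by (simp add: filterlim_split_at)
    then show ?thesis using 3
      by (simp add: has_field_derivative_iff flat_def)
  qed
qed

lemma smooth_on_flat: "smooth_on UNIV (flat p)"
  unfolding smooth_on_def
proof
  fix k show "Ck_on k UNIV (flat p)"
  proof (induction k arbitrary: p)
    case 0
    show ?case using flat_has_derivative by (auto intro!: continuous_at_imp_continuous_on DERIV_isCont)
  next
    case (Suc k)
    let ?q = "[:0,0,1:] * (p - pderiv p)"
    show ?case
      by (rule Ck_on_SucI[where D="\<lambda>x v. flat ?q x * v"])
         (use flat_has_derivative[of p] in \<open>auto simp: has_field_derivative_def intro!: Ck_on_mult Suc Ck_on_const\<close>)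
  qed
qed

lemma smooth_bump_exists:
  "\<exists>F F' :: real \<Rightarrow> real. smooth_on UNIV F \<and> (\<forall>t. (F has_real_derivative F' t) (at t)) \<and>
     continuous_on UNIV F' \<and> (\<forall>t. t \<notin> {-1..1} \<longrightarrow> F t = 0 \<and> F' t = 0) \<and> F 0 \<noteq> 0"
proof -
  \<comment> \<open>The bump is \<open>flat 1 (1 + t) * flat 1 (1 - t)\<close>, positive exactly on \<open>{-1<..<1}\<close>.\<close>
  let ?f = "\<lambda>p t. flat p (1 + t)" and ?g = "\<lambda>p t. flat p (1 + (-1) * t)"
  let ?q = "[:0,0,1:] * (1 - pderiv 1) :: real poly"
  have id: "Ck_on k UNIV (\<lambda>x::real. x)" for k
    by (cases k) (auto simp: Ck_on_const)
  have sm: "Ck_on k UNIV (?f p)" "Ck_on k UNIV (?g p)" for p k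
    using Ck_on_compose_real[OF open_UNIV smooth_on_flat Ck_on_add[OF open_UNIV Ck_on_const id]]
      Ck_on_compose_real[OF open_UNIV smooth_on_flat
        Ck_on_add[OF open_UNIV Ck_on_const Ck_on_mult[OF open_UNIV Ck_on_const id]]] by blast+
  have c: "continuous_on UNIV (?f p)" "continuous_on UNIV (?g p)" for p
    using sm[of 0] by simp_all
  have "smooth_on UNIV (\<lambda>t. ?f 1 t * ?g 1 t)"
    unfolding smooth_on_def by (rule allI, rule Ck_on_mult[OF open_UNIV sm])
  have "((\<lambda>t. ?f 1 t * ?g 1 t) has_real_derivative ?f ?q t * ?g 1 t - ?f 1 t * ?g ?q t) (at t)" for t
    by (rule derivative_eq_intros DERIV_chain2[OF flat_has_derivative] refl)+ (simp add: algebra_simps)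
  have "continuous_on UNIV (\<lambda>t. ?f ?q t * ?g 1 t - ?f 1 t * ?g ?q t)"
    by (intro continuous_intros c)
  have z: "flat p t = 0" if "t \<le> 0" for p t
    using that by (simp add: flat_def)
  have "?f 1 t * ?g 1 t = 0" "?f ?q t * ?g 1 t - ?f 1 t * ?g ?q t = 0" if "t \<notin> {-1..1}" for t
    using that z[of "1+t"] z[of "1 + (-1)*t"] by (cases "t < -1"; simp)+
  have "?f 1 0 * ?g 1 0 \<noteq> 0"
    by (simp add: flat_def)
  show ?thesis
    by (rule exI[of _ "\<lambda>t. ?f 1 t * ?g 1 t"], rule exI[of _ "\<lambda>t. ?f ?q t * ?g 1 t - ?f 1 t * ?g ?q t"],
        intro conjI allI impI; fact)
qed

section \<open>Metrics in a coordinate domain\<close>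

lemma pd_eq: "(f has_derivative f') (at x) \<Longrightarrow> pd i f x = f' (axis i 1)"
  unfolding pd_def using frechet_derivative_at by metis

text \<open>
  Functions that agree near \<open>x\<close> have the same Frechet derivatives there, if any, hence also the same
  value of the choice operator behind \<open>frechet_derivative\<close>.
\<close>

lemma pd_cong:
  assumes "open S" "x \<in> S" "\<And>y. y \<in> S \<Longrightarrow> f y = g y"
  shows "pd i f x = pd i g x"
proof -
  have "(f has_derivative D) (at x) \<longleftrightarrow> (g has_derivative D) (at x)" for D
    using assms has_derivative_transform_within_open[of f D x UNIV S g]
      has_derivative_transform_within_open[of g D x UNIV S f] by auto
  then show ?thesis by (simp add: pd_def frechet_derivative_def)
qed

lemma differentiable_cong_open:
  assumes "open S" "x \<in> S" "\<And>y. y \<in> S \<Longrightarrow> f y = g y" "f differentiable (at x)"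
  shows "g differentiable (at x)"
  using assms has_derivative_transform_within_open unfolding differentiable_def by metis

lemma pd_const [simp]: "pd i (\<lambda>_. c) = (\<lambda>_. 0)"
  by (simp add: fun_eq_iff pd_def)

lemma pd_mult_left: "f differentiable (at x) \<Longrightarrow> pd i (\<lambda>y. c * f y) x = c * pd i f x"
  using pd_eq[OF has_derivative_mult_right, of f _ x i c] by (simp add: pd_def frechet_derivative_works)

text \<open>
  With \<open>e\<close> one of \<open>Inl\<close>, \<open>Inr\<close>, \<open>Some\<close>, these are the projections of the coordinates of a product to
  its factors, and of a cone to its link.
\<close>

definition sub_coords :: "('a \<Rightarrow> 'b) \<Rightarrow> real^'b \<Rightarrow> real^'a::finite" where
  "sub_coords e x = (\<chi> k. x $ e k)"

lemma sub_coords_nth [simp]: "sub_coords e x $ k = x $ e k"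
  by (simp add: sub_coords_def)

lemma bounded_linear_sub_coords: "bounded_linear (sub_coords e :: real^'b::finite \<Rightarrow> real^'a::finite)"
  by (rule linear_conv_bounded_linear[THEN iffD1]) (simp add: linear_iff vec_eq_iff)

lemma sub_coords_axis:
  assumes "inj e"
  shows "sub_coords e (axis (e a) 1) = axis a 1"
    and "i \<notin> range e \<Longrightarrow> sub_coords e (axis i 1) = 0"
  using assms by (auto simp: vec_eq_iff axis_def inj_eq)

lemma has_derivative_sub_coords:
  assumes "f differentiable (at (sub_coords e x))"
  shows "((\<lambda>y. f (sub_coords e y)) has_derivative
     (\<lambda>v. frechet_derivative f (at (sub_coords e x)) (sub_coords e v))) (at x)"
  using has_derivative_compose[OF bounded_linear_imp_has_derivative[OF bounded_linear_sub_coords]]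
    assms frechet_derivative_works by blast

lemma pd_sub_coords:
  assumes "inj e" "f differentiable (at (sub_coords e x))"
  shows "pd (e a) (\<lambda>y. f (sub_coords e y)) x = pd a f (sub_coords e x)"
    and "i \<notin> range e \<Longrightarrow> pd i (\<lambda>y. f (sub_coords e y)) x = 0"
  unfolding pd_eq[OF has_derivative_sub_coords[OF assms(2)]]
  using linear_0[OF linear_frechet_derivative[OF assms(2)]]
  by (simp_all add: sub_coords_axis[OF assms(1)] pd_def)

lemma differentiable_sub_coords:
  assumes "f differentiable (at (sub_coords e x))"
  shows "(\<lambda>y. f (sub_coords e y)) differentiable (at x)"
  using has_derivative_sub_coords[OF assms] by (auto simp: differentiable_def)

lemma differentiable_prod:
  fixes f :: "'i \<Rightarrow> 'a::real_normed_vector \<Rightarrow> real"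
  assumes "\<And>i. i \<in> I \<Longrightarrow> f i differentiable (at x)"
  shows "(\<lambda>y. \<Prod>i\<in>I. f i y) differentiable (at x)"
proof -
  have "((\<lambda>y. \<Prod>i\<in>I. f i y) has_derivative
     (\<lambda>y. \<Sum>i\<in>I. frechet_derivative (f i) (at x) y * (\<Prod>j\<in>I - {i}. f j x))) (at x)"
    using assms frechet_derivative_works by (intro has_derivative_prod) blast
  then show ?thesis by (auto simp: differentiable_def)
qed

lemma differentiable_det:
  fixes M :: "'a::real_normed_vector \<Rightarrow> real^'n^'n::finite"
  assumes "\<And>i j. (\<lambda>y. M y $ i $ j) differentiable (at x)"
  shows "(\<lambda>y. det (M y)) differentiable (at x)"
  unfolding det_def
  by (intro differentiable_sum differentiable_mult differentiable_prod assms differentiable_const)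
     (auto intro!: differentiable_prod assms)

lemma matrix_inv_mult:
  fixes A :: "real^'n^'n::finite"
  assumes "invertible A"
  shows "A ** matrix_inv A = mat 1" "matrix_inv A ** A = mat 1"
proof -
  obtain B where "A ** B = mat 1 \<and> B ** A = mat 1" using assms by (auto simp: invertible_def)
  then have "A ** matrix_inv A = mat 1 \<and> matrix_inv A ** A = mat 1"
    unfolding matrix_inv_def by (rule someI)
  then show "A ** matrix_inv A = mat 1" "matrix_inv A ** A = mat 1" by auto
qed

lemma matrix_inv_eqI:
  fixes A :: "real^'n^'n::finite"
  assumes "A ** B = mat 1"
  shows "matrix_inv A = B"
proof -
  have "B ** A = mat 1" using assms matrix_left_right_inverse by blast
  then have "matrix_inv A ** A = mat 1"
    using matrix_inv_mult assms by (auto simp: invertible_def)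
  then have "matrix_inv A ** (A ** B) = B" by (simp add: matrix_mul_assoc)
  then show ?thesis using assms by simp
qed

text \<open>
  Cramer's rule exhibits the entries of the inverse metric as rational functions of those of the
  metric. This is what makes the Christoffel symbols differentiable.
\<close>

lemma matrix_inv_cramer:
  fixes A :: "real^'n^'n::finite"
  assumes "invertible A"
  shows "matrix_inv A $ i $ j = det (\<chi> a b. if b = i then (axis j 1 :: real^'n) $ a else A $ a $ b) / det A"
proof -
  have "A *v (matrix_inv A *v axis j 1) = axis j 1"
    by (simp add: matrix_vector_mul_assoc matrix_inv_mult[OF assms])
  then have "matrix_inv A *v axis j 1 =
      (\<chi> k. det (\<chi> a b. if b = k then (axis j 1 :: real^'n) $ a else A $ a $ b) / det A)"
    using cramer[of A "matrix_inv A *v axis j 1" "axis j 1"] assms invertible_det_nz by blast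
  moreover have "(matrix_inv A *v axis j 1) $ i = matrix_inv A $ i $ j"
    by (simp add: matrix_vector_mul_component inner_axis)
  ultimately show ?thesis by simp
qed

text \<open>
  Raising the index that \<open>riemann\<close> lowers turns the Ricci tensor into a plain trace, in which no
  metric coefficient is left.
\<close>

lemma ricci_contract:
  fixes g :: "real^'n \<Rightarrow> real^'n^'n::finite"
  assumes "invertible (g x)"
  shows "ricci g x $ j $ l = (\<Sum>i\<in>UNIV. riemann_up g i i j l x)"
proof -
  have inv: "(\<Sum>k\<in>UNIV. ginv g x i k * g x $ k $ m) = (if i = m then 1 else 0)" for i m
    using arg_cong[OF matrix_inv_mult(2)[OF assms], of "\<lambda>A. A $ i $ m"]
    by (simp add: matrix_matrix_mult_def mat_def ginv_def)
  have "(\<Sum>k\<in>UNIV. ginv g x i k * riemann g i j k l x) = riemann_up g i i j l x" for i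
  proof -
    have "(\<Sum>k\<in>UNIV. ginv g x i k * riemann g i j k l x) =
       (\<Sum>m\<in>UNIV. (\<Sum>k\<in>UNIV. ginv g x i k * g x $ k $ m) * riemann_up g m i j l x)"
      unfolding riemann_def sum_distrib_left sum_distrib_right by (subst sum.swap) (simp add: mult_ac)
    then show ?thesis by (simp add: inv if_distrib[of "\<lambda>t. t * _"] cong: if_cong)
  qed
  then show ?thesis by (simp add: ricci_def)
qed

text \<open>
  The tensor calculus in one chart. Two derivatives are what the curvature needs, and
  nondegeneracy is the form in which positive definiteness enters.
\<close>

locale local_metric =
  fixes U :: "(real^'n::finite) set" and g :: "real^'n \<Rightarrow> real^'n^'n"
  assumes open_U: "open U"
    and sym: "x \<in> U \<Longrightarrow> g x $ i $ j = g x $ j $ i"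
    and inv: "x \<in> U \<Longrightarrow> invertible (g x)"
    and diff: "x \<in> U \<Longrightarrow> (\<lambda>y. g y $ i $ j) differentiable (at x)"
    and diff_pd: "x \<in> U \<Longrightarrow> pd k (\<lambda>y. g y $ i $ j) differentiable (at x)"
begin

lemma sum_g_ginv: "x \<in> U \<Longrightarrow> (\<Sum>k\<in>UNIV. g x $ i $ k * ginv g x k j) = (if i = j then 1 else 0)"
  using arg_cong[OF matrix_inv_mult(1)[OF inv], of x "\<lambda>A. A $ i $ j"]
  by (simp add: matrix_matrix_mult_def mat_def ginv_def)

lemma sum_ginv_g: "x \<in> U \<Longrightarrow> (\<Sum>k\<in>UNIV. ginv g x i k * g x $ k $ j) = (if i = j then 1 else 0)"
  using arg_cong[OF matrix_inv_mult(2)[OF inv], of x "\<lambda>A. A $ i $ j"]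
  by (simp add: matrix_matrix_mult_def mat_def ginv_def)

lemma ginv_sym: "x \<in> U \<Longrightarrow> ginv g x i j = ginv g x j i"
proof -
  assume x: "x \<in> U"
  have s: "transpose (g x) = g x" using sym[OF x] by (simp add: transpose_def vec_eq_iff)
  have "g x ** transpose (matrix_inv (g x)) = mat 1"
    using arg_cong[OF matrix_inv_mult(2)[OF inv[OF x]], of transpose]
    by (simp add: matrix_transpose_mul s transpose_mat)
  then have "matrix_inv (g x) = transpose (matrix_inv (g x))" by (rule matrix_inv_eqI)
  from arg_cong[OF this, of "\<lambda>A. A $ i $ j"] show ?thesis
    by (simp add: ginv_def transpose_def)
qed

lemma pd_sym: "x \<in> U \<Longrightarrow> pd k (\<lambda>y. g y $ i $ j) x = pd k (\<lambda>y. g y $ j $ i) x"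
  by (rule pd_cong[OF open_U]) (auto simp: sym)

lemma christoffel_sym: "x \<in> U \<Longrightarrow> christoffel g k i j x = christoffel g k j i x"
  unfolding christoffel_def by (simp add: pd_sym[of x _ i j] add.commute)

lemma ginv_differentiable: 
  assumes x: "x \<in> U" shows "(\<lambda>y. ginv g y i j) differentiable (at x)"
proof (rule differentiable_cong_open[OF open_U x])
  let ?M = "\<lambda>y. \<chi> a b. if b = i then (axis j 1 :: real^'n) $ a else g y $ a $ b"
  show "det (?M y) / det (g y) = ginv g y i j" if "y \<in> U" for y
    by (simp add: ginv_def matrix_inv_cramer[OF inv[OF that]])
  have "(\<lambda>y. ?M y $ a $ b) differentiable (at x)" for a b
    using diff[OF x] by (cases "b = i") simp_all
  then have "(\<lambda>y. det (?M y)) differentiable (at x)" by (rule differentiable_det)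
  then show "(\<lambda>y. det (?M y) / det (g y)) differentiable (at x)"
    using inv[OF x] differentiable_det[OF diff[OF x]] by (intro differentiable_divide) (simp_all add: invertible_det_nz)
qed

lemma christoffel_differentiable: "x \<in> U \<Longrightarrow> christoffel g k i j differentiable (at x)"
  unfolding christoffel_def
  by (intro differentiable_mult differentiable_const differentiable_sum ballI differentiable_add
       differentiable_diff ginv_differentiable diff_pd) auto

lemma christoffel_lower:
  assumes x: "x \<in> U"
  shows "(\<Sum>m\<in>UNIV. g x $ k $ m * christoffel g m i j x) =
    (1/2) * (pd i (\<lambda>y. g y $ j $ k) x + pd j (\<lambda>y. g y $ i $ k) x - pd k (\<lambda>y. g y $ i $ j) x)"
proof -
  let ?d = "\<lambda>l. pd i (\<lambda>y. g y $ j $ l) x + pd j (\<lambda>y. g y $ i $ l) x - pd l (\<lambda>y. g y $ i $ j) x"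
  have "(\<Sum>m\<in>UNIV. g x $ k $ m * christoffel g m i j x) =
     (\<Sum>m\<in>UNIV. \<Sum>l\<in>UNIV. (1/2) * ((g x $ k $ m * ginv g x m l) * ?d l))"
    by (simp add: christoffel_def sum_distrib_left mult_ac)
  also have "\<dots> = (\<Sum>l\<in>UNIV. (1/2) * ((\<Sum>m\<in>UNIV. g x $ k $ m * ginv g x m l) * ?d l))"
    by (subst sum.swap) (simp add: sum_distrib_left sum_distrib_right)
  also have "\<dots> = (1/2) * ?d k"
    by (simp add: sum_g_ginv[OF x] if_distrib[of "\<lambda>t. t * _"] if_distrib[of "\<lambda>t. _ * t"] cong: if_cong)
  finally show ?thesis .
qed

lemma christoffel_lower': 
  assumes x: "x \<in> U"
  shows "(\<Sum>m\<in>UNIV. christoffel g m i j x * g x $ m $ k) =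
    (1/2) * (pd i (\<lambda>y. g y $ j $ k) x + pd j (\<lambda>y. g y $ i $ k) x - pd k (\<lambda>y. g y $ i $ j) x)"
  using christoffel_lower[OF x, of k i j] by (simp add: mult.commute sym[OF x, of _ k])

text \<open>
  Both Christoffel terms are lowered to derivatives of the metric; their sum is the derivative that
  is subtracted.
\<close>

lemma cov_deriv_metric: "x \<in> U \<Longrightarrow> cov_deriv g g k i j x = 0"
  using christoffel_lower'[of x k i j] christoffel_lower[of x i k j]
  by (simp add: cov_deriv_def sum.distrib mult.commute pd_sym[of x _ j i] pd_sym[of x _ j k] pd_sym[of x _ k i])

lemma raise_metric: "x \<in> U \<Longrightarrow> raise g g i j x = ginv g x i j"
proof -
  assume x: "x \<in> U"
  have "raise g g i j x = (\<Sum>b\<in>UNIV. (\<Sum>a\<in>UNIV. ginv g x i a * g x $ a $ b) * ginv g x j b)"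
    unfolding raise_def by (subst sum.swap) (simp add: sum_distrib_left sum_distrib_right mult_ac)
  then show ?thesis
    by (simp add: sum_ginv_g[OF x] ginv_sym[OF x, of j i] if_distrib[of "\<lambda>t. t * _"] cong: if_cong)
qed

lemma trace_metric: "x \<in> U \<Longrightarrow> (\<Sum>i\<in>UNIV. \<Sum>j\<in>UNIV. ginv g x i j * g x $ i $ j) = CARD('n)"
  using sum_ginv_g[of x i i for i] by (simp add: sym[of x])

text \<open>
  For \<open>h = g\<close> the quantity \<open>Rm(h, h)\<close> is the full trace of the curvature, that is, the scalar
  curvature.
\<close>

lemma Rm_metric:
  assumes x: "x \<in> U" and E: "ricci g x = \<Lambda> *\<^sub>R g x"
  shows "Rm g g x = \<Lambda> * CARD('n)"
proof -
  have "Rm g g x = (\<Sum>j\<in>UNIV. \<Sum>l\<in>UNIV. ginv g x j l * (\<Sum>i\<in>UNIV. \<Sum>k\<in>UNIV. ginv g x i k * riemann g i j k l x))"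
    unfolding Rm_def raise_metric[OF x] sum_distrib_left
    by (rule trans[OF sum.swap sum.cong[OF refl
          trans[OF sum.cong[OF refl sum.swap] trans[OF sum.swap sum.cong[OF refl]]]]])
       (simp add: mult_ac)
  also have "\<dots> = (\<Sum>j\<in>UNIV. \<Sum>l\<in>UNIV. ginv g x j l * ricci g x $ j $ l)"
    by (simp add: ricci_def)
  also have "\<dots> = \<Lambda> * (\<Sum>j\<in>UNIV. \<Sum>l\<in>UNIV. ginv g x j l * g x $ j $ l)"
    by (simp add: E sum_distrib_left mult_ac)
  finally show ?thesis by (simp add: trace_metric[OF x])
qed

lemma lower_raise:
  assumes x: "x \<in> U"
  shows "(\<Sum>b\<in>UNIV. \<Sum>d\<in>UNIV. g x $ c $ b * g x $ a $ d * raise g A b d x) = A x $ c $ a"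
proof -
  have "(\<Sum>b\<in>UNIV. \<Sum>d\<in>UNIV. g x $ c $ b * g x $ a $ d * raise g A b d x) =
    (\<Sum>b\<in>UNIV. \<Sum>d\<in>UNIV. \<Sum>e\<in>UNIV. \<Sum>f\<in>UNIV. (g x $ c $ b * ginv g x b e) * ((g x $ a $ d * ginv g x d f) * A x $ e $ f))"
    by (simp add: raise_def sum_distrib_left mult_ac)
  also have "\<dots> = (\<Sum>e\<in>UNIV. \<Sum>f\<in>UNIV. \<Sum>b\<in>UNIV. \<Sum>d\<in>UNIV. (g x $ c $ b * ginv g x b e) * ((g x $ a $ d * ginv g x d f) * A x $ e $ f))"
    by (rule trans[OF sum.cong[OF refl sum.swap] trans[OF sum.swap sum.cong[OF refl
          trans[OF sum.cong[OF refl sum.swap] sum.swap]]]])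
  also have "\<dots> = (\<Sum>e\<in>UNIV. \<Sum>f\<in>UNIV. (\<Sum>b\<in>UNIV. g x $ c $ b * ginv g x b e) *
      ((\<Sum>d\<in>UNIV. g x $ a $ d * ginv g x d f) * A x $ e $ f))"
    by (intro sum.cong refl) (simp add: sum_distrib_left sum_distrib_right, rule sum.swap)
  also have "\<dots> = (\<Sum>e\<in>UNIV. (if c = e then 1 else 0) * (\<Sum>f\<in>UNIV. (if a = f then 1 else 0) * A x $ e $ f))"
    by (simp only: sum_g_ginv[OF x] sum_distrib_left)
  also have "\<dots> = A x $ c $ a"
    by (simp add: if_distrib[of "\<lambda>t. t * _"] cong: if_cong)
  finally show ?thesis .
qed

lemma trace_raise:
  assumes x: "x \<in> U"
  shows "(\<Sum>a\<in>UNIV. \<Sum>c\<in>UNIV. g x $ a $ c * raise g A a c x) = (\<Sum>i\<in>UNIV. \<Sum>j\<in>UNIV. ginv g x i j * A x $ i $ j)"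
proof -
  have "(\<Sum>a\<in>UNIV. \<Sum>c\<in>UNIV. g x $ a $ c * raise g A a c x) =
    (\<Sum>a\<in>UNIV. \<Sum>c\<in>UNIV. \<Sum>e\<in>UNIV. \<Sum>f\<in>UNIV. (g x $ a $ c * ginv g x c f) * (ginv g x e a * A x $ e $ f))"
    by (simp add: raise_def sum_distrib_left mult_ac ginv_sym[OF x, of _ "_"])
  also have "\<dots> = (\<Sum>e\<in>UNIV. \<Sum>f\<in>UNIV. \<Sum>a\<in>UNIV. \<Sum>c\<in>UNIV. (g x $ a $ c * ginv g x c f) * (ginv g x e a * A x $ e $ f))"
    by (rule trans[OF sum.cong[OF refl sum.swap] trans[OF sum.swap sum.cong[OF refl
          trans[OF sum.cong[OF refl sum.swap] sum.swap]]]])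
  also have "\<dots> = (\<Sum>e\<in>UNIV. \<Sum>f\<in>UNIV. \<Sum>a\<in>UNIV. (\<Sum>c\<in>UNIV. g x $ a $ c * ginv g x c f) * (ginv g x e a * A x $ e $ f))"
    by (simp add: sum_distrib_right)
  also have "\<dots> = (\<Sum>i\<in>UNIV. \<Sum>j\<in>UNIV. ginv g x i j * A x $ i $ j)"
    by (simp add: sum_g_ginv[OF x] if_distrib[of "\<lambda>t. t * _"] cong: if_cong)
  finally show ?thesis .
qed

end

section \<open>Product metrics in coordinates\<close>

lemma sum_UNIV_Plus:
  fixes f :: "'a::finite + 'b::finite \<Rightarrow> 'c::comm_monoid_add"
  shows "(\<Sum>k\<in>UNIV. f k) = (\<Sum>a\<in>UNIV. f (Inl a)) + (\<Sum>b\<in>UNIV. f (Inr b))"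
  by (simp add: UNIV_Plus_UNIV[symmetric] sum.Plus del: UNIV_Plus_UNIV)

definition prod_block ::
  "(real^'m \<Rightarrow> real^'m^'m) \<Rightarrow> (real^'n \<Rightarrow> real^'n^'n) \<Rightarrow> real^('m + 'n) \<Rightarrow> real^('m + 'n)^('m::finite + 'n::finite)"
where
  "prod_block A B x = (\<chi> i j. case (i, j) of
       (Inl a, Inl b) \<Rightarrow> A (sub_coords Inl x) $ a $ b
     | (Inr a, Inr b) \<Rightarrow> B (sub_coords Inr x) $ a $ b
     | _ \<Rightarrow> 0)"

lemma prod_block_nth [simp]:
  "prod_block A B x $ Inl a $ Inl b = A (sub_coords Inl x) $ a $ b"
  "prod_block A B x $ Inr c $ Inr d = B (sub_coords Inr x) $ c $ d"
  "prod_block A B x $ Inl a $ Inr d = 0"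
  "prod_block A B x $ Inr c $ Inl b = 0"
  by (simp_all add: prod_block_def)

lemma product_metric_eq: "product_metric \<gamma>1 \<gamma>2 (c, d) = prod_block (\<gamma>1 c) (\<gamma>2 d)"
  unfolding product_metric_def prod_block_def sub_coords_def by simp

lemma pd_Inl_Inr:
  fixes x :: "real^('m::finite + 'n::finite)"
  shows "f differentiable (at (sub_coords Inl x)) \<Longrightarrow>
    pd (Inl a) (\<lambda>y. f (sub_coords Inl y)) x = pd a f (sub_coords Inl x)"
  "f differentiable (at (sub_coords Inl x)) \<Longrightarrow> pd (Inr c) (\<lambda>y. f (sub_coords Inl y)) x = 0"
  "f' differentiable (at (sub_coords Inr x)) \<Longrightarrow>
    pd (Inr c) (\<lambda>y. f' (sub_coords Inr y)) x = pd c f' (sub_coords Inr x)"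
  "f' differentiable (at (sub_coords Inr x)) \<Longrightarrow> pd (Inl a) (\<lambda>y. f' (sub_coords Inr y)) x = 0"
  using pd_sub_coords[of "Inl :: 'm \<Rightarrow> 'm + 'n" f x] pd_sub_coords[of "Inr :: 'n \<Rightarrow> 'm + 'n" f' x]
  by auto

text \<open>
  Each block of the product metric depends only on its own coordinates, so Christoffel symbols and
  curvature components with indices of both kinds vanish and the others are those of the factors.
\<close>

locale product_of_metrics =
  M1: local_metric U1 g1 + M2: local_metric U2 g2
  for U1 :: "(real^'m::finite) set" and g1 and U2 :: "(real^'n::finite) set" and g2
begin

abbreviation "G \<equiv> prod_block g1 g2"
definition U :: "(real^('m + 'n)) set" where
  "U = sub_coords Inl -` U1 \<inter> sub_coords Inr -` U2"

lemma U_D [simp]: "x \<in> U \<Longrightarrow> sub_coords Inl x \<in> U1" "x \<in> U \<Longrightarrow> sub_coords Inr x \<in> U2"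
  by (auto simp: U_def)

lemma open_U: "open U"
  unfolding U_def
  by (intro open_Int continuous_open_vimage M1.open_U M2.open_U linear_continuous_at[OF bounded_linear_sub_coords])

lemma block_inverse:
  assumes x: "x \<in> U"
  shows "G x ** prod_block (matrix_inv \<circ> g1) (matrix_inv \<circ> g2) x = mat 1"
proof -
  have "(G x ** prod_block (matrix_inv \<circ> g1) (matrix_inv \<circ> g2) x) $ i $ j = mat 1 $ i $ j" for i j
    using M1.sum_g_ginv[OF U_D(1)[OF x]] M2.sum_g_ginv[OF U_D(2)[OF x]]
    by (cases i; cases j) (simp_all add: matrix_matrix_mult_def sum_UNIV_Plus mat_def ginv_def)
  then show ?thesis by (simp add: vec_eq_iff)
qed

lemma ginv_product:
  assumes x: "x \<in> U"
  shows "ginv G x (Inl a) (Inl b) = ginv g1 (sub_coords Inl x) a b"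
    "ginv G x (Inr c) (Inr d) = ginv g2 (sub_coords Inr x) c d"
    "ginv G x (Inl a) (Inr d) = 0" "ginv G x (Inr c) (Inl b) = 0"
  by (simp_all add: ginv_def matrix_inv_eqI[OF block_inverse[OF x]])

lemma pd_metric:
  assumes x: "x \<in> U"
  shows "pd (Inl k) (\<lambda>y. g1 (sub_coords Inl y) $ a $ b) x = pd k (\<lambda>z. g1 z $ a $ b) (sub_coords Inl x)"
    "pd (Inr l) (\<lambda>y. g1 (sub_coords Inl y) $ a $ b) x = 0"
    "pd (Inr l) (\<lambda>y. g2 (sub_coords Inr y) $ c $ d) x = pd l (\<lambda>z. g2 z $ c $ d) (sub_coords Inr x)"
    "pd (Inl k) (\<lambda>y. g2 (sub_coords Inr y) $ c $ d) x = 0"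
  using pd_Inl_Inr(1,2)[of "\<lambda>z. g1 z $ a $ b" x, OF M1.diff] pd_Inl_Inr(3,4)[of "\<lambda>z. g2 z $ c $ d" x, OF M2.diff] x
  by auto

sublocale local_metric U G
proof
  fix x i j k assume x: "x \<in> U"
  show "G x $ i $ j = G x $ j $ i"
    using x by (cases i; cases j) (simp_all add: M1.sym[of _ _ "_"] M2.sym)
  show "invertible (G x)"
    using block_inverse[OF x] matrix_left_right_inverse by (auto simp: invertible_def)
  show "(\<lambda>y. G y $ i $ j) differentiable (at x)"
    using differentiable_sub_coords[OF M1.diff, of Inl x] differentiable_sub_coords[OF M2.diff, of Inr x] x
    by (cases i; cases j) simp_all
  show "pd k (\<lambda>y. G y $ i $ j) differentiable (at x)"
  proof (cases k)
    case (Inl a)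
    have "(\<lambda>y. pd a (\<lambda>z. g1 z $ p $ q) (sub_coords Inl y)) differentiable (at x)" for p q
      using differentiable_sub_coords[OF M1.diff_pd, of Inl x] x by simp
    then have "pd (Inl a) (\<lambda>y. g1 (sub_coords Inl y) $ p $ q) differentiable (at x)" for p q
      by (rule differentiable_cong_open[OF open_U x, rotated]) (simp add: pd_metric)
    moreover have "pd (Inl a) (\<lambda>y. g2 (sub_coords Inr y) $ p $ q) differentiable (at x)" for p q
      by (rule differentiable_cong_open[OF open_U x, of "\<lambda>_. 0"]) (simp_all add: pd_metric)
    ultimately show ?thesis by (cases i; cases j) (simp_all add: Inl)
  next
    case (Inr a)
    have "(\<lambda>y. pd a (\<lambda>z. g2 z $ p $ q) (sub_coords Inr y)) differentiable (at x)" for p q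
      using differentiable_sub_coords[OF M2.diff_pd, of Inr x] x by simp
    then have "pd (Inr a) (\<lambda>y. g2 (sub_coords Inr y) $ p $ q) differentiable (at x)" for p q
      by (rule differentiable_cong_open[OF open_U x, rotated]) (simp add: pd_metric)
    moreover have "pd (Inr a) (\<lambda>y. g1 (sub_coords Inl y) $ p $ q) differentiable (at x)" for p q
      by (rule differentiable_cong_open[OF open_U x, of "\<lambda>_. 0"]) (simp_all add: pd_metric)
    ultimately show ?thesis by (cases i; cases j) (simp_all add: Inr)
  qed
qed (rule open_U)

lemma christoffel_product:
  assumes x: "x \<in> U"
  shows "christoffel G (Inl k) (Inl i) (Inl j) x = christoffel g1 k i j (sub_coords Inl x)"
    "christoffel G (Inr k') (Inr i') (Inr j') x = christoffel g2 k' i' j' (sub_coords Inr x)"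
    "christoffel G (Inl k) (Inl i) (Inr j') x = 0"
    "christoffel G (Inl k) (Inr i') (Inl j) x = 0"
    "christoffel G (Inl k) (Inr i') (Inr j') x = 0"
    "christoffel G (Inr k') (Inl i) (Inr j') x = 0"
    "christoffel G (Inr k') (Inr i') (Inl j) x = 0"
    "christoffel G (Inr k') (Inl i) (Inl j) x = 0"
  using x by (simp_all add: christoffel_def sum_UNIV_Plus ginv_product pd_metric)

lemma pd_christoffel_product:
  assumes x: "x \<in> U"
  shows "pd (Inl l) (christoffel G (Inl k) (Inl i) (Inl j)) x = pd l (christoffel g1 k i j) (sub_coords Inl x)"
    "pd (Inr l') (christoffel G (Inl k) (Inl i) (Inl j)) x = 0"
    "pd (Inr l') (christoffel G (Inr k') (Inr i') (Inr j')) x = pd l' (christoffel g2 k' i' j') (sub_coords Inr x)"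
    "pd (Inl l) (christoffel G (Inr k') (Inr i') (Inr j')) x = 0"
    "pd m (christoffel G (Inl k) (Inl i) (Inr j')) x = 0"
    "pd m (christoffel G (Inl k) (Inr i') (Inl j)) x = 0"
    "pd m (christoffel G (Inl k) (Inr i') (Inr j')) x = 0"
    "pd m (christoffel G (Inr k') (Inl i) (Inr j')) x = 0"
    "pd m (christoffel G (Inr k') (Inr i') (Inl j)) x = 0"
    "pd m (christoffel G (Inr k') (Inl i) (Inl j)) x = 0"
  using x
  by (simp_all add: pd_cong[OF open_U x christoffel_product(1)] pd_cong[OF open_U x christoffel_product(2)]
     pd_cong[OF open_U x christoffel_product(3)] pd_cong[OF open_U x christoffel_product(4)]
     pd_cong[OF open_U x christoffel_product(5)] pd_cong[OF open_U x christoffel_product(6)]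
     pd_cong[OF open_U x christoffel_product(7)] pd_cong[OF open_U x christoffel_product(8)]
     pd_Inl_Inr M1.christoffel_differentiable M2.christoffel_differentiable)

lemma riemann_up_product:
  assumes x: "x \<in> U"
  shows "riemann_up G (Inl m) (Inl i) (Inl j) (Inl l) x = riemann_up g1 m i j l (sub_coords Inl x)"
    "riemann_up G (Inr m') (Inr i') (Inr j') (Inr l') x = riemann_up g2 m' i' j' l' (sub_coords Inr x)"
    "riemann_up G (Inl m) (Inl i) (Inr j') (Inr l') x = 0"
    "riemann_up G (Inr m') (Inr i') (Inl j) (Inl l) x = 0"
    "riemann_up G (Inl m) (Inl i) (Inl j) (Inr l') x = 0"
    "riemann_up G (Inl m) (Inl i) (Inr j') (Inl l) x = 0"
    "riemann_up G (Inr m') (Inr i') (Inr j') (Inl l) x = 0"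
    "riemann_up G (Inr m') (Inr i') (Inl j) (Inr l') x = 0"
  using x by (simp_all add: riemann_up_def pd_christoffel_product christoffel_product sum_UNIV_Plus)

lemma ricci_product:
  assumes x: "x \<in> U" and "ricci g1 (sub_coords Inl x) = \<Lambda> *\<^sub>R g1 (sub_coords Inl x)"
    and "ricci g2 (sub_coords Inr x) = \<Lambda> *\<^sub>R g2 (sub_coords Inr x)"
  shows "ricci G x = \<Lambda> *\<^sub>R G x"
proof -
  have "ricci G x $ j $ l = (\<Lambda> *\<^sub>R G x) $ j $ l" for j l
    using arg_cong[OF assms(2), of "\<lambda>A. A $ i $ j" for i j] arg_cong[OF assms(3), of "\<lambda>A. A $ i $ j" for i j]
      ricci_contract[of g1, OF M1.inv[OF U_D(1)[OF x]]] ricci_contract[of g2, OF M2.inv[OF U_D(2)[OF x]]]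
    by (cases j; cases l) (simp_all add: ricci_contract[of G, OF inv[OF x]] sum_UNIV_Plus riemann_up_product[OF x])
  then show ?thesis by (simp add: vec_eq_iff)
qed

context
  fixes \<alpha> \<beta> :: real
begin

text \<open>
  Both summands are parallel. The instability comes from the combination with trace zero,
  \<open>\<alpha> = 1 / n\<^sub>1\<close> and \<open>\<beta> = - 1 / n\<^sub>2\<close>.
\<close>

abbreviation "A \<equiv> prod_block (\<lambda>z. \<alpha> *\<^sub>R g1 z) (\<lambda>z. \<beta> *\<^sub>R g2 z)"

lemma A_differentiable: "x \<in> U \<Longrightarrow> (\<lambda>y. A y $ i $ j) differentiable (at x)"
  using differentiable_sub_coords[OF M1.diff, of Inl x] differentiable_sub_coords[OF M2.diff, of Inr x]
  by (cases i; cases j) simp_all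

lemma A_sym: "x \<in> U \<Longrightarrow> A x $ i $ j = A x $ j $ i"
  by (cases i; cases j) (simp_all add: M1.sym M2.sym)

lemma cov_deriv_A:
  assumes x: "x \<in> U"
  shows "cov_deriv G A k i j x = 0"
proof -
  have d: "(\<lambda>y. g1 (sub_coords Inl y) $ a $ b) differentiable (at x)"
      "(\<lambda>y. g2 (sub_coords Inr y) $ c $ d) differentiable (at x)" for a b c d
    using differentiable_sub_coords[OF M1.diff, of Inl x] differentiable_sub_coords[OF M2.diff, of Inr x] x by auto
  have "cov_deriv G A (Inl k) (Inl i) (Inl j) x = \<alpha> * cov_deriv g1 g1 k i j (sub_coords Inl x)"
     "cov_deriv G A (Inr k') (Inr i') (Inr j') x = \<beta> * cov_deriv g2 g2 k' i' j' (sub_coords Inr x)" for k i j k' i' j'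
    using x by (simp_all add: cov_deriv_def pd_mult_left[OF d(1)] pd_mult_left[OF d(2)] pd_metric
        christoffel_product sum_UNIV_Plus algebra_simps sum_distrib_left)
  then show ?thesis using x
    by (cases k; cases i; cases j) (simp_all add: M1.cov_deriv_metric M2.cov_deriv_metric, 
       simp_all add: cov_deriv_def pd_mult_left[OF d(1)] pd_mult_left[OF d(2)] pd_metric
        christoffel_product sum_UNIV_Plus)
qed

lemma trace_A:
  assumes x: "x \<in> U"
  shows "(\<Sum>i\<in>UNIV. \<Sum>j\<in>UNIV. ginv G x i j * A x $ i $ j) = \<alpha> * CARD('m) + \<beta> * CARD('n)"
  using M1.trace_metric[OF U_D(1)[OF x]] M2.trace_metric[OF U_D(2)[OF x]]
  by (simp add: sum_UNIV_Plus ginv_product[OF x] mult.left_commute[of _ \<alpha>] mult.left_commute[of _ \<beta>]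
      sum_distrib_left[symmetric])

lemma raise_A:
  assumes x: "x \<in> U"
  shows "raise G A (Inl a) (Inl b) x = \<alpha> * ginv g1 (sub_coords Inl x) a b"
    "raise G A (Inr c) (Inr d) x = \<beta> * ginv g2 (sub_coords Inr x) c d"
    "raise G A (Inl a) (Inr d) x = 0"
    "raise G A (Inr c) (Inl b) x = 0"
  using M1.raise_metric[OF U_D(1)[OF x]] M2.raise_metric[OF U_D(2)[OF x]]
  by (simp_all add: raise_def sum_UNIV_Plus ginv_product[OF x] mult.left_commute[of _ \<alpha>] mult.left_commute[of _ \<beta>]
      sum_distrib_left[symmetric])

lemma norm_A:
  assumes x: "x \<in> U"
  shows "(\<Sum>i\<in>UNIV. \<Sum>j\<in>UNIV. raise G A i j x * A x $ i $ j) = \<alpha>\<^sup>2 * CARD('m) + \<beta>\<^sup>2 * CARD('n)"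
proof -
  have sq: "(c * b) * (c * d) = c\<^sup>2 * (b * d)" for b c d :: real
    by (simp add: power2_eq_square)
  show ?thesis
    using M1.trace_metric[OF U_D(1)[OF x]] M2.trace_metric[OF U_D(2)[OF x]]
    by (simp add: sum_UNIV_Plus raise_A[OF x] sq sum_distrib_left[symmetric])
qed

lemma riemann_product:
  assumes x: "x \<in> U"
  shows "riemann G (Inl i) (Inl j) (Inl k) (Inl l) x = riemann g1 i j k l (sub_coords Inl x)"
    "riemann G (Inr i') (Inr j') (Inr k') (Inr l') x = riemann g2 i' j' k' l' (sub_coords Inr x)"
    "riemann G (Inl i) (Inr j') (Inl k) (Inr l') x = 0"
    "riemann G (Inr i') (Inl j) (Inr k') (Inl l) x = 0"
  by (simp_all add: riemann_def sum_UNIV_Plus riemann_up_product[OF x])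

lemma Rm_A:
  assumes x: "x \<in> U" and "ricci g1 (sub_coords Inl x) = \<Lambda> *\<^sub>R g1 (sub_coords Inl x)"
    and "ricci g2 (sub_coords Inr x) = \<Lambda> *\<^sub>R g2 (sub_coords Inr x)"
  shows "Rm G A x = \<Lambda> * (\<alpha>\<^sup>2 * CARD('m) + \<beta>\<^sup>2 * CARD('n))"
proof -
  have "Rm G A x = \<alpha>\<^sup>2 * Rm g1 g1 (sub_coords Inl x) + \<beta>\<^sup>2 * Rm g2 g2 (sub_coords Inr x)"
  proof -
    have sq: "a * (c * b) * (c * d) = c\<^sup>2 * (a * b * d)" for a b c d :: real
      by (simp add: power2_eq_square)
    show ?thesis using x
      by (simp add: Rm_def sum_UNIV_Plus raise_A M1.raise_metric M2.raise_metric riemann_product sq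
          sum_distrib_left[symmetric])
  qed
  then show ?thesis
    using M1.Rm_metric[OF U_D(1)[OF x] assms(2)] M2.Rm_metric[OF U_D(2)[OF x] assms(3)]
    by (simp add: algebra_simps)
qed

end
end

section \<open>Cone metrics in coordinates\<close>

lemma sum_UNIV_option:
  fixes f :: "'a::finite option \<Rightarrow> 'c::comm_monoid_add"
  shows "(\<Sum>k\<in>UNIV. f k) = f None + (\<Sum>a\<in>UNIV. f (Some a))"
  by (simp add: UNIV_option_conv sum.reindex)

text \<open>
  Metric, Christoffel symbols and test tensor of a cone are all products of a function of the
  radius and a function on the link.
\<close>

lemma pd_separated:
  fixes x :: "real^('n::finite option)"
  assumes q: "(q has_real_derivative q') (at (x $ None))" and f: "f differentiable (at (sub_coords Some x))"
  shows "pd None (\<lambda>y. q (y $ None) * f (sub_coords Some y)) x = q' * f (sub_coords Some x)"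
    and "pd (Some a) (\<lambda>y. q (y $ None) * f (sub_coords Some y)) x = q (x $ None) * pd a f (sub_coords Some x)"
proof -
  have "((\<lambda>y. y $ None) has_derivative (\<lambda>v. v $ None)) (at x)"
    by (intro bounded_linear_imp_has_derivative bounded_linear_vec_nth)
  from has_derivative_compose[OF this has_field_derivative_imp_has_derivative[OF q]]
  have "((\<lambda>y. q (y $ None)) has_derivative (\<lambda>v. q' * v $ None)) (at x)" by (simp add: mult_commute_abs)
  from pd_eq[OF has_derivative_mult[OF this has_derivative_sub_coords[OF f]]]
  have *: "pd i (\<lambda>y. q (y $ None) * f (sub_coords Some y)) x =
     q (x $ None) * frechet_derivative f (at (sub_coords Some x)) (sub_coords Some (axis i 1)) +
     q' * axis i 1 $ None * f (sub_coords Some x)" for i .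
  show "pd None (\<lambda>y. q (y $ None) * f (sub_coords Some y)) x = q' * f (sub_coords Some x)"
    unfolding * using linear_0[OF linear_frechet_derivative[OF f]]
    by (simp add: sub_coords_axis(2))
  show "pd (Some a) (\<lambda>y. q (y $ None) * f (sub_coords Some y)) x = q (x $ None) * pd a f (sub_coords Some x)"
    unfolding * by (simp add: sub_coords_axis(1) pd_def) (simp add: axis_def)
qed

definition cone_block :: "(real^'n \<Rightarrow> real^'n^'n) \<Rightarrow> real^('n option) \<Rightarrow> real^('n option)^('n::finite option)" where
  "cone_block g x = (\<chi> i j. case (i, j) of
       (None, None) \<Rightarrow> 1
     | (Some a, Some b) \<Rightarrow> (x $ None)\<^sup>2 * g (sub_coords Some x) $ a $ b
     | _ \<Rightarrow> 0)"

lemma cone_block_nth [simp]: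
  "cone_block g x $ None $ None = 1"
  "cone_block g x $ Some a $ Some b = (x $ None)\<^sup>2 * g (sub_coords Some x) $ a $ b"
  "cone_block g x $ None $ Some b = 0"
  "cone_block g x $ Some a $ None = 0"
  by (simp_all add: cone_block_def)

lemma cone_metric_eq: "cone_metric \<gamma> c = cone_block (\<gamma> c)"
  unfolding cone_metric_def cone_block_def sub_coords_def by simp

definition link_tensor ::
  "(real \<Rightarrow> real) \<Rightarrow> (real^'n \<Rightarrow> real^'n^'n) \<Rightarrow> real^('n option) \<Rightarrow> real^('n option)^('n::finite option)" where
  "link_tensor f A x = (\<chi> i j. case (i, j) of
     (Some a, Some b) \<Rightarrow> f (x $ None) * A (sub_coords Some x) $ a $ b
     | _ \<Rightarrow> 0)"

lemma link_tensor_nth [simp]: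
  "link_tensor f A x $ Some a $ Some b = f (x $ None) * A (sub_coords Some x) $ a $ b"
  "link_tensor f A x $ None $ i = 0"
  "link_tensor f A x $ i $ None = 0"
  by (simp_all add: link_tensor_def split: option.split)

context local_metric
begin

abbreviation "CG \<equiv> cone_block g"
definition CU :: "(real^('n option)) set" where
  "CU = {x. 0 < x $ None} \<inter> sub_coords Some -` U"

lemma CU_D: "x \<in> CU \<Longrightarrow> sub_coords Some x \<in> U" "x \<in> CU \<Longrightarrow> 0 < x $ None"
  by (auto simp: CU_def)

lemma open_CU: "open CU"
  unfolding CU_def
  by (intro open_Int continuous_open_vimage open_U linear_continuous_at[OF bounded_linear_sub_coords]
        open_Collect_less continuous_intros)

lemma cone_inverse:
  assumes x: "x \<in> CU"
  shows "CG x ** (\<chi> i j. case (i, j) of (None, None) \<Rightarrow> 1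
     | (Some a, Some b) \<Rightarrow> ginv g (sub_coords Some x) a b / (x $ None)\<^sup>2 | _ \<Rightarrow> 0) = mat 1" (is "_ ** ?B = _")
proof -
  have "(CG x ** ?B) $ i $ j = mat 1 $ i $ j" for i j
    using sum_g_ginv[OF CU_D(1)[OF x]] CU_D(2)[OF x]
    by (cases i; cases j) (simp_all add: matrix_matrix_mult_def sum_UNIV_option mat_def)
  then show ?thesis by (simp add: vec_eq_iff)
qed

lemma ginv_cone:
  assumes x: "x \<in> CU"
  shows "ginv CG x None None = 1"
    "ginv CG x (Some a) (Some b) = ginv g (sub_coords Some x) a b / (x $ None)\<^sup>2"
    "ginv CG x None (Some b) = 0" "ginv CG x (Some a) None = 0"
  by (simp_all add: ginv_def[of CG] matrix_inv_eqI[OF cone_inverse[OF x]])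

lemma pd_cone_metric:
  assumes x: "x \<in> CU"
  shows "pd None (\<lambda>y. (y $ None)\<^sup>2 * g (sub_coords Some y) $ a $ b) x = 2 * x $ None * g (sub_coords Some x) $ a $ b"
    "pd (Some c) (\<lambda>y. (y $ None)\<^sup>2 * g (sub_coords Some y) $ a $ b) x =
       (x $ None)\<^sup>2 * pd c (\<lambda>z. g z $ a $ b) (sub_coords Some x)"
proof -
  have q: "((\<lambda>r. r\<^sup>2) has_real_derivative 2 * x $ None) (at (x $ None))"
    by (auto intro!: derivative_eq_intros)
  show "pd None (\<lambda>y. (y $ None)\<^sup>2 * g (sub_coords Some y) $ a $ b) x = 2 * x $ None * g (sub_coords Some x) $ a $ b"
    "pd (Some c) (\<lambda>y. (y $ None)\<^sup>2 * g (sub_coords Some y) $ a $ b) x =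
       (x $ None)\<^sup>2 * pd c (\<lambda>z. g z $ a $ b) (sub_coords Some x)"
    using pd_separated[OF q diff[OF CU_D(1)[OF x], of a b]] by simp_all
qed

lemma christoffel_cone:
  assumes x: "x \<in> CU"
  shows "christoffel CG k None None x = 0"
    "christoffel CG None None i x = 0"
    "christoffel CG None i None x = 0"
    "christoffel CG None (Some a) (Some b) x = - x $ None * g (sub_coords Some x) $ a $ b"
    "christoffel CG (Some c) None (Some b) x = (if c = b then 1 / x $ None else 0)"
    "christoffel CG (Some c) (Some a) None x = (if c = a then 1 / x $ None else 0)"
    "christoffel CG (Some c) (Some a) (Some b) x = christoffel g c a b (sub_coords Some x)"
proof -
  note d = christoffel_def[of CG] sum_UNIV_option ginv_cone[OF x] pd_cone_metric[OF x]
  have r: "x $ None \<noteq> 0" using CU_D(2)[OF x] by simp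
  show "christoffel CG k None None x = 0" by (cases k) (simp_all add: d)
  show "christoffel CG None None i x = 0" by (cases i) (simp_all add: d)
  show "christoffel CG None i None x = 0" by (cases i) (simp_all add: d)
  show "christoffel CG None (Some a) (Some b) x = - x $ None * g (sub_coords Some x) $ a $ b"
    by (simp add: d)
  have e: "(\<Sum>l\<in>UNIV. ginv g (sub_coords Some x) c l * (2 * (x $ None * g (sub_coords Some x) $ b $ l)) / (x $ None)\<^sup>2) / 2
     = (if c = b then 1 / x $ None else 0)" for b c
  proof -
    have "(\<Sum>l\<in>UNIV. ginv g (sub_coords Some x) c l * (2 * (x $ None * g (sub_coords Some x) $ b $ l)) / (x $ None)\<^sup>2) / 2
      = (\<Sum>l\<in>UNIV. ginv g (sub_coords Some x) c l * g (sub_coords Some x) $ l $ b) / x $ None"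
      unfolding sum_divide_distrib using r
      by (intro sum.cong refl) (simp add: sym[OF CU_D(1)[OF x], of b] power2_eq_square)
    then show ?thesis by (simp add: sum_ginv_g[OF CU_D(1)[OF x]])
  qed
  show "christoffel CG (Some c) None (Some b) x = (if c = b then 1 / x $ None else 0)"
    "christoffel CG (Some c) (Some a) None x = (if c = a then 1 / x $ None else 0)"
    using e[of c b] e[of c a] by (simp_all add: d mult_ac)
  show "christoffel CG (Some c) (Some a) (Some b) x = christoffel g c a b (sub_coords Some x)"
    using r by (simp add: d christoffel_def[of g] right_diff_distrib[symmetric] distrib_left[symmetric])
qed

lemma pd_christoffel_cone:
  assumes x: "x \<in> CU"
  shows "pd m (christoffel CG k None None) x = 0"
    "pd m (christoffel CG None None i) x = 0"
    "pd m (christoffel CG None i None) x = 0"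
    "pd None (christoffel CG None (Some a) (Some b)) x = - g (sub_coords Some x) $ a $ b"
    "pd (Some d) (christoffel CG None (Some a) (Some b)) x = - x $ None * pd d (\<lambda>z. g z $ a $ b) (sub_coords Some x)"
    "pd None (christoffel CG (Some c) None (Some b)) x = (if c = b then - 1 / (x $ None)\<^sup>2 else 0)"
    "pd None (christoffel CG (Some c) (Some a) None) x = (if c = a then - 1 / (x $ None)\<^sup>2 else 0)"
    "pd (Some d) (christoffel CG (Some c) None (Some b)) x = 0"
    "pd (Some d) (christoffel CG (Some c) (Some a) None) x = 0"
    "pd (Some d) (christoffel CG (Some c) (Some a) (Some b)) x = pd d (christoffel g c a b) (sub_coords Some x)"
    "pd None (christoffel CG (Some c) (Some a) (Some b)) x = 0"
proof -
  have r: "x $ None \<noteq> 0" using CU_D(2)[OF x] by simp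
  have m: "((\<lambda>r. - r) has_real_derivative - 1) (at (x $ None))"
    and i: "((\<lambda>r. 1 / r) has_real_derivative - 1 / (x $ None)\<^sup>2) (at (x $ None))"
    using r by (auto intro!: derivative_eq_intros simp: power2_eq_square)
  have c: "((\<lambda>r. 1) has_real_derivative 0) (at (x $ None))" by simp
  note C = pd_cong[OF open_CU x christoffel_cone(1)] pd_cong[OF open_CU x christoffel_cone(2)]
     pd_cong[OF open_CU x christoffel_cone(3)] pd_cong[OF open_CU x christoffel_cone(4)]
     pd_cong[OF open_CU x christoffel_cone(5)] pd_cong[OF open_CU x christoffel_cone(6)]
     pd_cong[OF open_CU x christoffel_cone(7)]
  note S1 = pd_separated[OF m diff[OF CU_D(1)[OF x]]]
    and S2 = pd_separated[OF i differentiable_const[of 1]]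
    and S3 = pd_separated[OF c christoffel_differentiable[OF CU_D(1)[OF x]]]
  show "pd m (christoffel CG k None None) x = 0" by (simp add: C)
  show "pd m (christoffel CG None None i) x = 0" by (simp add: C)
  show "pd m (christoffel CG None i None) x = 0" by (simp add: C)
  show "pd None (christoffel CG None (Some a) (Some b)) x = - g (sub_coords Some x) $ a $ b"
    "pd (Some d) (christoffel CG None (Some a) (Some b)) x = - x $ None * pd d (\<lambda>z. g z $ a $ b) (sub_coords Some x)"
    using S1(1)[of a b] S1(2)[of d a b] by (simp_all add: C)
  show "pd None (christoffel CG (Some c) None (Some b)) x = (if c = b then - 1 / (x $ None)\<^sup>2 else 0)"
    "pd None (christoffel CG (Some c) (Some a) None) x = (if c = a then - 1 / (x $ None)\<^sup>2 else 0)"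
    "pd (Some d) (christoffel CG (Some c) None (Some b)) x = 0"
    "pd (Some d) (christoffel CG (Some c) (Some a) None) x = 0"
    using S2 by (cases "c = b"; cases "c = a"; simp add: C)+
  show "pd (Some d) (christoffel CG (Some c) (Some a) (Some b)) x = pd d (christoffel g c a b) (sub_coords Some x)"
    "pd None (christoffel CG (Some c) (Some a) (Some b)) x = 0"
    using S3(1)[of c a b] S3(2)[of d c a b] by (simp_all add: C)
qed

text \<open>
  The first formula is the Gauss equation for the slices \<open>r = const\<close>. The other four index
  patterns are those that the Ricci tensor contracts.
\<close>

lemma riemann_up_cone:
  assumes x: "x \<in> CU"
  shows "riemann_up CG (Some m) (Some i) (Some j) (Some l) x = riemann_up g m i j l (sub_coords Some x)
      - (if m = i then g (sub_coords Some x) $ j $ l else 0) + (if m = j then g (sub_coords Some x) $ i $ l else 0)"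
    "riemann_up CG None None p q x = 0"
    "riemann_up CG (Some m) (Some m) None (Some l) x = 0"
    "riemann_up CG (Some m) (Some m) (Some j) None x = 0"
    "riemann_up CG (Some m) (Some m) None None x = 0"
proof -
  have r: "x $ None \<noteq> 0" using CU_D(2)[OF x] by simp
  note d = riemann_up_def pd_christoffel_cone[OF x] christoffel_cone[OF x] sum_UNIV_option
     if_distrib[of "\<lambda>t. t * _"] if_distrib[of "\<lambda>t. _ * t"] sum_subtractf sum_negf
  show "riemann_up CG (Some m) (Some i) (Some j) (Some l) x = riemann_up g m i j l (sub_coords Some x)
      - (if m = i then g (sub_coords Some x) $ j $ l else 0) + (if m = j then g (sub_coords Some x) $ i $ l else 0)"
    using r by (simp add: d cong: if_cong)
  show "riemann_up CG None None p q x = 0"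
    using r by (cases p; cases q) (simp_all add: d cong: if_cong)
  show "riemann_up CG (Some m) (Some m) None (Some l) x = 0"
    using r by (simp add: d cong: if_cong)
  show "riemann_up CG (Some m) (Some m) (Some j) None x = 0"
    using r by (simp add: d christoffel_sym[OF CU_D(1)[OF x], of m m j] cong: if_cong)
  show "riemann_up CG (Some m) (Some m) None None x = 0"
    using r by (simp add: d power2_eq_square cong: if_cong)
qed

lemma riemann_cone:
  assumes x: "x \<in> CU"
  shows "riemann CG (Some i) (Some j) (Some k) (Some l) x =
    (x $ None)\<^sup>2 * (riemann g i j k l (sub_coords Some x)
      - g (sub_coords Some x) $ i $ k * g (sub_coords Some x) $ j $ l
      + g (sub_coords Some x) $ i $ l * g (sub_coords Some x) $ k $ j)"
  by (simp add: riemann_def sum_UNIV_option riemann_up_cone[OF x] algebra_simps sum.distrib sum_subtractf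
      if_distrib[of "\<lambda>t. _ * t"] sum_distrib_left sym[OF CU_D(1)[OF x], of k i] cong: if_cong)

text \<open>
  Tracing the Gauss equation subtracts \<open>(dim - 1) g\<close> from the Ricci tensor of the link.
\<close>

lemma ricci_cone:
  assumes x: "x \<in> CU" and "ricci g (sub_coords Some x) = (real CARD('n) - 1) *\<^sub>R g (sub_coords Some x)"
  shows "ricci CG x = 0"
proof -
  have "invertible (CG x)"
    using cone_inverse[OF x] matrix_left_right_inverse unfolding invertible_def by blast
  note R = ricci_contract[of CG, OF this]
  have "ricci CG x $ j $ l = 0" for j l
    using ricci_contract[of g, OF inv[OF CU_D(1)[OF x]]] arg_cong[OF assms(2), of "\<lambda>A. A $ i $ j" for i j]
    by (cases j; cases l) (simp_all add: R sum_UNIV_option riemann_up_cone[OF x] sum.distrib sum_subtractf algebra_simps)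
  then show ?thesis by (simp add: vec_eq_iff)
qed

context
  fixes A :: "real^'n \<Rightarrow> real^'n^'n" and \<phi> \<phi>' :: "real \<Rightarrow> real"
  assumes A_sym: "\<And>z i j. z \<in> U \<Longrightarrow> A z $ i $ j = A z $ j $ i"
    and A_diff: "\<And>z i j. z \<in> U \<Longrightarrow> (\<lambda>y. A y $ i $ j) differentiable (at z)"
    and A_parallel: "\<And>z k i j. z \<in> U \<Longrightarrow> cov_deriv g A k i j z = 0"
    and A_tracefree: "\<And>z. z \<in> U \<Longrightarrow> (\<Sum>i\<in>UNIV. \<Sum>j\<in>UNIV. ginv g z i j * A z $ i $ j) = 0"
    and \<phi>: "\<And>r. r > 0 \<Longrightarrow> (\<phi> has_real_derivative \<phi>' r) (at r)"
begin

text \<open>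
  Tangent vectors of the link have length proportional to \<open>r\<close>, so the factor \<open>r\<^sup>2\<close> makes the norm of
  this tensor proportional to \<open>\<phi>\<close>.
\<close>

abbreviation "H \<equiv> link_tensor (\<lambda>r. r\<^sup>2 * \<phi> r) A"

text \<open>
  Radial differentiation acts on \<open>\<phi>\<close> alone. Differentiation along the link produces only mixed
  components, from \<open>\<nabla>\<^sub>X \<partial>\<^sub>r = X / r\<close>; the purely tangential ones vanish because \<open>A\<close> is parallel.
\<close>

lemma cov_deriv_H:
  assumes x: "x \<in> CU"
  shows "cov_deriv CG H None (Some a) (Some b) x = (x $ None)\<^sup>2 * \<phi>' (x $ None) * A (sub_coords Some x) $ a $ b"
    "cov_deriv CG H (Some c) (Some a) (Some b) x = 0"
    "cov_deriv CG H (Some a) (Some b) None x = - x $ None * \<phi> (x $ None) * A (sub_coords Some x) $ a $ b"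
    "cov_deriv CG H (Some a) None (Some b) x = - x $ None * \<phi> (x $ None) * A (sub_coords Some x) $ a $ b"
    "cov_deriv CG H None i None x = 0"
    "cov_deriv CG H None None i x = 0"
    "cov_deriv CG H k None None x = 0"
proof -
  have r: "x $ None \<noteq> 0" using CU_D(2)[OF x] by simp
  have q: "((\<lambda>r. r\<^sup>2 * \<phi> r) has_real_derivative
      (x $ None)\<^sup>2 * \<phi>' (x $ None) + 2 * x $ None * \<phi> (x $ None)) (at (x $ None))"
    using CU_D(2)[OF x] by (auto intro!: derivative_eq_intros \<phi>)
  note S = pd_separated[OF q A_diff[OF CU_D(1)[OF x]]]
  note d = cov_deriv_def christoffel_cone[OF x] sum_UNIV_option
     if_distrib[of "\<lambda>t. t * _"] if_distrib[of "\<lambda>t. _ * t"] sum.distrib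
  show "cov_deriv CG H None (Some a) (Some b) x = (x $ None)\<^sup>2 * \<phi>' (x $ None) * A (sub_coords Some x) $ a $ b"
    using r S(1)[of a b] by (simp add: d algebra_simps power2_eq_square cong: if_cong)
  show "cov_deriv CG H (Some c) (Some a) (Some b) x = 0"
  proof -
    have "cov_deriv CG H (Some c) (Some a) (Some b) x =
      ((x $ None)\<^sup>2 * \<phi> (x $ None)) * cov_deriv g A c a b (sub_coords Some x)"
      using S(2)[of c a b] by (simp add: d algebra_simps sum_distrib_left)
    then show ?thesis by (simp add: A_parallel CU_D[OF x])
  qed
  show "cov_deriv CG H (Some a) (Some b) None x = - x $ None * \<phi> (x $ None) * A (sub_coords Some x) $ a $ b"
    "cov_deriv CG H (Some a) None (Some b) x = - x $ None * \<phi> (x $ None) * A (sub_coords Some x) $ a $ b"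
    using r by (simp_all add: d power2_eq_square A_sym[OF CU_D(1)[OF x], of b a] cong: if_cong)
  show "cov_deriv CG H None i None x = 0" "cov_deriv CG H None None i x = 0" "cov_deriv CG H k None None x = 0"
    by (simp_all add: d)
qed

text \<open>
  The radial component is a multiple of the trace of \<open>A\<close>, the tangential ones a multiple of its
  divergence.
\<close>

lemma divergence_H:
  assumes x: "x \<in> CU"
  shows "divergence CG H j x = 0"
proof (cases j)
  case None
  have "divergence CG H None x = (\<Sum>k\<in>UNIV. \<Sum>i\<in>UNIV. (- \<phi> (x $ None) / x $ None) *
     (ginv g (sub_coords Some x) k i * A (sub_coords Some x) $ k $ i))"
    unfolding divergence_def sum_UNIV_option ginv_cone[OF x] cov_deriv_H[OF x]
    using CU_D(2)[OF x] by (auto intro!: sum.cong simp: field_simps power2_eq_square)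
  then show ?thesis
    using A_tracefree[OF CU_D(1)[OF x]] None by (simp only: sum_distrib_left[symmetric])
next
  case (Some a)
  then show ?thesis
    by (simp add: divergence_def sum_UNIV_option ginv_cone[OF x] cov_deriv_H[OF x])
qed

abbreviation "norm_A_sq z \<equiv> \<Sum>i\<in>UNIV. \<Sum>j\<in>UNIV. raise g A i j z * A z $ i $ j"

text \<open>
  The mixed components of \<open>\<nabla>h\<close> occur in two positions, whence the factor 2.
\<close>

lemma norm_cov_deriv_H:
  assumes x: "x \<in> CU"
  shows "norm_cov_deriv_sq CG H x =
    ((\<phi>' (x $ None))\<^sup>2 + 2 * (\<phi> (x $ None))\<^sup>2 / (x $ None)\<^sup>2) * norm_A_sq (sub_coords Some x)"
proof -
  let ?r = "x $ None" and ?z = "sub_coords Some x"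
  let ?S = "\<Sum>i\<in>UNIV. \<Sum>j\<in>UNIV. \<Sum>i'\<in>UNIV. \<Sum>j'\<in>UNIV. ginv g ?z i i' * ginv g ?z j j' * A ?z $ i $ j * A ?z $ i' $ j'"
  have r: "?r > 0" using CU_D(2)[OF x] .
  have "norm_cov_deriv_sq CG H x = (\<phi>' ?r)\<^sup>2 * ?S + (\<phi> ?r)\<^sup>2 / ?r\<^sup>2 * ?S + (\<phi> ?r)\<^sup>2 / ?r\<^sup>2 * ?S"
    unfolding sum_distrib_left
    unfolding norm_cov_deriv_sq_def sum_UNIV_option ginv_cone[OF x] cov_deriv_H[OF x]
    using r by (simp add: sum.distrib[symmetric] field_simps power2_eq_square)
  moreover have "norm_A_sq ?z = ?S"
    by (simp add: raise_def sum_distrib_left sum_distrib_right mult_ac)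
  ultimately show ?thesis by (simp add: algebra_simps)
qed

text \<open>
  In the Gauss equation the term with \<open>g\<^sub>i\<^sub>k g\<^sub>j\<^sub>l\<close> contracts to the square of the trace of \<open>A\<close>, which
  is zero, and the term with \<open>g\<^sub>i\<^sub>l g\<^sub>k\<^sub>j\<close> to its squared norm.
\<close>

lemma Rm_H:
  assumes x: "x \<in> CU"
  shows "Rm CG H x = (\<phi> (x $ None))\<^sup>2 / (x $ None)\<^sup>2 * (Rm g A (sub_coords Some x) + norm_A_sq (sub_coords Some x))"
proof -
  let ?r = "x $ None" and ?z = "sub_coords Some x"
  let ?h = "\<lambda>i j. raise g A i j ?z"
  have r: "?r \<noteq> 0" using CU_D(2)[OF x] by simp
  have ra: "raise CG H (Some a) (Some b) x = \<phi> ?r / ?r\<^sup>2 * ?h a b"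
    "raise CG H None i x = 0" "raise CG H i None x = 0" for a b i
    using r by (simp_all add: raise_def sum_UNIV_option ginv_cone[OF x] sum_distrib_left field_simps power2_eq_square)
  have "Rm CG H x = (\<Sum>i\<in>UNIV. \<Sum>j\<in>UNIV. \<Sum>k\<in>UNIV. \<Sum>l\<in>UNIV. (\<phi> ?r)\<^sup>2 / ?r\<^sup>2 *
      (riemann g i j k l ?z * ?h i k * ?h j l - (g ?z $ i $ k * ?h i k) * (g ?z $ j $ l * ?h j l)
        + ?h i k * (g ?z $ i $ l * g ?z $ k $ j * ?h j l)))"
    unfolding Rm_def sum_UNIV_option ra riemann_cone[OF x]
    using r by (auto intro!: sum.cong simp: field_simps power2_eq_square)
  also have "\<dots> = (\<phi> ?r)\<^sup>2 / ?r\<^sup>2 * (Rm g A ?z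
      - (\<Sum>i\<in>UNIV. \<Sum>j\<in>UNIV. \<Sum>k\<in>UNIV. \<Sum>l\<in>UNIV. (g ?z $ i $ k * ?h i k) * (g ?z $ j $ l * ?h j l))
      + (\<Sum>i\<in>UNIV. \<Sum>j\<in>UNIV. \<Sum>k\<in>UNIV. \<Sum>l\<in>UNIV. ?h i k * (g ?z $ k $ j * g ?z $ i $ l * ?h j l)))"
    by (simp add: Rm_def sum_distrib_left sum.distrib sum_subtractf algebra_simps)
  also have "(\<Sum>i\<in>UNIV. \<Sum>j\<in>UNIV. \<Sum>k\<in>UNIV. \<Sum>l\<in>UNIV. (g ?z $ i $ k * ?h i k) * (g ?z $ j $ l * ?h j l)) = 0"
  proof -
    have "(\<Sum>i\<in>UNIV. \<Sum>j\<in>UNIV. \<Sum>k\<in>UNIV. \<Sum>l\<in>UNIV. (g ?z $ i $ k * ?h i k) * (g ?z $ j $ l * ?h j l)) =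
      (\<Sum>i\<in>UNIV. \<Sum>k\<in>UNIV. g ?z $ i $ k * ?h i k) * (\<Sum>j\<in>UNIV. \<Sum>l\<in>UNIV. g ?z $ j $ l * ?h j l)"
      by (simp only: sum_product)
    then show ?thesis by (simp add: trace_raise[OF CU_D(1)[OF x]] A_tracefree[OF CU_D(1)[OF x]])
  qed
  also have "(\<Sum>i\<in>UNIV. \<Sum>j\<in>UNIV. \<Sum>k\<in>UNIV. \<Sum>l\<in>UNIV. ?h i k * (g ?z $ k $ j * g ?z $ i $ l * ?h j l)) = norm_A_sq ?z"
  proof (rule sum.cong[OF refl])
    fix i
    have "(\<Sum>j\<in>UNIV. \<Sum>k\<in>UNIV. \<Sum>l\<in>UNIV. ?h i k * (g ?z $ k $ j * g ?z $ i $ l * ?h j l)) =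
      (\<Sum>k\<in>UNIV. ?h i k * (\<Sum>j\<in>UNIV. \<Sum>l\<in>UNIV. g ?z $ k $ j * g ?z $ i $ l * ?h j l))"
      by (subst sum.swap) (simp add: sum_distrib_left)
    then show "(\<Sum>j\<in>UNIV. \<Sum>k\<in>UNIV. \<Sum>l\<in>UNIV. ?h i k * (g ?z $ k $ j * g ?z $ i $ l * ?h j l)) = (\<Sum>k\<in>UNIV. ?h i k * A ?z $ i $ k)"
      by (simp add: lower_raise[OF CU_D(1)[OF x]] A_sym[OF CU_D(1)[OF x], of i])
  qed
  finally show ?thesis by simp
qed

end
end

section \<open>Determinants of block matrices\<close>

text \<open>
  If \<open>B\<close> is the identity in the rows outside the range of \<open>f\<close>, the Leibniz formula only sees the
  permutations that fix these rows, and they are the images of the permutations for \<open>A\<close>.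
\<close>

lemma det_embed:
  fixes A :: "real^'a^'a::finite" and B :: "real^'b^'b::finite" and f :: "'a \<Rightarrow> 'b"
  assumes f: "inj f" and AB: "\<And>i j. B $ f i $ f j = A $ i $ j"
    and out: "\<And>i j. i \<notin> range f \<Longrightarrow> B $ i $ j = (if i = j then 1 else 0)"
  shows "det B = det A"
proof -
  let ?m = "map_permutation UNIV f" and ?m' = "map_permutation (range f) (inv f)"
  have bij: "bij_betw f UNIV (range f)" "bij_betw (inv f) (range f) UNIV"
    using f by (auto simp: inj_on_imp_bij_betw bij_betw_inv_into)
  have "det B = (\<Sum>p\<in>{p. p permutes range f}. of_int (sign p) * (\<Prod>i\<in>UNIV. B $ i $ p i))"
    unfolding det_def
  proof (rule sum.mono_neutral_right)
    show "finite {p. p permutes (UNIV::'b set)}" by simp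
    show "{p. p permutes range f} \<subseteq> {p. p permutes UNIV}" by (auto intro: permutes_subset)
    show "\<forall>p\<in>{p. p permutes UNIV} - {p. p permutes range f}. of_int (sign p) * (\<Prod>i\<in>UNIV. B $ i $ p i) = 0"
    proof
      fix p assume p: "p \<in> {p. p permutes UNIV} - {p. p permutes range f}"
      then obtain i where "i \<notin> range f" "p i \<noteq> i"
        using permutes_superset[of p UNIV "range f"] by blast
      then have "B $ i $ p i = 0" by (simp add: out)
      then show "of_int (sign p) * (\<Prod>i\<in>UNIV. B $ i $ p i) = 0" by (auto intro!: prod_zero)
    qed
  qed
  also have "\<dots> = (\<Sum>p\<in>{p. p permutes UNIV}. of_int (sign p) * (\<Prod>i\<in>UNIV. A $ i $ p i))"
  proof (rule sum.reindex_bij_witness[of _ ?m ?m'])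
    fix p assume "p \<in> {p. p permutes range f}"
    then have p: "p permutes range f" by simp
    show "?m (?m' p) = p"
    proof -
      have "?m (?m' p) = map_permutation (range f) (f \<circ> inv f) p"
        by (rule map_permutation_compose[OF bij(2) f])
      also have "\<dots> = map_permutation (range f) (\<lambda>x. x) p"
        by (rule map_permutation_cong) (use p in \<open>auto simp: f_inv_into_f inj_on_def\<close>)
      finally show ?thesis using p by simp
    qed
    show m': "?m' p \<in> {p. p permutes UNIV}"
      using map_permutation_permutes[OF bij(2) p] by simp
    have "f (?m' p a) = p (f a)" for a
      using map_permutation_apply[of "inv f" "range f" "f a" p] bij(2) f p permutes_in_image[OF p, of "f a"]
      by (simp add: bij_betw_def f_inv_into_f)
    then have e: "A $ a $ ?m' p a = B $ f a $ p (f a)" for a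
      using AB[of a "?m' p a"] by simp
    have "(\<Prod>i\<in>UNIV. B $ i $ p i) = (\<Prod>i\<in>range f. B $ i $ p i)"
      using out permutes_not_in[OF p] by (intro prod.mono_neutral_right) auto
    also have "\<dots> = (\<Prod>a\<in>UNIV. A $ a $ ?m' p a)"
      by (simp add: prod.reindex[OF f] e)
    finally show "of_int (sign (?m' p)) * (\<Prod>i\<in>UNIV. A $ i $ ?m' p i) = of_int (sign p) * (\<Prod>i\<in>UNIV. B $ i $ p i)"
      using sign_map_permutation[of "inv f" "range f" p] bij(2) p by (simp add: bij_betw_def)
  next
    fix p :: "'a \<Rightarrow> 'a" assume "p \<in> {p. p permutes UNIV}"
    then have p: "p permutes UNIV" by simp
    show "?m p \<in> {p. p permutes range f}"
      using map_permutation_permutes[OF bij(1) p] by simp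
    show "?m' (?m p) = p"
      using map_permutation_compose[OF bij(1), where p=p and g="inv f"] bij(2) p f by (simp add: bij_betw_def)
  qed
  also have "\<dots> = det A" by (simp add: det_def)
  finally show ?thesis .
qed

lemma det_prod_block: "det (prod_block A B x) = det (A (sub_coords Inl x)) * det (B (sub_coords Inr x))"
proof -
  let ?I = "\<lambda>_. mat 1"
  \<comment> \<open>A block diagonal matrix is the product of two matrices with one trivial block each.\<close>
  have "prod_block A B x $ i $ j = (prod_block A ?I x ** prod_block ?I B x) $ i $ j" for i j
    by (cases i; cases j) (simp_all add: matrix_matrix_mult_def sum_UNIV_Plus mat_def
        if_distrib[of "\<lambda>t. t * _"] if_distrib[of "\<lambda>t. _ * t"] cong: if_cong)
  then have "prod_block A B x = prod_block A ?I x ** prod_block ?I B x"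
    unfolding vec_eq_iff by blast
  then have "det (prod_block A B x) = det (prod_block A ?I x) * det (prod_block ?I B x)"
    by (simp only: det_mul)
  moreover have "det (prod_block A ?I x) = det (A (sub_coords Inl x))"
  proof (rule det_embed[of Inl])
    fix i j :: "'a + 'b" assume "i \<notin> range Inl"
    then show "prod_block A ?I x $ i $ j = (if i = j then 1 else 0)"
      by (cases i; cases j) (auto simp: mat_def)
  qed auto
  moreover have "det (prod_block ?I B x) = det (B (sub_coords Inr x))"
  proof (rule det_embed[of Inr])
    fix i j :: "'a + 'b" assume "i \<notin> range Inr"
    then show "prod_block ?I B x $ i $ j = (if i = j then 1 else 0)"
      by (cases i; cases j) (auto simp: mat_def)
  qed auto
  ultimately show ?thesis by simp
qed

lemma det_cone_block:
  fixes g :: "real^'n \<Rightarrow> real^'n^'n::finite"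
  shows "det (cone_block g x) = ((x $ None)\<^sup>2) ^ CARD('n) * det (g (sub_coords Some x))"
proof -
  have "det (cone_block g x) = det ((x $ None)\<^sup>2 *\<^sub>R g (sub_coords Some x))"
  proof (rule det_embed[of Some])
    fix i j :: "'n option" assume "i \<notin> range Some"
    then show "cone_block g x $ i $ j = (if i = j then 1 else 0)"
      by (cases i; cases j) auto
  qed auto
  also have "\<dots> = ((x $ None)\<^sup>2) ^ CARD('n) * det (g (sub_coords Some x))"
    by (simp add: det_def prod.distrib sum_distrib_left mult_ac)
  finally show ?thesis .
qed


section \<open>Lebesgue measure and coordinates\<close>

lemma prod_Basis_vec:
  fixes v :: "real^'n::finite"
  shows "(\<Prod>b\<in>Basis. v \<bullet> b) = (\<Prod>i\<in>UNIV. v $ i)"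
proof -
  have B: "Basis = range (\<lambda>i::'n. axis i (1::real))" by (auto simp: Basis_vec_def)
  have "inj (\<lambda>i::'n. axis i (1::real))" by (auto simp: inj_on_def axis_eq_axis)
  then show ?thesis unfolding B by (subst prod.reindex) (simp_all add: inner_axis o_def)
qed

lemma emeasure_lborel_box_vec:
  fixes l u :: "real^'n::finite"
  assumes "\<And>i. l $ i \<le> u $ i"
  shows "emeasure lborel (box l u) = ennreal (\<Prod>i\<in>UNIV. u $ i - l $ i)"
proof -
  have "l \<bullet> b \<le> u \<bullet> b" if "b \<in> Basis" for b
    using that assms by (auto simp: Basis_vec_def inner_axis)
  then show ?thesis by (simp add: emeasure_lborel_box prod_Basis_vec)
qed

lemma lborel_eqI_vec:
  fixes M :: "(real^'n::finite) measure"
  assumes "\<And>l u. (\<And>i. l $ i \<le> u $ i) \<Longrightarrow> emeasure M (box l u) = ennreal (\<Prod>i\<in>UNIV. u $ i - l $ i)"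
    and "sets M = sets borel"
  shows "M = lborel"
proof (rule lborel_eqI[symmetric, OF _ assms(2)])
  fix l u :: "real^'n" assume "\<And>b. b \<in> Basis \<Longrightarrow> l \<bullet> b \<le> u \<bullet> b"
  then have "l $ i \<le> u $ i" for i by (metis axis_in_Basis_iff inner_axis inner_real_def mult.right_neutral Basis_real_def insertI1)
  then show "emeasure M (box l u) = (\<Prod>b\<in>Basis. (u - l) \<bullet> b)"
    using assms(1)[of l u] by (simp add: prod_Basis_vec)
qed

lemma borel_measurable_sub_coords [measurable]: "sub_coords e \<in> borel_measurable borel"
  by (intro borel_measurable_continuous_onI linear_continuous_on bounded_linear_sub_coords)

lemma lborel_relabel:
  fixes f :: "'a::finite \<Rightarrow> 'b::finite"
  assumes f: "bij f"
  shows "distr lborel borel (sub_coords f) = lborel"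
proof (rule lborel_eqI_vec)
  fix l u :: "real^'a" assume le: "\<And>i. l $ i \<le> u $ i"
  let ?e = "sub_coords (inv f) :: real^'a \<Rightarrow> real^'b"
  have "sub_coords f -` box l u = box (?e l) (?e u)"
    using bij_is_surj[OF f] f
    by (auto simp: mem_box_cart bij_is_surj inj_imp_surj_inv) (metis bij_inv_eq_iff)+
  then have "emeasure (distr lborel borel (sub_coords f)) (box l u) = ennreal (\<Prod>i\<in>UNIV. u $ inv f i - l $ inv f i)"
    using le by (simp add: emeasure_distr emeasure_lborel_box_vec)
  also have "(\<Prod>i\<in>UNIV. u $ inv f i - l $ inv f i) = (\<Prod>i\<in>UNIV. u $ i - l $ i)"
    by (rule prod.reindex_bij_betw[OF bij_imp_bij_inv[OF f]])
  finally show "emeasure (distr lborel borel (sub_coords f)) (box l u) = ennreal (\<Prod>i\<in>UNIV. u $ i - l $ i)" .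
qed simp

definition join :: "(real^'m) \<times> (real^'n) \<Rightarrow> real^('m::finite + 'n::finite)" where
  "join = (\<lambda>(x, y). \<chi> i. case i of Inl a \<Rightarrow> x $ a | Inr b \<Rightarrow> y $ b)"

definition cons_coord :: "real \<times> (real^'n) \<Rightarrow> real^('n::finite option)" where
  "cons_coord = (\<lambda>(r, x). \<chi> i. case i of None \<Rightarrow> r | Some a \<Rightarrow> x $ a)"

lemma join_nth [simp]: "join (x, y) $ Inl a = x $ a" "join (x, y) $ Inr b = y $ b"
  and cons_coord_nth [simp]: "cons_coord (r, z) $ None = r" "cons_coord (r, z) $ Some c = z $ c"
  by (simp_all add: join_def cons_coord_def)

lemma sub_coords_join [simp]: "sub_coords Inl (join (x, y)) = x" "sub_coords Inr (join (x, y)) = y"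
  and sub_coords_cons [simp]: "sub_coords Some (cons_coord (r, z)) = z"
  by (simp_all add: vec_eq_iff)

lemma borel_measurable_vecI:
  fixes f :: "'a \<Rightarrow> real^'n::finite"
  assumes "\<And>i. (\<lambda>x. f x $ i) \<in> borel_measurable M"
  shows "f \<in> borel_measurable M"
  using assms by (intro borel_measurable_euclidean_space[THEN iffD2]) (auto simp: Basis_vec_def inner_axis)

lemma borel_measurable_vec_nth' [measurable]: "(\<lambda>x::real^'n::finite. x $ i) \<in> borel_measurable borel"
  by (intro borel_measurable_continuous_onI continuous_intros)

lemma measurable_join [measurable]: "join \<in> borel_measurable (borel \<Otimes>\<^sub>M borel)"
proof (rule borel_measurable_vecI)
  fix i :: "'a + 'b"
  show "(\<lambda>p. join p $ i) \<in> borel_measurable (borel \<Otimes>\<^sub>M borel)"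
    by (cases i) (simp_all add: join_def case_prod_unfold)
qed

lemma measurable_cons_coord [measurable]: "cons_coord \<in> borel_measurable (borel \<Otimes>\<^sub>M borel)"
proof (rule borel_measurable_vecI)
  fix i :: "'a option"
  show "(\<lambda>p. cons_coord p $ i) \<in> borel_measurable (borel \<Otimes>\<^sub>M borel)"
    by (cases i) (simp_all add: cons_coord_def case_prod_unfold)
qed

lemma lborel_join: "distr (lborel \<Otimes>\<^sub>M lborel) borel join = lborel"
proof (rule lborel_eqI_vec)
  fix l u :: "real^('a + 'b)" assume le: "\<And>i. l $ i \<le> u $ i"
  have "join -` box l u = box (sub_coords Inl l) (sub_coords Inl u) \<times> box (sub_coords Inr l) (sub_coords Inr u)"
    by (auto simp: mem_box_cart) (metis join_nth sum.exhaust)+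
  then have "emeasure (distr (lborel \<Otimes>\<^sub>M lborel) borel join) (box l u) =
     ennreal (\<Prod>i\<in>UNIV. u $ Inl i - l $ Inl i) * ennreal (\<Prod>i\<in>UNIV. u $ Inr i - l $ Inr i)"
    using le by (simp add: emeasure_distr space_pair_measure lborel.emeasure_pair_measure_Times emeasure_lborel_box_vec)
  also have "\<dots> = ennreal (\<Prod>i\<in>UNIV. u $ i - l $ i)"
    using le by (simp add: ennreal_mult[symmetric] prod_nonneg UNIV_Plus_UNIV[symmetric] prod.Plus del: UNIV_Plus_UNIV)
  finally show "emeasure (distr (lborel \<Otimes>\<^sub>M lborel) borel join) (box l u) = ennreal (\<Prod>i\<in>UNIV. u $ i - l $ i)" .
qed simp

lemma lborel_cons_coord: "distr (lborel \<Otimes>\<^sub>M lborel) borel cons_coord = lborel"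
proof (rule lborel_eqI_vec)
  fix l u :: "real^('a option)" assume le: "\<And>i. l $ i \<le> u $ i"
  have "cons_coord -` box l u = {l $ None<..<u $ None} \<times> box (sub_coords Some l) (sub_coords Some u)"
    by (auto simp: mem_box_cart) (metis cons_coord_nth option.exhaust)+
  then have "emeasure (distr (lborel \<Otimes>\<^sub>M lborel) borel cons_coord) (box l u) =
     ennreal (u $ None - l $ None) * ennreal (\<Prod>i\<in>UNIV. u $ Some i - l $ Some i)"
    using le by (simp add: emeasure_distr space_pair_measure lborel.emeasure_pair_measure_Times emeasure_lborel_box_vec)
  also have "\<dots> = ennreal (\<Prod>i\<in>UNIV. u $ i - l $ i)"
    using le by (simp add: ennreal_mult[symmetric] prod_nonneg UNIV_option_conv prod.reindex)
  finally show "emeasure (distr (lborel \<Otimes>\<^sub>M lborel) borel cons_coord) (box l u) = ennreal (\<Prod>i\<in>UNIV. u $ i - l $ i)" .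
qed simp


section \<open>Change of variables for non-negative integrands\<close>

text \<open>
  The change of variables theorem for absolute integrals is stated for well-ordered index types. A
  copy of a finite index type, ordered along an injection into the natural numbers, carries it over
  to all finite index types, as relabelling the coordinates preserves Lebesgue measure and
  determinants.
\<close>

typedef 'a ordered = "UNIV :: 'a set" by simp

instance ordered :: (finite) finite
proof
  have "(UNIV :: 'a ordered set) = range Abs_ordered" by (metis Abs_ordered_cases UNIV_eq_I rangeI)
  then show "finite (UNIV :: 'a ordered set)" by (metis finite finite_imageI)
qed

definition ordinal :: "'a::finite ordered \<Rightarrow> nat" where
  "ordinal = (SOME f. inj f)"

lemma inj_ordinal: "inj (ordinal :: 'a::finite ordered \<Rightarrow> nat)"
proof -
  obtain f :: "'a ordered \<Rightarrow> nat" where "inj f"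
    using finite_imp_inj_to_nat_seg[of "UNIV :: 'a ordered set"] by auto
  then show ?thesis unfolding ordinal_def by (rule someI[where P="\<lambda>f. inj f"])
qed

instantiation ordered :: (finite) wellorder
begin

definition less_eq_ordered :: "'a ordered \<Rightarrow> 'a ordered \<Rightarrow> bool" where
  "less_eq_ordered x y \<longleftrightarrow> ordinal x \<le> ordinal y"

definition less_ordered :: "'a ordered \<Rightarrow> 'a ordered \<Rightarrow> bool" where
  "less_ordered x y \<longleftrightarrow> ordinal x < ordinal y"

instance
proof
  fix P :: "'a ordered \<Rightarrow> bool" and a :: "'a ordered"
  assume step: "\<And>x. (\<And>y. y < x \<Longrightarrow> P y) \<Longrightarrow> P x"
  show "P a"
  proof (rule measure_induct_rule[of ordinal P a])
    fix x :: "'a ordered" assume "\<And>y. ordinal y < ordinal x \<Longrightarrow> P y"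
    then show "P x" by (intro step[of x]) (simp add: less_ordered_def)
  qed
qed (auto simp: less_eq_ordered_def less_ordered_def inj_eq[OF inj_ordinal])

end

lemma bij_ordered: "bij (Rep_ordered :: 'a ordered \<Rightarrow> 'a)" "bij (Abs_ordered :: 'a \<Rightarrow> 'a ordered)"
  by (rule o_bij[of Abs_ordered] o_bij[of Rep_ordered];
      simp add: fun_eq_iff Rep_ordered_inverse Abs_ordered_inverse)+

text \<open>
  By the theorem for absolute integrals, one integrand is integrable if and only if the other is. If
  both are, the integrals agree, and otherwise both are infinite.
\<close>

lemma nn_integral_change_of_variables_wellorder:
  fixes T :: "real^'n::{finite,wellorder} \<Rightarrow> real^'n::_" and f :: "real^'n::_ \<Rightarrow> real"
  assumes S: "S \<in> sets borel" and TS: "T ` S \<in> sets borel"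
    and T: "\<And>x. x \<in> S \<Longrightarrow> (T has_derivative T' x) (at x within S)" and inj: "inj_on T S"
    and f: "(\<lambda>y. indicator (T ` S) y * f y) \<in> borel_measurable borel"
    and f': "(\<lambda>x. indicator S x * (\<bar>det (matrix (T' x))\<bar> * f (T x))) \<in> borel_measurable borel"
    and nn: "\<And>y. y \<in> T ` S \<Longrightarrow> f y \<ge> 0"
  shows "(\<integral>\<^sup>+y. ennreal (indicator (T ` S) y * f y) \<partial>lborel) =
     (\<integral>\<^sup>+x. ennreal (indicator S x * (\<bar>det (matrix (T' x))\<bar> * f (T x))) \<partial>lborel)"
proof -
  let ?F = "\<lambda>y. indicator (T ` S) y * f y" and ?G = "\<lambda>x. indicator S x * (\<bar>det (matrix (T' x))\<bar> * f (T x))"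
  have A: "h absolutely_integrable_on X \<and> integral X h = b \<longleftrightarrow>
     integrable lborel (\<lambda>y. indicator X y * h y) \<and> (\<integral>y. indicator X y * h y \<partial>lborel) = b"
    if "(\<lambda>y. indicator X y * h y) \<in> borel_measurable borel" for X :: "(real^'n::_) set" and h :: "real^'n::_ \<Rightarrow> real" and b
    using that set_lebesgue_integral_eq_integral(2)[of X h]
    by (auto simp: set_integrable_def set_lebesgue_integral_def integrable_completion integral_completion)
  have "(\<lambda>x. \<bar>det (matrix (T' x))\<bar> *\<^sub>R vec (f (T x)) :: real^1) absolutely_integrable_on S \<and>
           integral S (\<lambda>x. \<bar>det (matrix (T' x))\<bar> *\<^sub>R vec (f (T x))) = (vec b :: real^1)
     \<longleftrightarrow> (\<lambda>x. vec (f x) :: real^1) absolutely_integrable_on (T ` S) \<and> integral (T ` S) (\<lambda>x. vec (f x)) = (vec b :: real^1)" for b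
    by (intro has_absolute_integral_change_of_variables T inj) (use S in auto)
  then have "(\<lambda>x. \<bar>det (matrix (T' x))\<bar> * f (T x)) absolutely_integrable_on S \<and>
           integral S (\<lambda>x. \<bar>det (matrix (T' x))\<bar> * f (T x)) = b
     \<longleftrightarrow> f absolutely_integrable_on (T ` S) \<and> integral (T ` S) f = b" for b
    by (simp add: absolutely_integrable_on_1_iff integral_on_1_eq)
  then have eq: "integrable lborel ?G \<and> (\<integral>x. ?G x \<partial>lborel) = b \<longleftrightarrow> integrable lborel ?F \<and> (\<integral>y. ?F y \<partial>lborel) = b" for b
    unfolding A[OF f] A[OF f'] .
  have n: "?F y \<ge> 0" "?G x \<ge> 0" for x y using nn by (auto simp: indicator_def)
  show ?thesis
  proof (cases "integrable lborel ?F")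
    case True
    then have "integrable lborel ?G" "(\<integral>x. ?G x \<partial>lborel) = (\<integral>y. ?F y \<partial>lborel)" using eq by auto
    with True show ?thesis using n by (simp add: nn_integral_eq_integral)
  next
    case False
    then have "\<not> integrable lborel ?G" using eq by auto
    with False have "(\<integral>\<^sup>+y. ennreal (?F y) \<partial>lborel) = \<infinity>" "(\<integral>\<^sup>+x. ennreal (?G x) \<partial>lborel) = \<infinity>"
      using f f' n by (auto simp: integrable_iff_bounded less_top[symmetric])
    then show ?thesis by simp
  qed
qed

lemma nn_integral_change_of_variables:
  fixes T :: "real^'n::finite \<Rightarrow> real^'n" and f :: "real^'n \<Rightarrow> real"
  assumes S: "S \<in> sets borel" and TS: "T ` S \<in> sets borel"
    and T: "\<And>x. x \<in> S \<Longrightarrow> (T has_derivative T' x) (at x within S)" and inj: "inj_on T S"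
    and f: "(\<lambda>y. indicator (T ` S) y * f y) \<in> borel_measurable borel"
    and f': "(\<lambda>x. indicator S x * (\<bar>det (matrix (T' x))\<bar> * f (T x))) \<in> borel_measurable borel"
    and nn: "\<And>y. y \<in> T ` S \<Longrightarrow> f y \<ge> 0"
  shows "(\<integral>\<^sup>+y. ennreal (indicator (T ` S) y * f y) \<partial>lborel) =
     (\<integral>\<^sup>+x. ennreal (indicator S x * (\<bar>det (matrix (T' x))\<bar> * f (T x))) \<partial>lborel)"
proof -
  let ?s = "sub_coords Rep_ordered :: real^'n \<Rightarrow> real^('n ordered)"
  let ?t = "sub_coords Abs_ordered :: real^('n ordered) \<Rightarrow> real^'n"
  have ts [simp]: "?t (?s x) = x" and st [simp]: "?s (?t y) = y" for x y
    by (simp_all add: vec_eq_iff Rep_ordered_inverse Abs_ordered_inverse)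
  have image: "?s ` X = ?t -` X" for X by (force simp: image_iff intro: st[symmetric])
  have b: "?s ` X \<in> sets borel" if "X \<in> sets borel" for X
    unfolding image using measurable_sets[OF borel_measurable_sub_coords that, of Abs_ordered] by simp
  let ?T = "?s \<circ> T \<circ> ?t" and ?D = "\<lambda>y. ?s \<circ> T' (?t y) \<circ> ?t"
  have im: "?T ` ?s ` S = ?s ` T ` S" by (auto simp: image_comp)
  have lin: "linear (T' x)" if "x \<in> S" for x using T[OF that] has_derivative_linear by blast
  have det: "det (matrix (?D y)) = det (matrix (T' (?t y)))" if "?t y \<in> S" for y
  proof (rule det_embed[of Rep_ordered, symmetric])
    fix i j
    have "?t (axis j 1) = axis (Rep_ordered j) 1"
      by (auto simp: vec_eq_iff axis_def Abs_ordered_inverse) (metis Rep_ordered_inverse)+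
    then show "matrix (T' (?t y)) $ Rep_ordered i $ Rep_ordered j = matrix (?D y) $ i $ j"
      by (simp add: matrix_def)
  qed (use bij_ordered in \<open>auto simp: bij_def\<close>)
  have ind: "indicator (?s ` X) y = (indicator X (?t y) :: real)" for X y
    by (simp add: image indicator_def)
  have nni: "(\<integral>\<^sup>+x. h x \<partial>lborel) = (\<integral>\<^sup>+y. h (?t y) \<partial>lborel)" if "h \<in> borel_measurable borel" for h :: "real^'n \<Rightarrow> ennreal"
    using that by (subst lborel_relabel[OF bij_ordered(2), symmetric]) (simp add: nn_integral_distr)
  have "(\<integral>\<^sup>+y. ennreal (indicator (?T ` ?s ` S) y * f (?t y)) \<partial>lborel) =
     (\<integral>\<^sup>+x. ennreal (indicator (?s ` S) x * (\<bar>det (matrix (?D x))\<bar> * f (?t (?T x)))) \<partial>lborel)"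
  proof (rule nn_integral_change_of_variables_wellorder)
    show "?s ` S \<in> sets borel" "?T ` ?s ` S \<in> sets borel" unfolding im using b S TS by blast+
    show "inj_on ?T (?s ` S)" using inj by (auto simp: inj_on_def) (metis ts)
    show "(\<lambda>y. indicator (?T ` ?s ` S) y * f (?t y)) \<in> borel_measurable borel"
      unfolding im ind by (rule measurable_compose[OF borel_measurable_sub_coords f])
    have "(\<lambda>x. indicator (?s ` S) x * (\<bar>det (matrix (?D x))\<bar> * f (?t (?T x)))) =
       (\<lambda>y. (\<lambda>x. indicator S x * (\<bar>det (matrix (T' x))\<bar> * f (T x))) (?t y))"
      unfolding ind by (auto simp: fun_eq_iff indicator_def det)
    then show "(\<lambda>x. indicator (?s ` S) x * (\<bar>det (matrix (?D x))\<bar> * f (?t (?T x)))) \<in> borel_measurable borel"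
      using measurable_compose[OF borel_measurable_sub_coords f'] by simp
    show "0 \<le> f (?t y)" if "y \<in> ?T ` ?s ` S" for y
      using that nn by auto
    show "(?T has_derivative ?D y) (at y within ?s ` S)" if "y \<in> ?s ` S" for y
    proof -
      have l: "((sub_coords e) has_derivative sub_coords e) F" for e :: "'x::finite \<Rightarrow> 'y::finite" and F
        by (rule bounded_linear_imp_has_derivative[OF bounded_linear_sub_coords])
      have "?t ` ?s ` S = S" by (simp add: image_comp comp_def)
      then show ?thesis
        using that T[of "?t y"]
        by (intro diff_chain_within l) auto
    qed
  qed
  also have "\<dots> = (\<integral>\<^sup>+x. ennreal (indicator S (?t x) * (\<bar>det (matrix (T' (?t x)))\<bar> * f (T (?t x)))) \<partial>lborel)"
    unfolding ind by (intro nn_integral_cong) (auto simp: indicator_def det)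
  also have "\<dots> = (\<integral>\<^sup>+x. ennreal (indicator S x * (\<bar>det (matrix (T' x))\<bar> * f (T x))) \<partial>lborel)"
    by (rule nni[symmetric]) (use f' in simp)
  finally show ?thesis
    unfolding im ind using f by (subst nni) simp_all
qed

section \<open>The volume of a closed Riemannian manifold\<close>

lemma posdef_invertible:
  fixes A :: "real^'n^'n::finite"
  assumes "\<And>v. v \<noteq> 0 \<Longrightarrow> v \<bullet> (A *v v) > 0"
  shows "invertible A"
proof -
  have "\<forall>v. A *v v = 0 \<longrightarrow> v = 0" using assms by (metis inner_zero_right less_irrefl)
  then show ?thesis
    by (metis invertible_def matrix_left_invertible_ker matrix_left_right_inverse)
qed

text \<open>
  The segment from the identity to \<open>A\<close> consists of positive definite, hence invertible, matrices, so
  the determinant cannot change its sign along it.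
\<close>

lemma posdef_det_pos:
  fixes A :: "real^'n^'n::finite"
  assumes A: "\<And>v. v \<noteq> 0 \<Longrightarrow> v \<bullet> (A *v v) > 0"
  shows "det A > 0"
proof (rule ccontr)
  assume neg: "\<not> det A > 0"
  let ?P = "\<lambda>t. (1 - t) *\<^sub>R mat 1 + t *\<^sub>R A :: real^'n^'n"
  have "(\<lambda>t. det (?P t)) differentiable (at t)" for t
    by (intro differentiable_det) (simp add: differentiable_mult differentiable_add differentiable_diff)
  then have "continuous_on {0..1} (\<lambda>t. det (?P t))"
    by (auto intro!: continuous_at_imp_continuous_on differentiable_imp_continuous_within)
  moreover have "det (?P 1) \<le> 0" "0 \<le> det (?P 0)" using neg by simp_all
  ultimately obtain t where t: "0 \<le> t" "t \<le> 1" "det (?P t) = 0"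
    using IVT2'[of "\<lambda>t. det (?P t)" 1 0 0] by auto
  have "v \<bullet> (?P t *v v) > 0" if "v \<noteq> 0" for v
  proof -
    have "v \<bullet> (?P t *v v) = (1 - t) * (v \<bullet> v) + t * (v \<bullet> (A *v v))"
      by (simp add: matrix_vector_mult_add_rdistrib scaleR_matrix_vector_assoc[symmetric] inner_add_right)
    also have "\<dots> > 0"
    proof (cases "t = 1")
      case False
      then have "0 < (1 - t) * (v \<bullet> v)" "0 \<le> t * (v \<bullet> (A *v v))"
        using t that less_imp_le[OF A[OF that]] by auto
      then show ?thesis by linarith
    qed (use A[OF that] in simp)
    finally show ?thesis .
  qed
  then have "det (?P t) \<noteq> 0" using posdef_invertible invertible_det_nz by blast
  with t show False by simp
qed

lemma Ck_on_pd: "Ck_on (Suc k) S f \<Longrightarrow> Ck_on k S (pd i f)"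
  by (drule Ck_on_SucD(2)[of k S f "axis i 1"]) (simp add: pd_def[abs_def])

lemma riemannian_local_metric:
  assumes "riemannian_manifold M g"
  shows "local_metric (chart_img M c) (g c)"
proof
  show o: "open (chart_img M c)"
    using assms unfolding riemannian_manifold_def smooth_manifold_def by blast
  fix x i j k assume x: "x \<in> chart_img M c"
  have "transpose (g c x) = g c x"
    using assms x unfolding riemannian_manifold_def sym_tensor_field_def by blast
  from arg_cong[OF this, of "\<lambda>A. A $ j $ i"] show "g c x $ i $ j = g c x $ j $ i"
    by (simp add: transpose_def)
  show "invertible (g c x)"
    using assms x unfolding riemannian_manifold_def by (intro posdef_invertible) blast
  have s: "smooth_on (chart_img M c) (g c)"
    using assms unfolding riemannian_manifold_def sym_tensor_field_def by blast
  then have "Ck_on (Suc (Suc 0)) (chart_img M c) (\<lambda>y. g c y $ i $ j)"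
    using smooth_on_matrixD[OF o s] unfolding smooth_on_def by blast
  from Ck_on_SucD(1)[OF this x] Ck_on_SucD(1)[OF Ck_on_pd[OF this] x]
  show "(\<lambda>y. g c y $ i $ j) differentiable (at x)" "pd k (\<lambda>y. g c y $ i $ j) differentiable (at x)"
    by (auto simp: differentiable_def)
qed

definition chart_vol :: "('i, 'a, 'n::finite) atlas \<Rightarrow> ('i, 'n) tensor2 \<Rightarrow> 'i \<Rightarrow> 'a set \<Rightarrow> ennreal" where
  "chart_vol M g c A = (\<integral>\<^sup>+x\<in>chart M c ` A. ennreal (sqrt (det (g c x))) \<partial>lborel)"

lemma sum_of_restricted_measures:
  fixes W :: "nat \<Rightarrow> 'a::topological_space measure"
  assumes W: "\<And>k. k < N \<Longrightarrow> sets (W k) = sets borel" and P: "\<And>k. k < N \<Longrightarrow> P k \<in> sets borel"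
  shows "\<exists>V. sets V = sets borel \<and> (\<forall>A\<in>sets borel. emeasure V A = (\<Sum>k<N. emeasure (W k) (A \<inter> P k)))"
proof -
  let ?\<mu> = "\<lambda>A. \<Sum>k<N. emeasure (W k) (A \<inter> P k)"
  define V where "V = measure_of UNIV (sets borel) ?\<mu>"
  have sp: "UNIV = space (borel :: 'a measure)" by simp
  have sets: "sets V = sets borel"
    unfolding V_def sp by (simp only: sets_measure_of[OF sets.space_closed] sets.sigma_sets_eq)
  have ca: "countably_additive (sets V) ?\<mu>"
  proof (rule countably_additiveI)
    fix A :: "nat \<Rightarrow> 'a set" assume A: "range A \<subseteq> sets V" "disjoint_family A"
    have "(\<Sum>i. ?\<mu> (A i)) = (\<Sum>k<N. \<Sum>i. emeasure (W k) (A i \<inter> P k))"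
      by (rule suminf_sum) (simp add: summableI)
    also have "\<dots> = ?\<mu> (\<Union>i. A i)"
    proof (rule sum.cong[OF refl])
      fix k assume "k \<in> {..<N}"
      then show "(\<Sum>i. emeasure (W k) (A i \<inter> P k)) = emeasure (W k) ((\<Union>i. A i) \<inter> P k)"
        using A W[of k] P[of k] sets
        by (subst suminf_emeasure) (auto simp: disjoint_family_on_def intro!: arg_cong[of _ _ "emeasure (W k)"])
    qed
    finally show "(\<Sum>i. ?\<mu> (A i)) = ?\<mu> (\<Union>i. A i)" .
  qed
  have "emeasure V A = ?\<mu> A" if "A \<in> sets borel" for A
    by (rule emeasure_measure_of[OF V_def]) (use that sets ca in \<open>auto simp: positive_def\<close>)
  with sets show ?thesis by blast
qed

text \<open>
  The last conclusion expresses measurability of the pieces, for any ring of sets that contains the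
  sets of the cover.
\<close>

lemma finite_cover_disjointed:
  fixes D :: "'i \<Rightarrow> 'a set"
  assumes "finite J"
  obtains e :: "nat \<Rightarrow> 'i" and P N where "\<And>k. k < N \<Longrightarrow> P k \<subseteq> D (e k) \<and> e k \<in> J"
    "(\<Union>k<N. P k) = (\<Union>c\<in>J. D c)" "disjoint_family_on P {..<N}"
    "\<And>k R. ring_of_sets UNIV R \<Longrightarrow> (\<And>c. c \<in> J \<Longrightarrow> D c \<in> R) \<Longrightarrow> P k \<in> R"
proof -
  obtain e :: "nat \<Rightarrow> 'i" and N where e: "e ` {..<N} = J"
    using finite_imp_nat_seg_image_inj_on[OF assms] by (metis lessThan_def)
  define B where "B k = (if k < N then D (e k) else {})" for k
  have sub: "disjointed B k \<subseteq> B k" for k by (rule disjointed_subset)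
  show thesis
  proof (rule that[of N "disjointed B" e])
    show "disjointed B k \<subseteq> D (e k) \<and> e k \<in> J" if "k < N" for k
      using sub[of k] that e by (auto simp: B_def)
    have "(\<Union>k. disjointed B k) = (\<Union>k. B k)" by (rule UN_disjointed_eq)
    moreover have "(\<Union>k. B k) = (\<Union>c\<in>J. D c)"
      unfolding e[symmetric] by (auto simp: B_def split: if_splits)
    moreover have "disjointed B k = {}" if "\<not> k < N" for k using sub[of k] that by (simp add: B_def)
    then have "(\<Union>k<N. disjointed B k) = (\<Union>k. disjointed B k)"
      by auto
    ultimately show "(\<Union>k<N. disjointed B k) = (\<Union>c\<in>J. D c)" by simp
    show "disjoint_family_on (disjointed B) {..<N}"
      using disjoint_family_disjointed[of B] by (auto simp: disjoint_family_on_def)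
    show "disjointed B k \<in> R" if R: "ring_of_sets UNIV R" and D: "\<And>c. c \<in> J \<Longrightarrow> D c \<in> R" for k R
    proof -
      interpret ring_of_sets UNIV R by (rule R)
      have "B k \<in> R" for k using D e by (auto simp: B_def)
      then show ?thesis unfolding disjointed_def by (intro Diff finite_UN) auto
    qed
  qed
qed

locale closed_riemannian =
  fixes M :: "('i, 'a::{t2_space, second_countable_topology}, 'n::finite) atlas" and g :: "('i, 'n) tensor2"
  assumes closed_mfd: "closed_riemannian_manifold M g"
begin

lemma riemannian: "riemannian_manifold M g"
  and compact_points: "compact (points M)" and points_ne: "points M \<noteq> {}"
  using closed_mfd by (auto simp: closed_riemannian_manifold_def)

sublocale L: local_metric "chart_img M c" "g c" for c
  using riemannian by (rule riemannian_local_metric)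

lemma sym_tensor_field_metric: "sym_tensor_field M g"
  using riemannian by (simp add: riemannian_manifold_def)

lemma metric_smooth: "smooth_on (chart_img M c) (g c)"
  using sym_tensor_field_metric by (simp add: sym_tensor_field_def)

lemma metric_transforms:
  "x \<in> chart M c ` (chart_dom M c \<inter> chart_dom M d) \<Longrightarrow>
    g c x = transpose (jacobian (transition M c d) (at x)) ** g d (transition M c d x) ** jacobian (transition M c d) (at x)"
  using sym_tensor_field_metric unfolding sym_tensor_field_def by blast

abbreviation "inv_chart c \<equiv> inv_into (chart_dom M c) (chart M c)"

lemma dom_openin: "openin (top_of_set (points M)) (chart_dom M c)"
  and homeo: "homeomorphism (chart_dom M c) (chart_img M c) (chart M c) (inv_chart c)"
  and transition_smooth: "smooth_on (chart M c ` (chart_dom M c \<inter> chart_dom M d)) (transition M c d)"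
  using riemannian unfolding riemannian_manifold_def smooth_manifold_def by blast+

lemma dom_borel [measurable]: "chart_dom M c \<in> sets borel"
proof -
  obtain T where "open T" "chart_dom M c = T \<inter> points M"
    using dom_openin by (metis Int_commute openin_open)
  then show ?thesis using compact_imp_closed[OF compact_points] by simp
qed

lemma inv_chart_chart: "p \<in> chart_dom M c \<Longrightarrow> inv_chart c (chart M c p) = p"
  and chart_inv_chart: "x \<in> chart_img M c \<Longrightarrow> chart M c (inv_chart c x) = x"
  and inv_chart_dom: "x \<in> chart_img M c \<Longrightarrow> inv_chart c x \<in> chart_dom M c"
  and chart_in_img: "p \<in> chart_dom M c \<Longrightarrow> chart M c p \<in> chart_img M c"
  using homeo[of c] by (auto simp: homeomorphism_def)

lemma inj_on_chart: "inj_on (chart M c) (chart_dom M c)"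
  by (metis inj_on_inverseI inv_chart_chart)

lemma chart_image_eq:
  "A \<subseteq> chart_dom M c \<Longrightarrow> chart M c ` A = inv_chart c -` A \<inter> chart_img M c"
  using inv_chart_chart chart_inv_chart chart_in_img by (force simp: image_iff)

lemma inv_chart_measurable: "inv_chart c \<in> measurable (restrict_space borel (chart_img M c)) borel"
  using homeo[of c] by (intro borel_measurable_continuous_on_restrict) (simp add: homeomorphism_def)

lemma chart_image_borel:
  assumes "A \<in> sets borel" "A \<subseteq> chart_dom M c"
  shows "chart M c ` A \<in> sets borel"
  using measurable_sets[OF inv_chart_measurable assms(1), of c] borel_open[OF L.open_U[of c]]
  by (simp add: chart_image_eq[OF assms(2)] space_restrict_space sets_restrict_space_iff)

lemma det_pos: "x \<in> chart_img M c \<Longrightarrow> det (g c x) > 0"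
  using riemannian unfolding riemannian_manifold_def by (intro posdef_det_pos) blast

lemma continuous_on_density: "continuous_on (chart_img M c) (\<lambda>x. sqrt (det (g c x)))"
  by (intro continuous_on_real_sqrt continuous_at_imp_continuous_on ballI differentiable_imp_continuous_within
      differentiable_det L.diff)

lemma density_measurable:
  assumes "A \<in> sets borel" "A \<subseteq> chart_dom M c"
  shows "(\<lambda>x. indicator (chart M c ` A) x * sqrt (det (g c x))) \<in> borel_measurable borel"
proof -
  have "chart M c ` A \<subseteq> chart_img M c" using assms(2) by (auto simp: chart_img_def)
  then have "(\<lambda>x. indicator (chart M c ` A) x *\<^sub>R sqrt (det (g c x))) \<in> borel_measurable borel"
    by (intro borel_measurable_continuous_on_indicator chart_image_borel assms continuous_on_subset[OF continuous_on_density])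
  then show ?thesis by simp
qed

lemma chart_vol_eq:
  "chart_vol M g c A = (\<integral>\<^sup>+x. ennreal (indicator (chart M c ` A) x * sqrt (det (g c x))) \<partial>lborel)"
  unfolding chart_vol_def by (intro nn_integral_cong) (auto simp: indicator_def)

text \<open>
  The transformation law \<open>g\<^sub>c = J\<^sup>T g\<^sub>d J\<close> gives \<open>sqrt (det g\<^sub>c) = |det J| sqrt (det g\<^sub>d)\<close>, and \<open>|det J|\<close> is the
  factor in the change of variables formula.
\<close>

lemma chart_vol_chart_change:
  assumes A: "A \<in> sets borel" "A \<subseteq> chart_dom M c" "A \<subseteq> chart_dom M d"
  shows "chart_vol M g c A = chart_vol M g d A"
proof -
  let ?T = "transition M c d" and ?S = "chart M c ` A"
  have T: "?T (chart M c p) = chart M d p" if "p \<in> chart_dom M c" for p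
    using that by (simp add: transition_def inv_chart_chart)
  have TS: "?T ` ?S = chart M d ` A"
    using T A(2) by (force simp: image_comp)
  have diff: "(?T has_derivative frechet_derivative ?T (at x)) (at x)" if "x \<in> ?S" for x
  proof -
    have "Ck_on (Suc 0) (chart M c ` (chart_dom M c \<inter> chart_dom M d)) ?T"
      using transition_smooth unfolding smooth_on_def by blast
    from Ck_on_SucD(1)[OF this] show ?thesis using that A by blast
  qed
  have dens: "\<bar>det (matrix (frechet_derivative ?T (at x)))\<bar> * sqrt (det (g d (?T x))) = sqrt (det (g c x))"
    if "x \<in> ?S" for x
  proof -
    have "x \<in> chart M c ` (chart_dom M c \<inter> chart_dom M d)" using that A by blast
    then have "g c x = transpose (jacobian ?T (at x)) ** g d (?T x) ** jacobian ?T (at x)"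
      using riemannian unfolding riemannian_manifold_def sym_tensor_field_def by blast
    then show ?thesis
      by (simp add: det_mul jacobian_def real_sqrt_mult)
  qed
  have "(\<integral>\<^sup>+y. ennreal (indicator (?T ` ?S) y * sqrt (det (g d y))) \<partial>lborel) =
    (\<integral>\<^sup>+x. ennreal (indicator ?S x * (\<bar>det (matrix (frechet_derivative ?T (at x)))\<bar> * sqrt (det (g d (?T x))))) \<partial>lborel)"
  proof (rule nn_integral_change_of_variables)
    show "?S \<in> sets borel" "?T ` ?S \<in> sets borel"
      unfolding TS using A chart_image_borel by auto
    show "(?T has_derivative frechet_derivative ?T (at x)) (at x within ?S)" if "x \<in> ?S" for x
      using diff[OF that] by (rule has_derivative_at_withinI)
    have "inj_on (?T \<circ> chart M c) A"
      using T A inj_on_subset[OF inj_on_chart A(3)] by (auto simp: inj_on_def subset_iff)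
    then show "inj_on ?T ?S" by (rule inj_on_imageI)
    show "(\<lambda>y. indicator (?T ` ?S) y * sqrt (det (g d y))) \<in> borel_measurable borel"
      unfolding TS by (rule density_measurable[OF A(1,3)])
    have "(\<lambda>x. indicator ?S x * (\<bar>det (matrix (frechet_derivative ?T (at x)))\<bar> * sqrt (det (g d (?T x)))))
       = (\<lambda>x. indicator ?S x * sqrt (det (g c x)))"
      by (auto simp: fun_eq_iff indicator_def dens)
    then show "(\<lambda>x. indicator ?S x * (\<bar>det (matrix (frechet_derivative ?T (at x)))\<bar> * sqrt (det (g d (?T x))))) \<in> borel_measurable borel"
      using density_measurable[OF A(1,2)] by simp
    show "0 \<le> sqrt (det (g d y))" if "y \<in> ?T ` ?S" for y
      using that A(3) det_pos[of y d] chart_in_img unfolding TS by (auto intro!: less_imp_le)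
  qed
  also have "\<dots> = chart_vol M g c A"
    unfolding chart_vol_eq by (intro nn_integral_cong) (auto simp: indicator_def dens)
  finally show ?thesis unfolding TS chart_vol_eq by simp
qed

text \<open>
  The inverse chart with a constant value outside the image of the chart, which makes it Borel
  measurable on the whole coordinate space. The density below vanishes there.
\<close>

definition total_inv :: "'i \<Rightarrow> real^'n \<Rightarrow> 'a" where
  "total_inv c x = (if x \<in> chart_img M c then inv_chart c x else undefined)"

definition chart_density :: "'i \<Rightarrow> real^'n \<Rightarrow> ennreal" where
  "chart_density c x = ennreal (indicator (chart_img M c) x * sqrt (det (g c x)))"

lemma total_inv_measurable [measurable]: "total_inv c \<in> borel_measurable borel"
  unfolding total_inv_def[abs_def]
  by (rule measurable_If_restrict_space_iff[THEN iffD2])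
     (use inv_chart_measurable[of c] borel_open[OF L.open_U[of c]] in \<open>auto\<close>)

lemma chart_density_measurable [measurable]: "chart_density c \<in> borel_measurable borel"
  using density_measurable[OF dom_borel order_refl, of c]
  unfolding chart_density_def[abs_def] chart_img_def[symmetric] by simp

definition chart_measure :: "'i \<Rightarrow> 'a measure" where
  "chart_measure c = distr (density lborel (chart_density c)) borel (total_inv c)"

lemma sets_chart_measure [simp]: "sets (chart_measure c) = sets borel"
  by (simp add: chart_measure_def)

lemma emeasure_chart_measure:
  assumes A: "A \<in> sets borel"
  shows "emeasure (chart_measure c) A = chart_vol M g c (A \<inter> chart_dom M c)"
proof -
  have "emeasure (chart_measure c) A = emeasure (density lborel (chart_density c)) (total_inv c -` A)"
    unfolding chart_measure_def using A by (subst emeasure_distr) auto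
  also have "\<dots> = (\<integral>\<^sup>+x. chart_density c x * indicator (total_inv c -` A) x \<partial>lborel)"
    using measurable_sets[OF total_inv_measurable A] by (subst emeasure_density) auto
  also have "\<dots> = chart_vol M g c (A \<inter> chart_dom M c)"
    unfolding chart_vol_eq chart_image_eq[OF Int_lower2] chart_density_def
    by (intro nn_integral_cong) (auto simp: indicator_def total_inv_def inv_chart_dom)
  finally show ?thesis .
qed

text \<open>
  The density is bounded on a closed ball inside the image of a chart, whereas it may be unbounded
  on the whole image.
\<close>

lemma finite_volume_neighbourhood:
  assumes "p \<in> points M"
  shows "\<exists>c B. open B \<and> p \<in> B \<and> B \<inter> points M \<subseteq> chart_dom M c \<and> chart_vol M g c (B \<inter> points M) < \<infinity>"
proof -
  obtain c where p: "p \<in> chart_dom M c" using assms by (auto simp: points_def)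
  obtain e where e: "e > 0" "cball (chart M c p) e \<subseteq> chart_img M c"
    using L.open_U[of c] chart_in_img[OF p] open_contains_cball by metis
  let ?b = "ball (chart M c p) e"
  have "openin (top_of_set (chart_dom M c)) (chart_dom M c \<inter> chart M c -` ?b)"
    using homeo[of c] by (intro continuous_openin_preimage_gen) (auto simp: homeomorphism_def)
  then have "openin (top_of_set (points M)) (chart_dom M c \<inter> chart M c -` ?b)"
    using dom_openin openin_trans by blast
  then obtain B where B: "open B" "B \<inter> points M = chart_dom M c \<inter> chart M c -` ?b"
    by (metis Int_commute openin_open)
  have "chart M c ` (B \<inter> points M) \<subseteq> cball (chart M c p) e"
    unfolding B(2) by auto
  then have "chart_vol M g c (B \<inter> points M) \<le>
      (\<integral>\<^sup>+x. ennreal (indicator (cball (chart M c p) e) x *\<^sub>R sqrt (det (g c x))) \<partial>lborel)"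
    unfolding chart_vol_def by (intro nn_integral_mono) (auto simp: indicator_def)
  also have "\<dots> < \<infinity>"
  proof -
    have "integrable lborel (\<lambda>x. indicator (cball (chart M c p) e) x *\<^sub>R sqrt (det (g c x)))"
      by (intro borel_integrable_compact continuous_on_subset[OF continuous_on_density] e) simp
    moreover have "0 \<le> indicator (cball (chart M c p) e) x *\<^sub>R sqrt (det (g c x))" for x
      using e(2) det_pos[of x c] by (auto simp: indicator_def subset_iff intro!: less_imp_le)
    ultimately show ?thesis by (simp add: nn_integral_eq_integral)
  qed
  finally have "chart_vol M g c (B \<inter> points M) < \<infinity>" .
  moreover have "p \<in> B" using B(2) p e(1) by (auto simp: points_def)
  moreover have "B \<inter> points M \<subseteq> chart_dom M c" using B(2) by auto
  ultimately show ?thesis using B(1) by blast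
qed

text \<open>
  Finitely many neighbourhoods of finite volume cover the manifold. They are made disjoint, and
  the sum of the chart measures of the pieces is a finite measure. It has the right density in every
  chart because the charts agree on each piece.
\<close>

theorem volume_exists:
  "\<exists>V. sets V = sets borel \<and> finite_measure V \<and> emeasure V (points M) > 0 \<and>
     (\<forall>c. \<forall>A\<in>sets borel. A \<subseteq> chart_dom M c \<longrightarrow> emeasure V A = chart_vol M g c A)"
proof -
  obtain c0 B0 where cB: "\<And>p. p \<in> points M \<Longrightarrow> open (B0 p) \<and> p \<in> B0 p \<and> B0 p \<inter> points M \<subseteq> chart_dom M (c0 p)
      \<and> chart_vol M g (c0 p) (B0 p \<inter> points M) < \<infinity>"
    using finite_volume_neighbourhood by metis
  obtain D where D: "D \<subseteq> points M" "finite D" "points M \<subseteq> (\<Union>p\<in>D. B0 p)"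
    using compactE_image[OF compact_points, of "points M" B0] cB by (metis UN_I subsetI)
  have points_borel: "points M \<in> sets borel" using compact_points by (simp add: borel_closed compact_imp_closed)
  define B where "B p = B0 p \<inter> points M" for p
  have B: "B p \<in> sets borel" "B p \<subseteq> chart_dom M (c0 p)" "chart_vol M g (c0 p) (B p) < \<infinity>" if "p \<in> D" for p
  proof -
    have p: "p \<in> points M" using D(1) that by blast
    have "B0 p \<in> sets borel" using cB[OF p] by (simp add: borel_open)
    then show "B p \<in> sets borel" "B p \<subseteq> chart_dom M (c0 p)" "chart_vol M g (c0 p) (B p) < \<infinity>"
      using cB[OF p] points_borel by (auto simp: B_def)
  qed
  have BU: "(\<Union>p\<in>D. B p) = points M" using D(3) by (auto simp: B_def)
  obtain e P N where P: "\<And>k. k < (N::nat) \<Longrightarrow> P k \<subseteq> B (e k) \<and> e k \<in> D"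
      "(\<Union>k<N. P k) = points M" "disjoint_family_on P {..<N}"
      "\<And>k R. ring_of_sets UNIV R \<Longrightarrow> (\<And>p. p \<in> D \<Longrightarrow> B p \<in> R) \<Longrightarrow> P k \<in> R"
    using finite_cover_disjointed[OF D(2), of B] unfolding BU by metis
  have Pb: "P k \<in> sets borel" for k
    using sets.ring_of_sets_axioms[of borel] B(1) by (intro P(4)) auto
  have Psub: "P k \<subseteq> chart_dom M (c0 (e k))" if "k < N" for k
    using P(1)[OF that] B(2) by blast
  have W: "sets (chart_measure c) = sets borel"
      "A \<in> sets borel \<Longrightarrow> A \<subseteq> chart_dom M c \<Longrightarrow> emeasure (chart_measure c) A = chart_vol M g c A" for c A
    by (simp_all add: emeasure_chart_measure Int_absorb2)
  obtain V where V: "sets V = sets borel"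
      "\<And>A. A \<in> sets borel \<Longrightarrow> emeasure V A = (\<Sum>k<N. emeasure (chart_measure (c0 (e k))) (A \<inter> P k))"
    using sum_of_restricted_measures[of N "\<lambda>k. chart_measure (c0 (e k))" P] W(1) Pb by blast
  have vol: "emeasure V A = chart_vol M g c A" if A: "A \<in> sets borel" "A \<subseteq> chart_dom M c" for c A
  proof -
    have "emeasure (chart_measure (c0 (e k))) (A \<inter> P k) = emeasure (chart_measure c) (A \<inter> P k)" if "k < N" for k
      using A Pb[of k] Psub[OF that] chart_vol_chart_change[of "A \<inter> P k" "c0 (e k)" c]
      by (subst (1 2) W(2)) auto
    then have "emeasure V A = (\<Sum>k<N. emeasure (chart_measure c) (A \<inter> P k))"
      using V(2)[OF A(1)] by simp
    also have "\<dots> = emeasure (chart_measure c) (\<Union>k<N. A \<inter> P k)"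
    proof (rule sum_emeasure)
      show "disjoint_family_on (\<lambda>k. A \<inter> P k) {..<N}"
        using P(3) unfolding disjoint_family_on_def by blast
    qed (use A Pb W(1) in auto)
    also have "(\<Union>k<N. A \<inter> P k) = A"
    proof -
      have "A \<subseteq> points M" using A(2) by (auto simp: points_def)
      then show ?thesis using P(2) by blast
    qed
    finally show ?thesis using W(2) A by simp
  qed
  have "emeasure V UNIV < \<infinity>"
  proof -
    have "emeasure (chart_measure (c0 (e k))) (P k) < \<infinity>" if "k < N" for k
    proof -
      have "emeasure (chart_measure (c0 (e k))) (P k) \<le> emeasure (chart_measure (c0 (e k))) (B (e k))"
        using B(1) P(1)[OF that] W(1) by (intro emeasure_mono) auto
      also have "\<dots> < \<infinity>"
        using B P(1)[OF that] by (subst W(2)) auto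
      finally show ?thesis .
    qed
    then show ?thesis using V(2)[of UNIV] by simp
  qed
  then have fin: "finite_measure V"
    using V(1) by (intro finite_measureI) (auto simp: sets_eq_imp_space_eq[OF V(1)])
  obtain p where p: "p \<in> points M" using points_ne by auto
  then obtain c where c: "p \<in> chart_dom M c" by (auto simp: points_def)
  have pos: "emeasure V (points M) > 0"
  proof -
    have dom: "chart M c ` chart_dom M c = chart_img M c" by (simp add: chart_img_def)
    \<comment> \<open>A positive density on a nonempty open set.\<close>
    have "chart_vol M g c (chart_dom M c) \<noteq> 0"
    proof
      assume "chart_vol M g c (chart_dom M c) = 0"
      then have "AE x in lborel. ennreal (indicator (chart_img M c) x * sqrt (det (g c x))) = 0"
        unfolding chart_vol_eq dom using density_measurable[OF dom_borel order_refl, of c]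
        by (subst (asm) nn_integral_0_iff_AE) (auto simp: dom)
      then have "AE x in lborel. x \<notin> chart_img M c"
      proof eventually_elim
        case (elim x)
        then show ?case using det_pos[of x c] by (auto simp: indicator_def)
      qed
      then have "emeasure lborel (chart_img M c) = 0"
        using borel_open[OF L.open_U[of c]] by (subst (asm) AE_iff_measurable[of "chart_img M c"]) auto
      moreover obtain \<epsilon> where e: "\<epsilon> > 0" "ball (chart M c p) \<epsilon> \<subseteq> chart_img M c"
        using L.open_U[of c] chart_in_img[OF c] open_contains_ball by metis
      then have "emeasure lborel (ball (chart M c p) \<epsilon>) \<le> emeasure lborel (chart_img M c)"
        using borel_open[OF L.open_U[of c]] by (intro emeasure_mono) auto
      ultimately show False
        using content_ball_pos[OF e(1), of "chart M c p"] by (simp add: measure_def)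
    qed
    then have "emeasure V (chart_dom M c) > 0"
      using vol[OF dom_borel order_refl, of c] by (simp add: zero_less_iff_neq_zero)
    also have "emeasure V (chart_dom M c) \<le> emeasure V (points M)"
      using points_borel V(1) by (intro emeasure_mono) (auto simp: points_def)
    finally show ?thesis .
  qed
  show ?thesis using V(1) fin pos vol by blast
qed

end

section \<open>The volume of the cone over a product\<close>

text \<open>
  A finite cover by charts splits a measurable set into finitely many disjoint pieces in single
  charts, so the values prescribed on chart domains determine the measure.
\<close>

lemma riemannian_volume_eqI:
  assumes J: "finite J" "points M = (\<Union>c\<in>J. chart_dom M c)"
    and dom: "\<And>c. c \<in> J \<Longrightarrow> chart_dom M c \<in> sets borel"
    and \<mu>: "sets \<mu> = sets (restrict_space borel (points M))"
      "\<And>c A. A \<in> sets \<mu> \<Longrightarrow> A \<subseteq> chart_dom M c \<Longrightarrow> emeasure \<mu> A = chart_vol M g c A"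
  shows "riemannian_volume M g = \<mu>"
  unfolding riemannian_volume_def chart_vol_def[symmetric]
proof (rule the_equality)
  show "sets \<mu> = sets (restrict_space borel (points M)) \<and>
    (\<forall>c. \<forall>A\<in>sets \<mu>. A \<subseteq> chart_dom M c \<longrightarrow> emeasure \<mu> A = chart_vol M g c A)"
    using \<mu> by blast
next
  fix \<nu> assume \<nu>: "sets \<nu> = sets (restrict_space borel (points M)) \<and>
    (\<forall>c. \<forall>A\<in>sets \<nu>. A \<subseteq> chart_dom M c \<longrightarrow> emeasure \<nu> A = chart_vol M g c A)"
  obtain e P N where P: "\<And>k. k < (N::nat) \<Longrightarrow> P k \<subseteq> chart_dom M (e k) \<and> e k \<in> J"
      "(\<Union>k<N. P k) = points M" "disjoint_family_on P {..<N}"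
      "\<And>k R. ring_of_sets UNIV R \<Longrightarrow> (\<And>c. c \<in> J \<Longrightarrow> chart_dom M c \<in> R) \<Longrightarrow> P k \<in> R"
    using finite_cover_disjointed[OF J(1), of "chart_dom M"] unfolding J(2)[symmetric] by metis
  have Pb: "P k \<in> sets borel" for k
    using sets.ring_of_sets_axioms[of borel] dom by (intro P(4)) auto
  have m: "emeasure \<kappa> A = (\<Sum>k<N. chart_vol M g (e k) (A \<inter> P k))"
    if l: "sets \<kappa> = sets (restrict_space borel (points M))"
      "\<And>c A. A \<in> sets \<kappa> \<Longrightarrow> A \<subseteq> chart_dom M c \<Longrightarrow> emeasure \<kappa> A = chart_vol M g c A"
      and A: "A \<in> sets \<kappa>" for \<kappa> A
  proof -
    have "P k \<subseteq> points M" if "k < N" for k using P(1)[OF that] by (auto simp: points_def)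
    then have AP: "A \<inter> P k \<in> sets \<kappa>" if "k < N" for k
    proof -
      obtain x where x: "x \<in> sets borel" "A = points M \<inter> x"
        using A unfolding l(1) sets_restrict_space by blast
      have "A \<inter> P k = points M \<inter> (x \<inter> P k)" using x by blast
      then show ?thesis unfolding l(1) sets_restrict_space using x(1) Pb[of k] by blast
    qed
    have "A \<subseteq> points M" using sets.sets_into_space[OF A] sets_eq_imp_space_eq[OF l(1)]
      by (simp add: space_restrict_space)
    then have "A = (\<Union>k<N. A \<inter> P k)" using P(2) by blast
    then have "emeasure \<kappa> A = emeasure \<kappa> (\<Union>k<N. A \<inter> P k)" by simp
    also have "\<dots> = (\<Sum>k<N. emeasure \<kappa> (A \<inter> P k))"
    proof (rule sum_emeasure[symmetric])
      show "disjoint_family_on (\<lambda>k. A \<inter> P k) {..<N}"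
        using P(3) unfolding disjoint_family_on_def by blast
    qed (use AP in auto)
    also have "\<dots> = (\<Sum>k<N. chart_vol M g (e k) (A \<inter> P k))"
      using P(1) AP by (intro sum.cong refl l(2)) auto
    finally show ?thesis .
  qed
  show "\<nu> = \<mu>"
  proof (rule measure_eqI)
    show "sets \<nu> = sets \<mu>" using \<nu> \<mu> by simp
    show "emeasure \<nu> A = emeasure \<mu> A" if "A \<in> sets \<nu>" for A
      using m[of \<nu> A] m[of \<mu> A] \<nu> \<mu> that by simp
  qed
qed

context closed_riemannian
begin

lemma nn_integral_volume_chart:
  assumes V: "sets V = sets borel" "\<And>A. A \<in> sets borel \<Longrightarrow> A \<subseteq> chart_dom M c \<Longrightarrow> emeasure V A = chart_vol M g c A"
    and F: "F \<in> borel_measurable borel"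
  shows "(\<integral>\<^sup>+p. F p * indicator (chart_dom M c) p \<partial>V) = (\<integral>\<^sup>+x. chart_density c x * F (total_inv c x) \<partial>lborel)"
proof -
  have [measurable_cong]: "sets V = sets borel" by (rule V)
  have "density V (indicator (chart_dom M c)) = chart_measure c"
  proof (rule measure_eqI)
    show "sets (density V (indicator (chart_dom M c))) = sets (chart_measure c)"
      using V by simp
    fix A assume "A \<in> sets (density V (indicator (chart_dom M c)))"
    then have A: "A \<in> sets borel" using V by simp
    then have "A \<inter> chart_dom M c \<in> sets borel" by (intro sets.Int dom_borel)
    moreover have "emeasure (density V (indicator (chart_dom M c))) A = emeasure V (A \<inter> chart_dom M c)"
      using A V dom_borel by (subst emeasure_density) (auto simp: indicator_inter_arith[symmetric] Int_commute)
    ultimately show "emeasure (density V (indicator (chart_dom M c))) A = emeasure (chart_measure c) A"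
      using V(2) A by (simp add: emeasure_chart_measure)
  qed
  then have "(\<integral>\<^sup>+p. F p \<partial>density V (indicator (chart_dom M c))) =
     (\<integral>\<^sup>+p. F p \<partial>distr (density lborel (chart_density c)) borel (total_inv c))"
    by (simp add: chart_measure_def)
  then show ?thesis
    using F V(1) dom_borel[of c]
    by (subst (asm) nn_integral_density, simp, simp, subst (asm) nn_integral_distr, simp, simp,
        subst (asm) nn_integral_density, simp, simp, simp add: mult.commute)
qed

lemma finite_chart_cover: "\<exists>J. finite J \<and> points M = (\<Union>c\<in>J. chart_dom M c)"
proof -
  have "\<exists>T. open T \<and> chart_dom M c = T \<inter> points M" for c
    using dom_openin[of c] by (metis Int_commute openin_open)
  then obtain T where T: "\<And>c. open (T c) \<and> chart_dom M c = T c \<inter> points M"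
    by metis
  obtain J where J: "finite J" "points M \<subseteq> (\<Union>c\<in>J. T c)"
  proof (rule compactE_image[OF compact_points, of UNIV T])
    show "open (T c)" for c using T by simp
    show "points M \<subseteq> (\<Union>c\<in>UNIV. T c)"
    proof
      fix p assume "p \<in> points M"
      then obtain c where "p \<in> chart_dom M c" by (auto simp: points_def)
      then show "p \<in> (\<Union>c\<in>UNIV. T c)" using T[of c] by blast
    qed
  qed
  have "(\<Union>c\<in>J. chart_dom M c) = (\<Union>c\<in>J. T c) \<inter> points M" using T by simp
  then show ?thesis using J by (intro exI[of _ J]) (simp add: Int_absorb1)
qed

end

locale two_closed =
  A: closed_riemannian M1 \<gamma>1 + B: closed_riemannian M2 \<gamma>2
  for M1 :: "('i1, 'a1::{t2_space, second_countable_topology}, 'n1::finite) atlas"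
    and M2 :: "('i2, 'a2::{t2_space, second_countable_topology}, 'n2::finite) atlas"
    and \<gamma>1 \<gamma>2
begin

abbreviation "CM \<equiv> cone_atlas (product_atlas M1 M2)"
abbreviation "CG \<equiv> cone_metric (product_metric \<gamma>1 \<gamma>2)"

lemma cone_dom: "chart_dom CM (c, d) = {0<..} \<times> (chart_dom M1 c \<times> chart_dom M2 d)"
  by (simp add: cone_atlas_def product_atlas_def)

lemma cone_points: "points CM = {0<..} \<times> (points M1 \<times> points M2)"
  by (auto simp: points_def cone_atlas_def product_atlas_def)

lemma cone_chart: "chart CM (c, d) (r, (p, q)) = cons_coord (r, join (chart M1 c p, chart M2 d q))"
  by (simp add: cone_atlas_def product_atlas_def cons_coord_def join_def)

lemma cone_chart_image:
  assumes "A \<subseteq> chart_dom CM (c, d)"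
  shows "x \<in> chart CM (c, d) ` A \<longleftrightarrow>
    sub_coords Inl (sub_coords Some x) \<in> chart_img M1 c \<and> sub_coords Inr (sub_coords Some x) \<in> chart_img M2 d \<and>
    (x $ None, (A.total_inv c (sub_coords Inl (sub_coords Some x)), B.total_inv d (sub_coords Inr (sub_coords Some x)))) \<in> A"
    (is "?L \<longleftrightarrow> ?R")
proof
  assume ?L
  then obtain r p q where x: "x = cons_coord (r, join (chart M1 c p, chart M2 d q))" "(r, (p, q)) \<in> A"
    by (auto simp: cone_chart)
  then have "p \<in> chart_dom M1 c" "q \<in> chart_dom M2 d" using assms by (auto simp: cone_dom)
  then show ?R using x by (simp add: A.total_inv_def B.total_inv_def A.inv_chart_chart B.inv_chart_chart
        A.chart_in_img B.chart_in_img)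
next
  have eta: "cons_coord (x $ None, join (sub_coords Inl (sub_coords Some x), sub_coords Inr (sub_coords Some x))) = x"
    by (auto simp: vec_eq_iff cons_coord_def join_def split: option.split sum.split)
  assume R: ?R
  show ?L
    by (rule image_eqI[OF _ conjunct2[OF conjunct2[OF R]]])
       (use R in \<open>simp add: cone_chart A.total_inv_def B.total_inv_def A.chart_inv_chart B.chart_inv_chart eta\<close>)
qed

text \<open>
  On a link of dimension \<open>m\<close> the determinant of \<open>r\<^sup>2 \<gamma>\<close> is \<open>r\<^bsup>2 m\<^esup>\<close> times that of \<open>\<gamma>\<close>.
\<close>

lemma cone_density:
  assumes "x $ None > 0"
  shows "sqrt (det (CG (c, d) x)) = (x $ None) ^ CARD('n1 + 'n2) *
     (sqrt (det (\<gamma>1 c (sub_coords Inl (sub_coords Some x)))) * sqrt (det (\<gamma>2 d (sub_coords Inr (sub_coords Some x)))))"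
proof -
  have "((x $ None)\<^sup>2) ^ CARD('n1 + 'n2) = ((x $ None) ^ CARD('n1 + 'n2))\<^sup>2"
    by (simp add: power_mult[symmetric] mult.commute)
  then show ?thesis
    using assms unfolding cone_metric_eq product_metric_eq det_cone_block det_prod_block
    by (simp add: real_sqrt_mult)
qed

text \<open>
  The constant \<open>K\<close> is the volume of the link. The candidate for the volume of the cone is the product
  of \<open>r\<^sup>m dr\<close> with the volumes of the two factors; Tonelli's theorem, in the coordinates
  \<open>(r, x, y)\<close> of the cone, shows that it has the prescribed density in each chart.
\<close>

lemma cone_volume:
  "space (riemannian_volume CM CG) = points CM"
  "\<exists>K>0. \<forall>u. u \<in> borel_measurable borel \<longrightarrow> (\<forall>r>0. 0 \<le> u r) \<longrightarrow>
     (\<integral>p. u (fst p) \<partial>riemannian_volume CM CG) =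
     K * (\<integral>r. indicator {0<..} r * (r ^ CARD('n1 + 'n2) * u r) \<partial>lborel)"
proof -
  obtain V1 where V1: "sets V1 = sets borel" "finite_measure V1" "emeasure V1 (points M1) > 0"
    "\<And>c A. A \<in> sets borel \<Longrightarrow> A \<subseteq> chart_dom M1 c \<Longrightarrow> emeasure V1 A = chart_vol M1 \<gamma>1 c A"
    using A.volume_exists by blast
  obtain V2 where V2: "sets V2 = sets borel" "finite_measure V2" "emeasure V2 (points M2) > 0"
    "\<And>c A. A \<in> sets borel \<Longrightarrow> A \<subseteq> chart_dom M2 c \<Longrightarrow> emeasure V2 A = chart_vol M2 \<gamma>2 c A"
    using B.volume_exists by blast
  have [measurable_cong]: "sets V1 = sets borel" "sets V2 = sets borel" by (rule V1 V2)+
  interpret V1: finite_measure V1 by (rule V1)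
  interpret V2: finite_measure V2 by (rule V2)
  interpret V: finite_measure "V1 \<Otimes>\<^sub>M V2" by (rule finite_measure_pair_measure[OF V2(2) V1(2)])
  define f where "f r = indicator {0<..} r * ennreal (r ^ CARD('n1 + 'n2))" for r :: real
  have [measurable]: "f \<in> borel_measurable borel" unfolding f_def[abs_def] by measurable
  define \<rho> where "\<rho> = density lborel f"
  have [measurable_cong]: "sets \<rho> = sets borel" by (simp add: \<rho>_def)
  define \<mu> where "\<mu> = restrict_space (\<rho> \<Otimes>\<^sub>M (V1 \<Otimes>\<^sub>M V2)) (points CM)"
  have sets_prod: "sets (\<rho> \<Otimes>\<^sub>M (V1 \<Otimes>\<^sub>M V2)) = sets borel"
  proof -
    have "sets (V1 \<Otimes>\<^sub>M V2) = sets borel"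
      using sets_pair_measure_cong[OF V1(1) V2(1)] unfolding borel_prod .
    from sets_pair_measure_cong[OF \<open>sets \<rho> = sets borel\<close> this] show ?thesis unfolding borel_prod .
  qed
  have pts: "points M1 \<in> sets borel" "points M2 \<in> sets borel"
    using A.compact_points B.compact_points by (auto simp: borel_closed compact_imp_closed)
  then have points_borel: "points CM \<in> sets borel"
    unfolding cone_points by (intro borel_Times) auto
  have sets_\<mu>: "sets \<mu> = sets (restrict_space borel (points CM))"
    unfolding \<mu>_def sets_restrict_space sets_prod ..
  have vol: "riemannian_volume CM CG = \<mu>"
  proof -
    obtain J1 where J1: "finite J1" "points M1 = (\<Union>c\<in>J1. chart_dom M1 c)" using A.finite_chart_cover by blast
    obtain J2 where J2: "finite J2" "points M2 = (\<Union>c\<in>J2. chart_dom M2 c)" using B.finite_chart_cover by blast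
    show ?thesis
    proof (rule riemannian_volume_eqI[of "J1 \<times> J2"])
      show "finite (J1 \<times> J2)" using J1 J2 by simp
      show "points CM = (\<Union>c\<in>J1 \<times> J2. chart_dom CM c)"
        unfolding cone_points J1(2) J2(2) by (auto simp: cone_dom)
      show "chart_dom CM c \<in> sets borel" if "c \<in> J1 \<times> J2" for c
        by (cases c) (auto simp: cone_dom intro!: borel_Times A.dom_borel B.dom_borel)
      show "sets \<mu> = sets (restrict_space borel (points CM))" by (rule sets_\<mu>)
      fix cd A assume A: "A \<in> sets \<mu>" "A \<subseteq> chart_dom CM cd"
      obtain c d where cd: "cd = (c, d)" by (cases cd)
      have Ab: "A \<in> sets borel" and Asub: "A \<subseteq> points CM"
        using A(1) points_borel unfolding sets_\<mu> by (auto simp: sets_restrict_space_iff)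
      have A'[measurable]: "A \<in> sets (borel \<Otimes>\<^sub>M (borel \<Otimes>\<^sub>M borel))"
        using Ab unfolding borel_prod .
      \<comment> \<open>The density of the cone, restricted to the image of \<open>A\<close>, as a manifestly Borel function.\<close>
      define h where "h x = f (x $ None) * (A.chart_density c (sub_coords Inl (sub_coords Some x)) *
         (B.chart_density d (sub_coords Inr (sub_coords Some x)) *
          indicator A (x $ None, (A.total_inv c (sub_coords Inl (sub_coords Some x)),
            B.total_inv d (sub_coords Inr (sub_coords Some x))))))" for x
      have [measurable]: "h \<in> borel_measurable borel" unfolding h_def[abs_def] by measurable
      have ind: "indicator A (r, (p, q)) = (indicator A (r, (p, q)) * indicator (chart_dom M2 d) q * indicator (chart_dom M1 c) p :: ennreal)" for r p q
        using A(2) unfolding cd cone_dom by (auto simp: indicator_def)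
      have "emeasure \<mu> A = emeasure (\<rho> \<Otimes>\<^sub>M (V1 \<Otimes>\<^sub>M V2)) A"
        unfolding \<mu>_def using points_borel Asub Ab sets_prod by (intro emeasure_restrict_space) auto
      also have "\<dots> = (\<integral>\<^sup>+r. \<integral>\<^sup>+p. indicator A (r, p) \<partial>(V1 \<Otimes>\<^sub>M V2) \<partial>\<rho>)"
        using Ab sets_prod by (intro V.emeasure_pair_measure) simp
      also have "\<dots> = (\<integral>\<^sup>+r. \<integral>\<^sup>+p. \<integral>\<^sup>+q. indicator A (r, (p, q)) \<partial>V2 \<partial>V1 \<partial>\<rho>)"
        by (intro nn_integral_cong V2.nn_integral_fst[symmetric]) measurable
      also have "\<dots> = (\<integral>\<^sup>+r. \<integral>\<^sup>+p. (\<integral>\<^sup>+q. indicator A (r, (p, q)) * indicator (chart_dom M2 d) q \<partial>V2) * indicator (chart_dom M1 c) p \<partial>V1 \<partial>\<rho>)"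
        by (subst ind, subst nn_integral_multc) simp_all
      also have "\<dots> = (\<integral>\<^sup>+r. \<integral>\<^sup>+p. (\<integral>\<^sup>+y. B.chart_density d y * indicator A (r, (p, B.total_inv d y)) \<partial>lborel) * indicator (chart_dom M1 c) p \<partial>V1 \<partial>\<rho>)"
        by (subst B.nn_integral_volume_chart[OF V2(1,4)]) simp_all
      also have "\<dots> = (\<integral>\<^sup>+r. \<integral>\<^sup>+x. A.chart_density c x * (\<integral>\<^sup>+y. B.chart_density d y * indicator A (r, (A.total_inv c x, B.total_inv d y)) \<partial>lborel) \<partial>lborel \<partial>\<rho>)"
        by (subst A.nn_integral_volume_chart[OF V1(1,4)]) simp_all
      also have "\<dots> = (\<integral>\<^sup>+r. f r * (\<integral>\<^sup>+x. A.chart_density c x * (\<integral>\<^sup>+y. B.chart_density d y * indicator A (r, (A.total_inv c x, B.total_inv d y)) \<partial>lborel) \<partial>lborel) \<partial>lborel)"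
        unfolding \<rho>_def by (subst nn_integral_density) simp_all
      also have "\<dots> = (\<integral>\<^sup>+r. \<integral>\<^sup>+x. \<integral>\<^sup>+y. h (cons_coord (r, join (x, y))) \<partial>lborel \<partial>lborel \<partial>lborel)"
        unfolding h_def by (simp add: nn_integral_cmult)
      also have "\<dots> = (\<integral>\<^sup>+r. \<integral>\<^sup>+z. h (cons_coord (r, z)) \<partial>lborel \<partial>lborel)"
      proof (rule nn_integral_cong)
        fix r
        have "(\<integral>\<^sup>+z. h (cons_coord (r, z)) \<partial>lborel) = (\<integral>\<^sup>+z. h (cons_coord (r, z)) \<partial>distr (lborel \<Otimes>\<^sub>M lborel) borel join)"
          by (simp add: lborel_join)
        also have "\<dots> = (\<integral>\<^sup>+p. h (cons_coord (r, join p)) \<partial>(lborel \<Otimes>\<^sub>M lborel))"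
          by (subst nn_integral_distr) simp_all
        also have "\<dots> = (\<integral>\<^sup>+x. \<integral>\<^sup>+y. h (cons_coord (r, join (x, y))) \<partial>lborel \<partial>lborel)"
          by (subst lborel.nn_integral_fst[symmetric]) simp_all
        finally show "(\<integral>\<^sup>+x. \<integral>\<^sup>+y. h (cons_coord (r, join (x, y))) \<partial>lborel \<partial>lborel) = (\<integral>\<^sup>+z. h (cons_coord (r, z)) \<partial>lborel)" ..
      qed
      also have "\<dots> = (\<integral>\<^sup>+x. h x \<partial>lborel)"
      proof -
        have "(\<integral>\<^sup>+x. h x \<partial>lborel) = (\<integral>\<^sup>+x. h x \<partial>distr (lborel \<Otimes>\<^sub>M lborel) borel cons_coord)"
          by (simp add: lborel_cons_coord)
        also have "\<dots> = (\<integral>\<^sup>+p. h (cons_coord p) \<partial>(lborel \<Otimes>\<^sub>M lborel))"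
          by (subst nn_integral_distr) simp_all
        also have "\<dots> = (\<integral>\<^sup>+r. \<integral>\<^sup>+z. h (cons_coord (r, z)) \<partial>lborel \<partial>lborel)"
          by (subst lborel.nn_integral_fst[symmetric]) simp_all
        finally show ?thesis ..
      qed
      also have "\<dots> = chart_vol CM CG cd A"
        unfolding chart_vol_def
      proof (rule nn_integral_cong)
        fix x
        show "h x = ennreal (sqrt (det (CG cd x))) * indicator (chart CM cd ` A) x"
        proof (cases "x \<in> chart CM cd ` A")
          case True
          note im = True[unfolded cd cone_chart_image[OF A(2)[unfolded cd]]]
          then have pos: "x $ None > 0" using A(2) unfolding cd cone_dom by auto
          show ?thesis
            using True im pos unfolding h_def cd cone_density[OF pos]
            by (simp add: f_def A.chart_density_def B.chart_density_def ennreal_mult' A.det_pos B.det_pos less_imp_le)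
        next
          case False
          then show ?thesis
            using cone_chart_image[OF A(2)[unfolded cd], of x] unfolding h_def cd
            by (auto simp: A.chart_density_def B.chart_density_def indicator_def)
        qed
      qed
      finally show "emeasure \<mu> A = chart_vol CM CG cd A" .
    qed
  qed
  show "space (riemannian_volume CM CG) = points CM"
    unfolding vol \<mu>_def space_restrict_space
    by (auto simp: space_pair_measure \<rho>_def sets_eq_imp_space_eq[OF V1(1)] sets_eq_imp_space_eq[OF V2(1)])
  define K where "K = measure V1 (points M1) * measure V2 (points M2)"
  have K: "K > 0" "ennreal K = emeasure V1 (points M1) * emeasure V2 (points M2)"
    using V1(3) V2(3) by (auto simp: K_def V1.emeasure_eq_measure V2.emeasure_eq_measure ennreal_mult)
  have "(\<integral>p. u (fst p) \<partial>riemannian_volume CM CG) = K * (\<integral>r. indicator {0<..} r * (r ^ CARD('n1 + 'n2) * u r) \<partial>lborel)"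
    if u [measurable]: "u \<in> borel_measurable borel" and nn: "\<forall>r>0. 0 \<le> u r" for u :: "real \<Rightarrow> real"
  proof -
    have m: "(\<lambda>p. u (fst p)) \<in> borel_measurable (\<rho> \<Otimes>\<^sub>M (V1 \<Otimes>\<^sub>M V2))" by measurable
    have pts': "points CM \<in> sets (\<rho> \<Otimes>\<^sub>M (V1 \<Otimes>\<^sub>M V2))" unfolding sets_prod by (rule points_borel)
    have [measurable]: "points M1 \<in> sets V1" "points M2 \<in> sets V2" using pts V1(1) V2(1) by auto
    have "(\<integral>\<^sup>+p. ennreal (u (fst p)) \<partial>\<mu>) = (\<integral>\<^sup>+p. ennreal (u (fst p)) * indicator (points CM) p \<partial>(\<rho> \<Otimes>\<^sub>M (V1 \<Otimes>\<^sub>M V2)))"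
      unfolding \<mu>_def using pts' by (subst nn_integral_restrict_space) (auto simp: space_pair_measure sets_eq_imp_space_eq[OF V1(1)] sets_eq_imp_space_eq[OF V2(1)] \<rho>_def)
    also have "\<dots> = (\<integral>\<^sup>+r. \<integral>\<^sup>+p. ennreal (u r) * indicator (points CM) (r, p) \<partial>(V1 \<Otimes>\<^sub>M V2) \<partial>\<rho>)"
      using pts' by (subst V.nn_integral_fst[symmetric]) simp_all
    also have "\<dots> = (\<integral>\<^sup>+r. \<integral>\<^sup>+p. (ennreal (u r) * indicator {0<..} r) * indicator (points M1 \<times> points M2) p \<partial>(V1 \<Otimes>\<^sub>M V2) \<partial>\<rho>)"
      unfolding cone_points by (intro nn_integral_cong) (auto simp: indicator_def)
    also have "\<dots> = (\<integral>\<^sup>+r. (ennreal (u r) * indicator {0<..} r) * ennreal K \<partial>\<rho>)"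
      by (simp add: nn_integral_cmult V2.emeasure_pair_measure_Times K)
    also have "\<dots> = (\<integral>\<^sup>+r. (ennreal (u r) * indicator {0<..} r) \<partial>\<rho>) * ennreal K"
      by (rule nn_integral_multc) measurable
    also have "(\<integral>\<^sup>+r. (ennreal (u r) * indicator {0<..} r) \<partial>\<rho>) = (\<integral>\<^sup>+r. ennreal (indicator {0<..} r * (r ^ CARD('n1 + 'n2) * u r)) \<partial>lborel)"
      unfolding \<rho>_def by (subst nn_integral_density) (auto intro!: nn_integral_cong simp: f_def indicator_def ennreal_mult' nn)
    finally have "(\<integral>\<^sup>+p. ennreal (u (fst p)) \<partial>\<mu>) = (\<integral>\<^sup>+r. ennreal (indicator {0<..} r * (r ^ CARD('n1 + 'n2) * u r)) \<partial>lborel) * ennreal K" .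
    moreover have "(\<integral>p. u (fst p) \<partial>\<mu>) = enn2real (\<integral>\<^sup>+p. ennreal (u (fst p)) \<partial>\<mu>)"
    proof (rule integral_eq_nn_integral)
      show "(\<lambda>p. u (fst p)) \<in> borel_measurable \<mu>"
        unfolding \<mu>_def by (rule measurable_restrict_space1[OF m])
      show "AE p in \<mu>. 0 \<le> u (fst p)"
        using nn by (intro AE_I2) (auto simp: \<mu>_def space_restrict_space cone_points)
    qed
    moreover have "(\<integral>r. indicator {0<..} r * (r ^ CARD('n1 + 'n2) * u r) \<partial>lborel) =
      enn2real (\<integral>\<^sup>+r. ennreal (indicator {0<..} r * (r ^ CARD('n1 + 'n2) * u r)) \<partial>lborel)"
      using nn by (intro integral_eq_nn_integral) (auto simp: indicator_def)
    ultimately show ?thesis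
      using K(1) by (simp add: vol enn2real_mult mult.commute)
  qed
  with K(1) show "\<exists>K>0. \<forall>u. u \<in> borel_measurable borel \<longrightarrow> (\<forall>r>0. 0 \<le> u r) \<longrightarrow>
     (\<integral>p. u (fst p) \<partial>riemannian_volume CM CG) =
     K * (\<integral>r. indicator {0<..} r * (r ^ CARD('n1 + 'n2) * u r) \<partial>lborel)" by blast
qed

end

section \<open>The test tensor\<close>

lemma has_derivative_vecI:
  fixes f :: "'a::real_normed_vector \<Rightarrow> real^'n::finite"
  assumes "\<And>i. ((\<lambda>x. f x $ i) has_derivative (\<lambda>v. f' v $ i)) (at x)"
  shows "(f has_derivative f') (at x)"
  using assms by (subst has_derivative_componentwise_within) (auto simp: Basis_vec_def inner_axis)

context two_closed
begin

sublocale P: product_of_metrics "chart_img M1 c" "\<gamma>1 c" "chart_img M2 d" "\<gamma>2 d" for c d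
  by (intro product_of_metrics.intro A.L.local_metric_axioms B.L.local_metric_axioms)

lemma cone_chart_img: "chart_img CM (c, d) = P.CU c d"
proof -
  have "x \<in> chart CM (c, d) ` chart_dom CM (c, d) \<longleftrightarrow> x \<in> P.CU c d" for x
    unfolding cone_chart_image[OF order_refl] unfolding P.CU_def unfolding P.U_def cone_dom
    using A.inv_chart_dom[of "sub_coords Inl (sub_coords Some x)" c] B.inv_chart_dom[of "sub_coords Inr (sub_coords Some x)" d]
    by (auto simp: A.total_inv_def B.total_inv_def)
  then show ?thesis unfolding chart_img_def by blast
qed

lemma cone_geometry:
  "CG (c, d) = cone_block (prod_block (\<gamma>1 c) (\<gamma>2 d))"
  by (simp add: cone_metric_eq product_metric_eq)

text \<open>
  With \<open>f r = r\<^sup>2 \<phi> r\<close>, \<open>\<alpha> = 1 / n\<^sub>1\<close> and \<open>\<beta> = - 1 / n\<^sub>2\<close> this is the destabilising variation.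
\<close>

definition test_tensor :: "(real \<Rightarrow> real) \<Rightarrow> real \<Rightarrow> real \<Rightarrow> ('i1 \<times> 'i2, ('n1 + 'n2) option) tensor2" where
  "test_tensor f \<alpha> \<beta> = (\<lambda>(c, d). link_tensor f (prod_block (\<lambda>z. \<alpha> *\<^sub>R \<gamma>1 c z) (\<lambda>z. \<beta> *\<^sub>R \<gamma>2 d z)))"

lemma test_tensor_smooth:
  assumes f: "smooth_on {0<..} f"
  shows "smooth_on (chart_img CM (c, d)) (test_tensor f \<alpha> \<beta> (c, d))"
proof (rule smooth_on_matrixI)
  let ?W = "chart_img CM (c, d)"
  show o: "open ?W" unfolding cone_chart_img by (rule P.open_CU)
  have r: "Ck_on k ?W (\<lambda>x. f (x $ None))" for k
    by (rule Ck_on_linear_right[OF bounded_linear_vec_nth o, where S="{0<..}"])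
       (use f in \<open>auto simp: smooth_on_def cone_chart_img P.CU_def\<close>)
  have lin: "bounded_linear (\<lambda>x. sub_coords e (sub_coords e' x))" for e :: "'x::finite \<Rightarrow> 'y::finite" and e' :: "'y \<Rightarrow> 'z::finite"
    by (rule bounded_linear_compose[OF bounded_linear_sub_coords bounded_linear_sub_coords])
  have s: "Ck_on k (chart_img M1 c) (\<lambda>z. \<gamma>1 c z $ i $ j)" "Ck_on k (chart_img M2 d) (\<lambda>z. \<gamma>2 d z $ i' $ j')" for k i j i' j'
    using smooth_on_matrixD[OF A.L.open_U A.metric_smooth] smooth_on_matrixD[OF B.L.open_U B.metric_smooth]
    unfolding smooth_on_def by blast+
  have g1: "Ck_on k ?W (\<lambda>x. \<gamma>1 c (sub_coords Inl (sub_coords Some x)) $ i $ j)" for k i j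
    by (rule Ck_on_linear_right[OF lin o _ s(1)]) (auto simp: cone_chart_img P.CU_def)
  have g2: "Ck_on k ?W (\<lambda>x. \<gamma>2 d (sub_coords Inr (sub_coords Some x)) $ i $ j)" for k i j
    by (rule Ck_on_linear_right[OF lin o _ s(2)]) (auto simp: cone_chart_img P.CU_def)
  have "Ck_on k ?W (\<lambda>x. f (x $ None) * (\<alpha> * \<gamma>1 c (sub_coords Inl (sub_coords Some x)) $ i $ j))"
    "Ck_on k ?W (\<lambda>x. f (x $ None) * (\<beta> * \<gamma>2 d (sub_coords Inr (sub_coords Some x)) $ i' $ j'))" for k i j i' j'
    by (rule Ck_on_mult[OF o r Ck_on_mult[OF o Ck_on_const g1]] Ck_on_mult[OF o r Ck_on_mult[OF o Ck_on_const g2]])+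
  then show "smooth_on ?W (\<lambda>x. test_tensor f \<alpha> \<beta> (c, d) x $ i $ j)" for i j
    unfolding smooth_on_def test_tensor_def
    by (cases i; cases j; (simp add: Ck_on_const)?; rename_tac p q; case_tac p; case_tac q; simp add: Ck_on_const)
qed

lemma cone_transition:
  assumes "x \<in> chart_img CM (c, d)"
  shows "transition CM (c, d) (c', d') x = cons_coord (x $ None,
     join (transition M1 c c' (sub_coords Inl (sub_coords Some x)), transition M2 d d' (sub_coords Inr (sub_coords Some x))))"
proof -
  obtain r p q where x: "x = cons_coord (r, join (chart M1 c p, chart M2 d q))" "r > 0" "p \<in> chart_dom M1 c" "q \<in> chart_dom M2 d"
    using assms by (auto simp: chart_img_def cone_dom cone_chart)
  have "inj_on (chart CM (c, d)) (chart_dom CM (c, d))"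
  proof (rule inj_onI, clarsimp simp: cone_dom cone_chart)
    fix s p q s' p' q'
    assume *: "p \<in> chart_dom M1 c" "q \<in> chart_dom M2 d" "p' \<in> chart_dom M1 c" "q' \<in> chart_dom M2 d"
      and e: "cons_coord (s, join (chart M1 c p, chart M2 d q)) = cons_coord (s', join (chart M1 c p', chart M2 d q'))"
    have "s = s'" using arg_cong[OF e, of "\<lambda>v. v $ None"] by simp
    moreover have "chart M1 c p = chart M1 c p'" using arg_cong[OF e, of "\<lambda>v. sub_coords Inl (sub_coords Some v)"] by simp
    moreover have "chart M2 d q = chart M2 d q'" using arg_cong[OF e, of "\<lambda>v. sub_coords Inr (sub_coords Some v)"] by simp
    ultimately show "s = s' \<and> p = p' \<and> q = q'"
      using * A.inj_on_chart B.inj_on_chart by (auto dest: inj_onD)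
  qed
  then have "inv_into (chart_dom CM (c, d)) (chart CM (c, d)) x = (r, (p, q))"
    using x by (intro inv_into_f_eq) (auto simp: cone_dom cone_chart)
  then show ?thesis
    using x by (simp add: transition_def cone_chart A.inv_chart_chart B.inv_chart_chart)
qed

text \<open>
  A change of charts of the cone fixes the radius and acts on the two factors separately. Only
  the rows with index \<open>Some\<close> are computed, as in the transformation law the row \<open>None\<close> is multiplied
  by the radial components of the tensor, which vanish.
\<close>

lemma cone_jacobian:
  assumes x: "x \<in> chart CM (c, d) ` (chart_dom CM (c, d) \<inter> chart_dom CM (c', d'))"
  defines "x1 \<equiv> sub_coords Inl (sub_coords Some x)" and "x2 \<equiv> sub_coords Inr (sub_coords Some x)"
  defines "J \<equiv> jacobian (transition CM (c, d) (c', d')) (at x)"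
  shows "J $ Some (Inl a) $ Some (Inl b) = jacobian (transition M1 c c') (at x1) $ a $ b"
    "J $ Some (Inr a') $ Some (Inr b') = jacobian (transition M2 d d') (at x2) $ a' $ b'"
    "J $ Some (Inl a) $ Some (Inr b') = 0" "J $ Some (Inr a') $ Some (Inl b) = 0"
    "J $ Some m $ None = 0"
    "x1 \<in> chart M1 c ` (chart_dom M1 c \<inter> chart_dom M1 c')"
    "x2 \<in> chart M2 d ` (chart_dom M2 d \<inter> chart_dom M2 d')"
proof -
  obtain r p q where "x = cons_coord (r, join (chart M1 c p, chart M2 d q))" "r > 0"
     "p \<in> chart_dom M1 c" "q \<in> chart_dom M2 d" "p \<in> chart_dom M1 c'" "q \<in> chart_dom M2 d'"
    using x by (auto simp: cone_dom cone_chart)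
  then show i: "x1 \<in> chart M1 c ` (chart_dom M1 c \<inter> chart_dom M1 c')"
    "x2 \<in> chart M2 d ` (chart_dom M2 d \<inter> chart_dom M2 d')"
    unfolding x1_def x2_def by auto
  let ?T1 = "transition M1 c c'" and ?T2 = "transition M2 d d'"
  let ?D1 = "frechet_derivative ?T1 (at x1)" and ?D2 = "frechet_derivative ?T2 (at x2)"
  let ?T = "\<lambda>y. cons_coord (y $ None, join (?T1 (sub_coords Inl (sub_coords Some y)), ?T2 (sub_coords Inr (sub_coords Some y))))"
  let ?D = "\<lambda>v. cons_coord (v $ None, join (?D1 (sub_coords Inl (sub_coords Some v)), ?D2 (sub_coords Inr (sub_coords Some v))))"
  have d: "?T1 differentiable (at x1)" "?T2 differentiable (at x2)"
    using A.transition_smooth[of c c'] B.transition_smooth[of d d'] i unfolding smooth_on_def by (metis Ck_on.simps(2))+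
  have sc: "(sub_coords e has_derivative sub_coords e) F" for e :: "'x::finite \<Rightarrow> 'y::finite" and F
    by (rule bounded_linear_imp_has_derivative[OF bounded_linear_sub_coords])
  have "(?T has_derivative ?D) (at x)"
  proof (rule has_derivative_vecI)
    fix i
    have n: "((\<lambda>y. y $ j) has_derivative (\<lambda>v. v $ j)) F" for j :: "'z::finite" and F :: "(real^'z) filter"
      by (intro bounded_linear_imp_has_derivative bounded_linear_vec_nth)
    have 1: "((\<lambda>y. ?T1 (sub_coords Inl (sub_coords Some y)) $ a) has_derivative (\<lambda>v. ?D1 (sub_coords Inl (sub_coords Some v)) $ a)) (at x)" for a
      using has_derivative_compose[OF has_derivative_compose[OF has_derivative_compose[OF sc sc] frechet_derivative_works[THEN iffD1, OF d(1)[unfolded x1_def]]] n]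
      unfolding x1_def .
    have 2: "((\<lambda>y. ?T2 (sub_coords Inr (sub_coords Some y)) $ a) has_derivative (\<lambda>v. ?D2 (sub_coords Inr (sub_coords Some v)) $ a)) (at x)" for a
      using has_derivative_compose[OF has_derivative_compose[OF has_derivative_compose[OF sc sc] frechet_derivative_works[THEN iffD1, OF d(2)[unfolded x2_def]]] n]
      unfolding x2_def .
    show "((\<lambda>y. ?T y $ i) has_derivative (\<lambda>v. ?D v $ i)) (at x)"
    proof (cases i)
      case None
      then show ?thesis by (simp add: n)
    next
      case (Some m)
      then show ?thesis by (cases m) (simp_all add: 1 2)
    qed
  qed
  moreover have "x \<in> chart_img CM (c, d)" using x by (auto simp: chart_img_def)
  ultimately have "(transition CM (c, d) (c', d') has_derivative ?D) (at x)"
    by (rule has_derivative_transform_within_open[OF _ P.open_CU[of c d, folded cone_chart_img]])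
       (simp add: cone_transition)
  from frechet_derivative_at[OF this] have J: "J = matrix ?D" by (simp add: J_def jacobian_def)
  have l: "linear ?D1" "linear ?D2" using d by (auto intro: linear_frechet_derivative)
  have ax: "sub_coords Some (axis (Some k) 1) = axis k 1" "sub_coords Some (axis None 1) = 0"
    "sub_coords Inl (axis (Inl b) 1) = axis b 1" "sub_coords Inl (axis (Inr b') 1) = 0"
    "sub_coords Inr (axis (Inr b') 1) = axis b' 1" "sub_coords Inr (axis (Inl b) 1) = 0"
    for k :: "'n1 + 'n2" and b :: 'n1 and b' :: 'n2
    by (auto simp: vec_eq_iff axis_def)
  have z: "sub_coords e 0 = 0" for e :: "'x::finite \<Rightarrow> 'y::finite" by (simp add: vec_eq_iff)
  show "J $ Some (Inl a) $ Some (Inl b) = jacobian ?T1 (at x1) $ a $ b"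
    "J $ Some (Inr a') $ Some (Inr b') = jacobian ?T2 (at x2) $ a' $ b'"
    "J $ Some (Inl a) $ Some (Inr b') = 0" "J $ Some (Inr a') $ Some (Inl b) = 0"
    unfolding J by (simp_all add: matrix_def ax jacobian_def linear_0[OF l(1)] linear_0[OF l(2)])
  show "J $ Some m $ None = 0"
    unfolding J by (cases m) (simp_all add: matrix_def ax z linear_0[OF l(1)] linear_0[OF l(2)])
qed

lemma test_tensor_transforms:
  assumes x: "x \<in> chart CM (c, d) ` (chart_dom CM (c, d) \<inter> chart_dom CM (c', d'))"
  defines "T \<equiv> transition CM (c, d) (c', d')"
  shows "test_tensor f \<alpha> \<beta> (c, d) x =
    transpose (jacobian T (at x)) ** test_tensor f \<alpha> \<beta> (c', d') (T x) ** jacobian T (at x)"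
proof -
  let ?x1 = "sub_coords Inl (sub_coords Some x)" and ?x2 = "sub_coords Inr (sub_coords Some x)"
  let ?J = "jacobian T (at x)" and ?J1 = "jacobian (transition M1 c c') (at ?x1)" and ?J2 = "jacobian (transition M2 d d') (at ?x2)"
  let ?T1 = "transition M1 c c' ?x1" and ?T2 = "transition M2 d d' ?x2"
  note j = cone_jacobian[OF x, folded T_def]
  have Tx: "T x = cons_coord (x $ None, join (?T1, ?T2))"
    unfolding T_def using x by (intro cone_transition) (auto simp: chart_img_def)
  have "\<gamma>1 c ?x1 = transpose ?J1 ** \<gamma>1 c' ?T1 ** ?J1" "\<gamma>2 d ?x2 = transpose ?J2 ** \<gamma>2 d' ?T2 ** ?J2"
    by (rule A.metric_transforms[OF j(6)] B.metric_transforms[OF j(7)])+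
  from arg_cong[OF this(1), of "\<lambda>B. B $ a $ b" for a b] arg_cong[OF this(2), of "\<lambda>B. B $ a $ b" for a b]
  have g: "\<gamma>1 c ?x1 $ a $ b = (\<Sum>k\<in>UNIV. (\<Sum>l\<in>UNIV. ?J1 $ l $ a * \<gamma>1 c' ?T1 $ l $ k) * ?J1 $ k $ b)"
    "\<gamma>2 d ?x2 $ a' $ b' = (\<Sum>k\<in>UNIV. (\<Sum>l\<in>UNIV. ?J2 $ l $ a' * \<gamma>2 d' ?T2 $ l $ k) * ?J2 $ k $ b')" for a b a' b'
    by (simp_all add: matrix_matrix_mult_def transpose_def)
  have "test_tensor f \<alpha> \<beta> (c, d) x $ i $ k = (transpose ?J ** test_tensor f \<alpha> \<beta> (c', d') (T x) ** ?J) $ i $ k" for i k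
  proof -
    have e: "(\<Sum>k\<in>UNIV. (\<Sum>l\<in>UNIV. X l * (s * (t * Y l k))) * Z k) = s * (t * (\<Sum>k\<in>UNIV. (\<Sum>l\<in>UNIV. X l * Y l k) * Z k))"
      for X Z :: "'z::finite \<Rightarrow> real" and Y s t
      by (simp add: sum_distrib_left sum_distrib_right mult_ac)
    show ?thesis
      unfolding test_tensor_def matrix_matrix_mult_def transpose_def
      by (cases i; cases k; (simp add: sum_UNIV_option sum_UNIV_Plus j Tx)?; rename_tac p q; case_tac p; case_tac q;
         simp add: sum_UNIV_option sum_UNIV_Plus j Tx g e)
  qed
  then show ?thesis by (simp add: vec_eq_iff)
qed

lemma test_tensor_admissible:
  assumes f: "smooth_on {0<..} f" and supp: "\<And>r. r > 0 \<Longrightarrow> r \<notin> {a..b} \<Longrightarrow> f r = 0" and a: "a > 0"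
  shows "sym_tensor_field CM (test_tensor f \<alpha> \<beta>)" "compact_support CM (test_tensor f \<alpha> \<beta>)"
proof -
  show "sym_tensor_field CM (test_tensor f \<alpha> \<beta>)"
    unfolding sym_tensor_field_def
  proof (intro conjI allI ballI)
    fix cd :: "'i1 \<times> 'i2"
    obtain c d where cd: "cd = (c, d)" by (cases cd)
    show "smooth_on (chart_img CM cd) (test_tensor f \<alpha> \<beta> cd)"
      unfolding cd by (rule test_tensor_smooth[OF f])
    fix x assume x: "x \<in> chart_img CM cd"
    have "test_tensor f \<alpha> \<beta> cd x $ i $ j = test_tensor f \<alpha> \<beta> cd x $ j $ i" for i j
    proof -
      have "x \<in> P.CU c d" using x unfolding cd cone_chart_img .
      from P.A_sym[OF P.CU_D(1)[OF this], of \<alpha> \<beta>] show ?thesis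
        unfolding cd test_tensor_def by (cases i; cases j) simp_all
    qed
    then show "transpose (test_tensor f \<alpha> \<beta> cd x) = test_tensor f \<alpha> \<beta> cd x"
      by (simp add: transpose_def vec_eq_iff)
  next
    fix cd cd' :: "'i1 \<times> 'i2" and x assume "x \<in> chart CM cd ` (chart_dom CM cd \<inter> chart_dom CM cd')"
    then show "test_tensor f \<alpha> \<beta> cd x = transpose (jacobian (transition CM cd cd') (at x)) **
        test_tensor f \<alpha> \<beta> cd' (transition CM cd cd' x) ** jacobian (transition CM cd cd') (at x)"
      by (cases cd; cases cd') (simp only: test_tensor_transforms)
  qed
  show "compact_support CM (test_tensor f \<alpha> \<beta>)"
    unfolding compact_support_def
  proof (intro exI[of _ "{a..b} \<times> (points M1 \<times> points M2)"] conjI allI ballI)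
    show "compact ({a..b} \<times> (points M1 \<times> points M2))"
      by (intro compact_Times A.compact_points B.compact_points) simp
    show "{a..b} \<times> (points M1 \<times> points M2) \<subseteq> points CM"
      unfolding cone_points using a by auto
    fix cd rp assume rp: "rp \<in> chart_dom CM cd - {a..b} \<times> (points M1 \<times> points M2)"
    obtain c d where cd: "cd = (c, d)" by (cases cd)
    obtain r p q where rpq: "rp = (r, (p, q))" by (cases rp)
    have "f r = 0" using rp supp unfolding cd rpq cone_dom by (auto simp: points_def)
    then show "test_tensor f \<alpha> \<beta> cd (chart CM cd rp) = 0"
      unfolding cd rpq cone_chart test_tensor_def by (simp add: vec_eq_iff link_tensor_def split: option.split)
  qed
qed

end

section \<open>Instability\<close>

lemma continuous_bump_integrable:
  fixes G :: "real \<Rightarrow> real"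
  assumes "continuous_on UNIV G" "\<And>t. t \<notin> {-1..1} \<Longrightarrow> G t = 0"
  shows "integrable lborel G"
proof -
  have "integrable lborel (\<lambda>t. indicator {-1..1} t *\<^sub>R G t)"
    using assms by (intro borel_integrable_compact continuous_on_subset[OF assms(1)]) auto
  also have "(\<lambda>t. indicator {-1..1} t *\<^sub>R G t) = G"
    using assms(2) by (auto simp: fun_eq_iff indicator_def)
  finally show ?thesis .
qed

text \<open>
  The substitution \<open>t = \<epsilon> ln r\<close> maps the half-line onto the line and turns \<open>dr / r\<close> into \<open>dt / \<epsilon>\<close>.
\<close>

lemma integral_log_substitution:
  fixes G :: "real \<Rightarrow> real"
  assumes G: "continuous_on UNIV G" "\<And>t. t \<notin> {-1..1} \<Longrightarrow> G t = 0" and \<epsilon>: "\<epsilon> > 0"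
  shows "(\<integral>r. indicator {0<..} r * (G (\<epsilon> * ln r) / r) \<partial>lborel) = (\<integral>t. G t \<partial>lborel) / \<epsilon>"
proof -
  let ?S = "{0<..} :: real set" and ?g = "\<lambda>r. \<epsilon> * ln r" and ?g' = "\<lambda>r. \<epsilon> / r"
  have [measurable]: "G \<in> borel_measurable borel" using G(1) by (rule borel_measurable_continuous_onI)
  have surj: "?g ` ?S = UNIV"
  proof -
    have "t = ?g (exp (t / \<epsilon>))" for t using \<epsilon> by simp
    then show ?thesis by (metis UNIV_eq_I exp_gt_zero greaterThan_iff image_eqI)
  qed
  have "integrable lborel G" using G by (rule continuous_bump_integrable)
  then have "integrable (completion lborel) G" by (simp add: integrable_completion)
  then have GI: "G absolutely_integrable_on UNIV" by (simp add: set_integrable_def)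
  have GL: "integral UNIV G = (\<integral>t. G t \<partial>lborel)"
    using set_lebesgue_integral_eq_integral(2)[OF GI] by (simp add: set_lebesgue_integral_def integral_completion)
  have "(\<lambda>r. \<bar>?g' r\<bar> * G (?g r)) absolutely_integrable_on ?S \<and> integral ?S (\<lambda>r. \<bar>?g' r\<bar> * G (?g r)) = integral UNIV G"
  proof (rule has_absolute_integral_change_of_variables_1'[where S="?S" and g="?g" and g'="?g'" and f=G, THEN iffD2])
    show "(?g has_field_derivative ?g' r) (at r within ?S)" if "r \<in> ?S" for r
      using that by (auto intro!: derivative_eq_intros)
    show "inj_on ?g ?S" using \<epsilon> by (auto intro!: inj_onI)
  qed (use GI surj in auto)
  then have "integral UNIV G = (\<integral>r. indicator ?S r *\<^sub>R (\<bar>?g' r\<bar> * G (?g r)) \<partial>completion lborel)"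
    using set_lebesgue_integral_eq_integral(2)[of ?S "\<lambda>r. \<bar>?g' r\<bar> * G (?g r)"] by (simp add: set_lebesgue_integral_def)
  also have "\<dots> = (\<integral>r. indicator ?S r *\<^sub>R (\<bar>?g' r\<bar> * G (?g r)) \<partial>lborel)"
    by (rule integral_completion) measurable
  also have "\<dots> = (\<integral>r. \<epsilon> * (indicator ?S r * (G (?g r) / r)) \<partial>lborel)"
    using \<epsilon> by (intro Bochner_Integration.integral_cong) (auto simp: indicator_def)
  also have "\<dots> = \<epsilon> * (\<integral>r. indicator ?S r * (G (?g r) / r) \<partial>lborel)"
    by (rule integral_mult_right_zero)
  finally show ?thesis using \<epsilon> GL by (simp add: field_simps)
qed

text \<open>
  This is the failure of the Hardy inequality with a constant above the optimal one, after the
  logarithmic substitution. The left-hand side tends to \<open>a\<^sup>2 \<integral> F\<^sup>2\<close> as \<open>\<epsilon>\<close> tends to zero, because every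
  term with \<open>F'\<close> carries a factor \<open>\<epsilon>\<close>.
\<close>

lemma hardy_inequality_fails:
  fixes F F' :: "real \<Rightarrow> real" and a :: real
  assumes F': "\<And>t. (F has_real_derivative F' t) (at t)" and contF': "continuous_on UNIV F'"
    and supp: "\<And>t. t \<notin> {-1..1} \<Longrightarrow> F t = 0 \<and> F' t = 0" and F0: "F 0 \<noteq> 0"
    and b: "a\<^sup>2 < b"
  shows "\<exists>\<epsilon>>0. (\<integral>t. (\<epsilon> * F' t - a * F t)\<^sup>2 \<partial>lborel) < b * (\<integral>t. (F t)\<^sup>2 \<partial>lborel)"
proof -
  have contF: "continuous_on UNIV F" using F' by (auto intro!: continuous_at_imp_continuous_on DERIV_isCont)
  have I: "integrable lborel (\<lambda>t. (F' t)\<^sup>2)" "integrable lborel (\<lambda>t. F' t * F t)" "integrable lborel (\<lambda>t. (F t)\<^sup>2)"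
    using supp by (auto intro!: continuous_bump_integrable continuous_intros contF contF')
  let ?A = "\<integral>t. (F' t)\<^sup>2 \<partial>lborel" and ?B = "\<integral>t. F' t * F t \<partial>lborel" and ?C = "\<integral>t. (F t)\<^sup>2 \<partial>lborel"
  have e: "(\<integral>t. (\<epsilon> * F' t - a * F t)\<^sup>2 \<partial>lborel) = \<epsilon>\<^sup>2 * ?A - 2 * a * \<epsilon> * ?B + a\<^sup>2 * ?C" for \<epsilon>
  proof -
    have "(\<integral>t. (\<epsilon> * F' t - a * F t)\<^sup>2 \<partial>lborel) = (\<integral>t. \<epsilon>\<^sup>2 * (F' t)\<^sup>2 - (2 * a * \<epsilon>) * (F' t * F t) + a\<^sup>2 * (F t)\<^sup>2 \<partial>lborel)"
      by (intro Bochner_Integration.integral_cong) (auto simp: power2_eq_square algebra_simps)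
    then show ?thesis using I by simp
  qed
  have "?C > 0"
  proof (rule ccontr)
    assume "\<not> ?C > 0"
    then have "?C = 0" using Bochner_Integration.integral_nonneg[of lborel "\<lambda>t. (F t)\<^sup>2"] by fastforce
    then have ae: "AE t in lborel. (F t)\<^sup>2 = 0" using integral_nonneg_eq_0_iff_AE[OF I(3)] by simp
    have "{t \<in> space lborel. \<not> (F t)\<^sup>2 = 0} = - (F -` {0})" by auto
    moreover have "open (- (F -` {0}))"
      using contF by (intro open_Compl closed_vimage) auto
    ultimately have "emeasure lborel (- (F -` {0})) = 0"
      using ae by (subst (asm) AE_iff_measurable[of "- (F -` {0})"]) (auto simp: borel_open)
    moreover obtain e where "e > 0" "ball 0 e \<subseteq> - (F -` {0})"
      using \<open>open (- (F -` {0}))\<close> F0 open_contains_ball by (metis ComplI singletonD vimage_eq)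
    ultimately have "emeasure lborel (ball (0::real) e) = 0"
      using emeasure_mono[of "ball 0 e" "- (F -` {0})" lborel] \<open>open (- (F -` {0}))\<close> by (auto simp: borel_open)
    then show False using content_ball_pos[OF \<open>e > 0\<close>, of "0::real"] by (simp add: measure_def)
  qed
  with b have "a\<^sup>2 * ?C < b * ?C" by simp
  moreover have "((\<lambda>\<epsilon>. \<epsilon>\<^sup>2 * ?A - 2 * a * \<epsilon> * ?B + a\<^sup>2 * ?C) \<longlongrightarrow> 0\<^sup>2 * ?A - 2 * a * 0 * ?B + a\<^sup>2 * ?C) (at_right 0)"
    by (intro tendsto_intros)
  ultimately have "\<forall>\<^sub>F \<epsilon> in at_right 0. \<epsilon>\<^sup>2 * ?A - 2 * a * \<epsilon> * ?B + a\<^sup>2 * ?C < b * ?C"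
    by (intro order_tendstoD(2)) auto
  moreover have "\<forall>\<^sub>F \<epsilon> in at_right (0::real). \<epsilon> > 0" by (simp add: eventually_at_right_less)
  ultimately have "\<forall>\<^sub>F \<epsilon> in at_right (0::real). \<epsilon> > 0 \<and> \<epsilon>\<^sup>2 * ?A - 2 * a * \<epsilon> * ?B + a\<^sup>2 * ?C < b * ?C"
    by eventually_elim simp
  then obtain \<epsilon> where "\<epsilon> > 0" "\<epsilon>\<^sup>2 * ?A - 2 * a * \<epsilon> * ?B + a\<^sup>2 * ?C < b * ?C"
    using eventually_happens'[OF trivial_limit_at_right_real] by blast
  then show ?thesis using e by auto
qed

context two_closed
begin

definition \<nu> :: real where "\<nu> = 1 / real CARD('n1) + 1 / real CARD('n2)"

lemma \<nu>_pos: "\<nu> > 0" by (simp add: \<nu>_def add_pos_pos)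

abbreviation "h f \<equiv> test_tensor f (1 / real CARD('n1)) (- 1 / real CARD('n2))"

context
  fixes \<Lambda> :: real
  assumes E1: "einstein M1 \<gamma>1 \<Lambda>" and E2: "einstein M2 \<gamma>2 \<Lambda>" and \<Lambda>: "\<Lambda> = real CARD('n1 + 'n2) - 1"
begin

lemma link_einstein:
  assumes "x \<in> P.U c d"
  shows "ricci (\<gamma>1 c) (sub_coords Inl x) = \<Lambda> *\<^sub>R \<gamma>1 c (sub_coords Inl x)"
    "ricci (\<gamma>2 d) (sub_coords Inr x) = \<Lambda> *\<^sub>R \<gamma>2 d (sub_coords Inr x)"
  using E1 E2 P.U_D[OF assms] by (auto simp: einstein_def)

lemma cone_ricci_flat: "ricci_flat CM CG"
  unfolding ricci_flat_def
proof (intro allI ballI)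
  fix cd x assume x: "x \<in> chart_img CM cd"
  obtain c d where cd: "cd = (c, d)" by (cases cd)
  have x': "x \<in> P.CU c d" using x unfolding cd cone_chart_img .
  show "ricci (CG cd) x = 0"
    unfolding cd cone_geometry
    using P.ricci_cone[OF x'] P.ricci_product[OF P.CU_D(1)[OF x'] link_einstein[OF P.CU_D(1)[OF x']]] \<Lambda> by simp
qed

lemma test_tensor_geometry:
  assumes \<phi>: "\<And>r. r > 0 \<Longrightarrow> (\<phi> has_real_derivative \<phi>' r) (at r)" and x: "x \<in> chart_img CM (c, d)"
  shows "divergence (CG (c, d)) (h (\<lambda>r. r\<^sup>2 * \<phi> r) (c, d)) j x = 0"
    "norm_cov_deriv_sq (CG (c, d)) (h (\<lambda>r. r\<^sup>2 * \<phi> r) (c, d)) x =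
      \<nu> * ((\<phi>' (x $ None))\<^sup>2 + 2 * (\<phi> (x $ None))\<^sup>2 / (x $ None)\<^sup>2)"
    "Rm (CG (c, d)) (h (\<lambda>r. r\<^sup>2 * \<phi> r) (c, d)) x = \<nu> * CARD('n1 + 'n2) * (\<phi> (x $ None))\<^sup>2 / (x $ None)\<^sup>2"
proof -
  let ?\<alpha> = "1 / real CARD('n1)" and ?\<beta> = "- 1 / real CARD('n2)"
  have x': "x \<in> P.CU c d" using x unfolding cone_chart_img .
  note xU = P.CU_D(1)[OF x']
  have tr: "(\<Sum>i\<in>UNIV. \<Sum>j\<in>UNIV. ginv (P.G c d) z i j * P.A c d ?\<alpha> ?\<beta> z $ i $ j) = 0" if "z \<in> P.U c d" for z
    using P.trace_A[OF that, of ?\<alpha> ?\<beta>] by simp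
  have nA: "(\<Sum>i\<in>UNIV. \<Sum>j\<in>UNIV. raise (P.G c d) (P.A c d ?\<alpha> ?\<beta>) i j (sub_coords Some x) * P.A c d ?\<alpha> ?\<beta> (sub_coords Some x) $ i $ j) = \<nu>"
    using P.norm_A[OF xU, of ?\<alpha> ?\<beta>] by (simp add: \<nu>_def power2_eq_square)
  have RA: "Rm (P.G c d) (P.A c d ?\<alpha> ?\<beta>) (sub_coords Some x) = \<Lambda> * \<nu>"
    using P.Rm_A[OF xU link_einstein[OF xU], of ?\<alpha> ?\<beta>] by (simp add: \<nu>_def power2_eq_square)
  note L = P.A_sym[of _ c d] P.A_differentiable[of _ c d] P.cov_deriv_A[of _ c d] tr \<phi> x'
  have alg: "p / q * ((m - 1) * v + v) = v * m * p / q" for p q m v :: real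
    by (cases "q = 0") (simp_all add: field_simps)
  have e: "h f (c, d) = link_tensor f (P.A c d ?\<alpha> ?\<beta>)" for f
    by (simp only: test_tensor_def prod.case)
  show "divergence (CG (c, d)) (h (\<lambda>r. r\<^sup>2 * \<phi> r) (c, d)) j x = 0"
    unfolding cone_geometry e by (rule P.divergence_H[OF L])
  show "norm_cov_deriv_sq (CG (c, d)) (h (\<lambda>r. r\<^sup>2 * \<phi> r) (c, d)) x =
      \<nu> * ((\<phi>' (x $ None))\<^sup>2 + 2 * (\<phi> (x $ None))\<^sup>2 / (x $ None)\<^sup>2)"
    unfolding cone_geometry e by (rule trans[OF P.norm_cov_deriv_H[OF L]]) (simp_all only: nA, rule mult.commute)
  show "Rm (CG (c, d)) (h (\<lambda>r. r\<^sup>2 * \<phi> r) (c, d)) x = \<nu> * CARD('n1 + 'n2) * (\<phi> (x $ None))\<^sup>2 / (x $ None)\<^sup>2"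
    unfolding cone_geometry e
    by (rule trans[OF P.Rm_H[OF L]]) (simp_all only: nA RA \<Lambda> alg)
qed

text \<open>
  The coordinate with index \<open>None\<close> is the radius in every chart, so the choice of the chart in
  \<open>scalar_at\<close> does not matter for radial functions.
\<close>

lemma scalar_at_radial:
  assumes "\<And>c d x. x \<in> chart_img CM (c, d) \<Longrightarrow> s (c, d) x = u (x $ None)" and p: "p \<in> points CM"
  shows "scalar_at CM s p = u (fst p)"
proof -
  define cd where "cd = (SOME c. p \<in> chart_dom CM c)"
  have "p \<in> chart_dom CM cd"
    unfolding cd_def using p by (intro someI_ex[of "\<lambda>c. p \<in> chart_dom CM c"]) (auto simp: points_def)
  moreover have "scalar_at CM s p = s cd (chart CM cd p)" by (simp add: scalar_at_def cd_def Let_def)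
  moreover obtain c d r q q' where e: "cd = (c, d)" "p = (r, (q, q'))" by (metis prod.exhaust)
  moreover have "chart CM cd p $ None = fst p" by (simp add: e cone_chart)
  ultimately show ?thesis
    using assms(1)[of "chart CM cd p" c d] by (simp add: chart_img_def)
qed

text \<open>
  Here \<open>CARD('n1 + 'n2)\<close> is \<open>n - 1\<close>, so the hypothesis says \<open>n < 10\<close>.
\<close>

lemma cone_unstable:
  assumes small: "CARD('n1 + 'n2) < 9"
  shows "unstable CM CG"
proof -
  let ?m = "CARD('n1 + 'n2)"
  \<comment> \<open>With \<open>\<phi> = r\<^bsup>-a\<^esup> F\<close>, this exponent makes \<open>r\<^sup>m (\<phi> / r)\<^sup>2\<close> equal to \<open>F\<^sup>2 / r\<close>, which is invariant under scaling.\<close>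
  define a where "a = (real ?m - 1) / 2"
  have m2: "?m \<ge> 2"
  proof -
    have "?m = CARD('n1) + CARD('n2)" by simp
    with zero_less_card_finite[where 'a='n1] zero_less_card_finite[where 'a='n2] show ?thesis by linarith
  qed
  \<comment> \<open>\<open>a = (n - 2) / 2\<close> lies strictly between 0 and 4; this is where \<open>n < 10\<close> is used.\<close>
  have "0 < a * (4 - a)" using m2 small by (intro mult_pos_pos) (auto simp: a_def)
  then have gap: "a\<^sup>2 < 2 * real ?m - 2" by (simp add: a_def power2_eq_square field_simps)
  obtain F F' :: "real \<Rightarrow> real" where F: "smooth_on UNIV F" "\<And>t. (F has_real_derivative F' t) (at t)"
      "continuous_on UNIV F'" "\<And>t. t \<notin> {-1..1} \<Longrightarrow> F t = 0 \<and> F' t = 0" "F 0 \<noteq> 0"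
    using smooth_bump_exists by blast
  obtain \<epsilon> where \<epsilon>: "\<epsilon> > 0" and less: "(\<integral>t. (\<epsilon> * F' t - a * F t)\<^sup>2 \<partial>lborel) < (2 * real ?m - 2) * (\<integral>t. (F t)\<^sup>2 \<partial>lborel)"
    using hardy_inequality_fails[OF F(2,3,4,5) gap] by blast
  define \<phi> where "\<phi> r = exp (- a * ln r) * F (\<epsilon> * ln r)" for r
  define \<phi>' where "\<phi>' r = exp (- a * ln r) * (\<epsilon> * F' (\<epsilon> * ln r) - a * F (\<epsilon> * ln r)) / r" for r
  have \<phi>_deriv: "(\<phi> has_real_derivative \<phi>' r) (at r)" if "r > 0" for r
    unfolding \<phi>_def[abs_def] \<phi>'_def using that
    by (auto intro!: derivative_eq_intros DERIV_chain2[OF F(2)] simp: field_simps)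
  have contF: "continuous_on UNIV F" using F(2) by (auto intro!: continuous_at_imp_continuous_on DERIV_isCont)
  have [measurable]: "F \<in> borel_measurable borel" "F' \<in> borel_measurable borel"
    using contF F(3) by (auto intro: borel_measurable_continuous_onI)
  have [measurable]: "\<phi> \<in> borel_measurable borel" "\<phi>' \<in> borel_measurable borel"
    unfolding \<phi>_def[abs_def] \<phi>'_def[abs_def] by measurable
  let ?f = "\<lambda>r. r\<^sup>2 * \<phi> r"
  have "smooth_on {0<..} ?f"
    unfolding smooth_on_def
  proof
    fix k
    have ln: "Ck_on k {0<..} (ln :: real \<Rightarrow> real)" using smooth_on_ln by (simp add: smooth_on_def)
    have ex: "smooth_on UNIV (exp :: real \<Rightarrow> real)"
      unfolding smooth_on_def
    proof
      fix k show "Ck_on k UNIV (exp :: real \<Rightarrow> real)"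
      proof (induction k)
        case (Suc k)
        show ?case
          by (rule Ck_on_SucI[where D="\<lambda>x v. exp x * v"])
             (auto intro!: derivative_eq_intros Ck_on_mult Suc Ck_on_const)
      qed (auto intro!: continuous_intros)
    qed
    have id: "Ck_on k {0<..} (\<lambda>x::real. x)"
      by (cases k) (auto simp: Ck_on_const)
    have "Ck_on k {0<..} (\<lambda>r. (r * r) * (exp (- a * ln r) * F (\<epsilon> * ln r)))"
      by (rule Ck_on_mult[OF open_greaterThan Ck_on_mult[OF open_greaterThan id id]
            Ck_on_mult[OF open_greaterThan Ck_on_compose_real[OF open_greaterThan ex Ck_on_mult[OF open_greaterThan Ck_on_const ln]]
              Ck_on_compose_real[OF open_greaterThan F(1) Ck_on_mult[OF open_greaterThan Ck_on_const ln]]]])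
    then show "Ck_on k {0<..} ?f" by (simp add: \<phi>_def power2_eq_square)
  qed
  moreover have "?f r = 0" if "r > 0" "r \<notin> {exp (- 1 / \<epsilon>)..exp (1 / \<epsilon>)}" for r
  proof -
    have "ln r < - 1 / \<epsilon> \<or> 1 / \<epsilon> < ln r"
      using that ln_less_cancel_iff[of r "exp (- 1 / \<epsilon>)"] ln_less_cancel_iff[of "exp (1 / \<epsilon>)" r]
      by (auto simp: not_le)
    then have "\<epsilon> * ln r \<notin> {-1..1}" using \<epsilon> by (auto simp: field_simps)
    then show ?thesis using F(4) by (simp add: \<phi>_def)
  qed
  ultimately have adm: "sym_tensor_field CM (h ?f)" "compact_support CM (h ?f)"
    using test_tensor_admissible[of ?f "exp (- 1 / \<epsilon>)" "exp (1 / \<epsilon>)"] by auto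
  have tr: "transverse CM CG (h ?f)"
    unfolding transverse_def using test_tensor_geometry(1)[OF \<phi>_deriv] by auto
  let ?u = "\<lambda>r. 2 * (\<nu> * ?m * (\<phi> r)\<^sup>2 / r\<^sup>2)" and ?w = "\<lambda>r. \<nu> * ((\<phi>' r)\<^sup>2 + 2 * (\<phi> r)\<^sup>2 / r\<^sup>2)"
  from cone_volume(2) obtain K where K: "K > 0" "\<forall>u. u \<in> borel_measurable borel \<longrightarrow> (\<forall>r>0. 0 \<le> u r) \<longrightarrow>
     (\<integral>p. u (fst p) \<partial>riemannian_volume CM CG) =
     K * (\<integral>r. indicator {0<..} r * (r ^ ?m * u r) \<partial>lborel)"
    by (elim exE conjE)
  have pw: "(exp (- a * ln r))\<^sup>2 * r ^ ?m = r" if "r > 0" for r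
  proof -
    have "(exp (- a * ln r))\<^sup>2 * r ^ ?m = exp (2 * (- a * ln r)) * exp (real ?m * ln r)"
      by (simp only: exp_double exp_of_nat_mult exp_ln[OF that])
    also have "\<dots> = exp (2 * (- a * ln r) + real ?m * ln r)" by (rule exp_add[symmetric])
    also have "2 * (- a * ln r) + real ?m * ln r = ln r" by (simp add: a_def field_simps)
    finally show ?thesis using that by simp
  qed
  have "(\<integral>p. 2 * scalar_at CM (\<lambda>c. Rm (CG c) (h ?f c)) p \<partial>riemannian_volume CM CG) = (\<integral>p. ?u (fst p) \<partial>riemannian_volume CM CG)"
    using test_tensor_geometry(3)[OF \<phi>_deriv]
    by (intro Bochner_Integration.integral_cong refl) (subst scalar_at_radial, auto simp: cone_volume(1))
  also have "\<dots> = K * (\<integral>r. indicator {0<..} r * (r ^ ?m * ?u r) \<partial>lborel)"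
    using \<nu>_pos by (intro K(2)[rule_format]) auto
  also have "(\<integral>r. indicator {0<..} r * (r ^ ?m * ?u r) \<partial>lborel) =
      (\<integral>r. indicator {0<..} r * ((2 * \<nu> * ?m * (F (\<epsilon> * ln r))\<^sup>2) / r) \<partial>lborel)"
  proof (intro Bochner_Integration.integral_cong refl)
    fix r :: real
    show "indicator {0<..} r * (r ^ ?m * ?u r) = indicator {0<..} r * ((2 * \<nu> * ?m * (F (\<epsilon> * ln r))\<^sup>2) / r)"
    proof (cases "r > 0")
      case True
      have "r ^ ?m * ?u r = ((exp (- a * ln r))\<^sup>2 * r ^ ?m) * (2 * \<nu> * ?m * (F (\<epsilon> * ln r))\<^sup>2) / r\<^sup>2"
        by (simp add: \<phi>_def power_mult_distrib)
      then show ?thesis using True unfolding pw[OF True] by (simp add: power2_eq_square)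
    qed simp
  qed
  also have "\<dots> = (\<integral>t. 2 * \<nu> * ?m * (F t)\<^sup>2 \<partial>lborel) / \<epsilon>"
    using F(4) by (intro integral_log_substitution[OF _ _ \<epsilon>] continuous_intros contF) auto
  finally have lhs: "(\<integral>p. 2 * scalar_at CM (\<lambda>c. Rm (CG c) (h ?f c)) p \<partial>riemannian_volume CM CG) =
     K * ((\<integral>t. 2 * \<nu> * ?m * (F t)\<^sup>2 \<partial>lborel) / \<epsilon>)" .
  have sq: "(E * X / r)\<^sup>2 + 2 * (E * Y)\<^sup>2 / r\<^sup>2 = E\<^sup>2 * (X\<^sup>2 + 2 * Y\<^sup>2) / r\<^sup>2" for E X Y r :: real
    by (simp add: power_mult_distrib power_divide add_divide_distrib distrib_left)
  have "(\<integral>p. scalar_at CM (\<lambda>c. norm_cov_deriv_sq (CG c) (h ?f c)) p \<partial>riemannian_volume CM CG) = (\<integral>p. ?w (fst p) \<partial>riemannian_volume CM CG)"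
    using test_tensor_geometry(2)[OF \<phi>_deriv]
    by (intro Bochner_Integration.integral_cong refl) (subst scalar_at_radial, auto simp: cone_volume(1))
  also have "\<dots> = K * (\<integral>r. indicator {0<..} r * (r ^ ?m * ?w r) \<partial>lborel)"
    using \<nu>_pos by (intro K(2)[rule_format]) auto
  also have "(\<integral>r. indicator {0<..} r * (r ^ ?m * ?w r) \<partial>lborel) =
      (\<integral>r. indicator {0<..} r * ((\<nu> * ((\<epsilon> * F' (\<epsilon> * ln r) - a * F (\<epsilon> * ln r))\<^sup>2 + 2 * (F (\<epsilon> * ln r))\<^sup>2)) / r) \<partial>lborel)"
  proof (intro Bochner_Integration.integral_cong refl)
    fix r :: real
    show "indicator {0<..} r * (r ^ ?m * ?w r) = indicator {0<..} r *
      ((\<nu> * ((\<epsilon> * F' (\<epsilon> * ln r) - a * F (\<epsilon> * ln r))\<^sup>2 + 2 * (F (\<epsilon> * ln r))\<^sup>2)) / r)"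
    proof (cases "r > 0")
      case True
      have "r ^ ?m * ?w r = ((exp (- a * ln r))\<^sup>2 * r ^ ?m) *
          (\<nu> * ((\<epsilon> * F' (\<epsilon> * ln r) - a * F (\<epsilon> * ln r))\<^sup>2 + 2 * (F (\<epsilon> * ln r))\<^sup>2)) / r\<^sup>2"
        unfolding \<phi>_def \<phi>'_def sq by simp
      then show ?thesis using True unfolding pw[OF True] by (simp add: power2_eq_square)
    qed simp
  qed
  also have "\<dots> = (\<integral>t. \<nu> * ((\<epsilon> * F' t - a * F t)\<^sup>2 + 2 * (F t)\<^sup>2) \<partial>lborel) / \<epsilon>"
    using F(4) by (intro integral_log_substitution[OF _ _ \<epsilon>] continuous_intros contF F(3)) auto
  finally have rhs: "(\<integral>p. scalar_at CM (\<lambda>c. norm_cov_deriv_sq (CG c) (h ?f c)) p \<partial>riemannian_volume CM CG) =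
     K * ((\<integral>t. \<nu> * ((\<epsilon> * F' t - a * F t)\<^sup>2 + 2 * (F t)\<^sup>2) \<partial>lborel) / \<epsilon>)" .
  have I: "integrable lborel (\<lambda>t. (\<epsilon> * F' t - a * F t)\<^sup>2)" "integrable lborel (\<lambda>t. (F t)\<^sup>2)"
    using F(4) by (auto intro!: continuous_bump_integrable continuous_intros contF F(3))
  have "(\<integral>t. \<nu> * ((\<epsilon> * F' t - a * F t)\<^sup>2 + 2 * (F t)\<^sup>2) \<partial>lborel) < (\<integral>t. 2 * \<nu> * ?m * (F t)\<^sup>2 \<partial>lborel)"
  proof -
    have "(\<integral>t. (\<epsilon> * F' t - a * F t)\<^sup>2 \<partial>lborel) + 2 * (\<integral>t. (F t)\<^sup>2 \<partial>lborel) < 2 * real ?m * (\<integral>t. (F t)\<^sup>2 \<partial>lborel)"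
      using less by (simp add: algebra_simps)
    from mult_strict_left_mono[OF this \<nu>_pos] show ?thesis using I by (simp add: algebra_simps)
  qed
  then have "K * ((\<integral>t. \<nu> * ((\<epsilon> * F' t - a * F t)\<^sup>2 + 2 * (F t)\<^sup>2) \<partial>lborel) / \<epsilon>) < K * ((\<integral>t. 2 * \<nu> * ?m * (F t)\<^sup>2 \<partial>lborel) / \<epsilon>)"
    using K(1) \<epsilon> by (intro mult_strict_left_mono divide_strict_right_mono)
  then have "(\<integral>p. scalar_at CM (\<lambda>c. norm_cov_deriv_sq (CG c) (h ?f c)) p \<partial>riemannian_volume CM CG) <
      (\<integral>p. 2 * scalar_at CM (\<lambda>c. Rm (CG c) (h ?f c)) p \<partial>riemannian_volume CM CG)"
    unfolding lhs rhs .
  moreover have "(\<integral>p. 2 * scalar_at CM (\<lambda>c. Rm (CG c) (h ?f c)) p \<partial>riemannian_volume CM CG) \<le>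
      (\<integral>p. scalar_at CM (\<lambda>c. norm_cov_deriv_sq (CG c) (h ?f c)) p \<partial>riemannian_volume CM CG)"
    if "stable CM CG"
    by (rule that[unfolded stable_def, THEN spec[of _ "h ?f"], THEN mp, OF conjI[OF adm(1) conjI[OF adm(2) tr]]])
  ultimately show ?thesis
    unfolding unstable_def by (meson not_less)
qed

end
end

theorem theorem1p1:
  fixes M1 :: "('i1, 'a1::{t2_space, second_countable_topology}, 'n1::finite) atlas"
    and M2 :: "('i2, 'a2::{t2_space, second_countable_topology}, 'n2::finite) atlas"
    and \<gamma>1 :: "('i1, 'n1) tensor2" and \<gamma>2 :: "('i2, 'n2) tensor2"
    and n1 n2 n :: nat
  assumes "n1 = CARD('n1)" and "n2 = CARD('n2)" and "n = n1 + n2 + 1"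
    and "closed_riemannian_manifold M1 \<gamma>1" and "closed_riemannian_manifold M2 \<gamma>2"
    and "einstein M1 \<gamma>1 (real n - 2)" and "einstein M2 \<gamma>2 (real n - 2)"
  shows "ricci_flat (cone_atlas (product_atlas M1 M2)) (cone_metric (product_metric \<gamma>1 \<gamma>2)) \<and>
    (n < 10 \<longrightarrow>
      unstable (cone_atlas (product_atlas M1 M2)) (cone_metric (product_metric \<gamma>1 \<gamma>2)))"
proof -
  interpret two_closed M1 M2 \<gamma>1 \<gamma>2
    by (intro two_closed.intro closed_riemannian.intro assms)
  have m: "real n - 2 = real CARD('n1 + 'n2) - 1" "n = CARD('n1 + 'n2) + 1"
    using assms(1-3) by simp_all
  show ?thesis
    using cone_ricci_flat[OF assms(6,7) m(1)] cone_unstable[OF assms(6,7) m(1)] m(2) by auto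
qed

end
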